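(* The degree 1 and degree 2 components of the Arnold algebra $\mathcal{A}_n$ decompose as $\mathcal{S}_n$-modules as $$\mathcal{A}^1(n)\cong V(0)_n\oplus V(1)_n\oplus V(2)_n\qquad\text{for } n\ge 4,$$ $$\mathcal{A}^2(n)\cong 2V(1)_n\oplus 2V(2)_n\oplus 2V(1,1)_n\oplus V(3)_n\oplus 2V(2,1)_n\oplus V(3,1)_n\qquad\text{for } n\ge 7.$$
   Context: All representations are over $\mathbb{Q}$. The Arnold algebra $\mathcal{A}_n$ (the rational cohomology algebra of the pure braid group $P_n$, or of the ordered configuration space of $n$ points in the plane) is the graded-commutative $\mathbb{Q}$-algebra generated by degree one elements $w_{ij}$, $1\le i<j\le n$, subject to the degree two relations $$YB_{ijk}:\quad w_{ij}w_{ik}-w_{ij}w_{jk}+w_{ik}w_{jk}=0,\qquad 1\le i<j<k\le n;$$ i.e. it is the exterior algebra on the $w_{ij}$ modulo the ideal generated by the elements $w_{ij}w_{ik}-w_{ij}w_{jk}+w_{ik}w_{jk}$. With the convention $w_{ij}=w_{ji}$, $\mathcal{S}_n$ acts by algebra automorphisms via $\pi\cdot w_{ij}=w_{\pi(i)\pi(j)}$. $\mathcal{A}^d(n)$ is the degree $d$ component of $\mathcal{A}_n$. $V_\lambda$ is the irreducible $\mathcal{S}_n$-module of the partition $\lambda$ of $n$, and $V(\mu_1,\dots,\mu_s)_n=V_{(n-\sum\mu_i,\mu_1,\dots,\mu_s)}$ (defined when $n-\sum\mu_i\ge\mu_1$); $V(0)_n=V_{(n)}$. $cV$ denotes the direct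 sum of $c$ copies of $V$. *)

theory Defs
  imports "HOL-Algebra.Algebra" "HOL-Algebra.Algebraic_Closure_Type"
    "HOL-Combinatorics.Permutations"
begin

section \<open>Modules over the symmetric group\<close>

abbreviation rationals :: "rat ring" where
  "rationals \<equiv> ring_of_type_algebra"

text \<open>The multiplicative fields \<open>mult\<close> and \<open>one\<close> inherited from the ring record only
  matter for algebras; for plain modules they are left undefined, and they play no role in
  \<open>sn_iso\<close>.\<close>

record 'v sn_module = "(rat, 'v) module" +
  act :: "(nat \<Rightarrow> nat) \<Rightarrow> 'v \<Rightarrow> 'v"

definition sn_iso :: "nat \<Rightarrow> 'v sn_module \<Rightarrow> 'w sn_module \<Rightarrow> bool" where
  "sn_iso n M N \<longleftrightarrow> (\<exists>\<phi>. \<phi> \<in> iso (add_monoid M) (add_monoid N)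
     \<and> (\<forall>c. \<forall>x\<in>carrier M. \<phi> (c \<odot>\<^bsub>M\<^esub> x) = c \<odot>\<^bsub>N\<^esub> \<phi> x)
     \<and> (\<forall>\<pi>\<in>carrier (sym_group n). \<forall>x\<in>carrier M. \<phi> (act M \<pi> x) = act N \<pi> (\<phi> x)))"

text \<open>The external direct sum of a list of modules; its elements are the lists whose
  \<open>i\<close>-th entry lies in the \<open>i\<close>-th module.\<close>

definition direct_sum :: "'v sn_module list \<Rightarrow> 'v list sn_module" where
  "direct_sum Ms = \<lparr>
     carrier = listset (map carrier Ms),
     monoid.mult = undefined,
     monoid.one = undefined,
     ring.zero = map ring.zero Ms,
     ring.add = (\<lambda>xs ys. map (\<lambda>(M, x, y). x \<oplus>\<^bsub>M\<^esub> y) (zip Ms (zip xs ys))),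
     module.smult = (\<lambda>c xs. map2 (\<lambda>M x. c \<odot>\<^bsub>M\<^esub> x) Ms xs),
     act = (\<lambda>\<pi> xs. map2 (\<lambda>M x. act M \<pi> x) Ms xs)\<rparr>"

definition submodule_generated :: "'v sn_module \<Rightarrow> 'v set \<Rightarrow> 'v set" where
  "submodule_generated M S = \<Inter>{H. submodule H rationals M \<and> S \<subseteq> H}"

text \<open>The rational vector space with basis \<open>B\<close>, a set of lists of subsets of
  \<open>{1..n}\<close> that is stable under permutations of \<open>{1..n}\<close>. A permutation sends the basis
  element \<open>[A\<^sub>1, \<dots>, A\<^sub>k]\<close> to \<open>[\<pi>(A\<^sub>1), \<dots>, \<pi>(A\<^sub>k)]\<close>. On coefficient functions
  this is precomposition with the inverse. Both words in the generators of the Arnold algebra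
  and tabloids are lists of this kind.\<close>

definition permutation_module :: "nat set list set \<Rightarrow> (nat set list \<Rightarrow> rat) sn_module" where
  "permutation_module B = \<lparr>
     carrier = {f. finite {u. f u \<noteq> 0} \<and> {u. f u \<noteq> 0} \<subseteq> B},
     monoid.mult = undefined,
     monoid.one = undefined,
     ring.zero = (\<lambda>u. 0),
     ring.add = (\<lambda>f g u. f u + g u),
     module.smult = (\<lambda>c f u. c * f u),
     act = (\<lambda>\<pi> f u. f (map (image (Hilbert_Choice.inv \<pi>)) u))\<rparr>"

definition basis_vector :: "nat set list \<Rightarrow> nat set list \<Rightarrow> rat" where
  "basis_vector u = (\<lambda>v. if v = u then 1 else 0)"


section \<open>The Arnold algebra\<close>

text \<open>The generator \<open>w\<^sub>i\<^sub>j\<close> is indexed by the two-element set \<open>{i, j}\<close>, which builds in the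
  convention \<open>w\<^sub>i\<^sub>j = w\<^sub>j\<^sub>i\<close>. The tensor algebra has the words in the generators as a basis,
  multiplied by concatenation.\<close>

definition generators :: "nat \<Rightarrow> nat set set" where
  "generators n = {{i, j} |i j. 1 \<le> i \<and> i < j \<and> j \<le> n}"

definition tensor_algebra :: "nat \<Rightarrow> (nat set list \<Rightarrow> rat) sn_module" where
  "tensor_algebra n = (permutation_module (lists (generators n)))\<lparr>
     monoid.mult := (\<lambda>f g u. \<Sum>k\<le>length u. f (take k u) * g (drop k u)),
     monoid.one := basis_vector []\<rparr>"

definition tensor_component :: "nat \<Rightarrow> nat \<Rightarrow> (nat set list \<Rightarrow> rat) set" where
  "tensor_component d n =
     {f \<in> carrier (tensor_algebra n). \<forall>u. f u \<noteq> 0 \<longrightarrow> length u = d}"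

definition w_gen :: "nat \<Rightarrow> nat \<Rightarrow> nat set list \<Rightarrow> rat" where
  "w_gen i j = basis_vector [{i, j}]"

definition YB :: "nat \<Rightarrow> nat \<Rightarrow> nat \<Rightarrow> nat \<Rightarrow> nat set list \<Rightarrow> rat" where
  "YB n i j k = (let T = tensor_algebra n in
     w_gen i j \<otimes>\<^bsub>T\<^esub> w_gen i k \<ominus>\<^bsub>T\<^esub> w_gen i j \<otimes>\<^bsub>T\<^esub> w_gen j k \<oplus>\<^bsub>T\<^esub> w_gen i k \<otimes>\<^bsub>T\<^esub> w_gen j k)"

text \<open>The first family consists of the defining relations of the exterior algebra.\<close>

definition arnold_relations :: "nat \<Rightarrow> (nat set list \<Rightarrow> rat) set" where
  "arnold_relations n =
     {v \<otimes>\<^bsub>tensor_algebra n\<^esub> v |v. v \<in> tensor_component 1 n}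
     \<union> {YB n i j k |i j k. 1 \<le> i \<and> i < j \<and> j < k \<and> k \<le> n}"

definition arnold_ideal :: "nat \<Rightarrow> (nat set list \<Rightarrow> rat) set" where
  "arnold_ideal n = Idl\<^bsub>tensor_algebra n\<^esub> (arnold_relations n)"

text \<open>The ring structure is that of the quotient ring. The library quotient carries no scalar
  multiplication, so both this and the action are spelled out: they are induced from the tensor
  algebra, a permutation mapping the coset \<open>C\<close> to the coset \<open>\<pi>(C)\<close>.\<close>

definition arnold_algebra :: "nat \<Rightarrow> (nat set list \<Rightarrow> rat) set sn_module" where
  "arnold_algebra n =
     (let T = tensor_algebra n; I = arnold_ideal n; Q = T Quot I in
      \<lparr>carrier = carrier Q,
       monoid.mult = monoid.mult Q,
       monoid.one = monoid.one Q,
       ring.zero = ring.zero Q,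
       ring.add = ring.add Q,
       module.smult = (\<lambda>c C. \<Union>x\<in>C. I +>\<^bsub>T\<^esub> (c \<odot>\<^bsub>T\<^esub> x)),
       act = (\<lambda>\<pi> C. act T \<pi> ` C)\<rparr>)"

definition arnold_component :: "nat \<Rightarrow> nat \<Rightarrow> (nat set list \<Rightarrow> rat) set sn_module" where
  "arnold_component d n = (arnold_algebra n)\<lparr>carrier :=
     (\<lambda>f. arnold_ideal n +>\<^bsub>tensor_algebra n\<^esub> f) ` tensor_component d n\<rparr>"


section \<open>Irreducible modules of the symmetric group\<close>

text \<open>The irreducible module of a partition is realised as its Specht module. A partition is the
  list of its parts in weakly decreasing order; the cell \<open>(r, c)\<close> lies in row \<open>r\<close> and column
  \<open>c\<close>, both counted from \<open>0\<close>.\<close>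

definition cells :: "nat list \<Rightarrow> (nat \<times> nat) set" where
  "cells p = {(r, c). r < length p \<and> c < p ! r}"

definition tableaux :: "nat list \<Rightarrow> (nat \<times> nat \<Rightarrow> nat) set" where
  "tableaux p = {t. bij_betw t (cells p) {1..sum_list p}}"

text \<open>A tabloid is a tableau up to permutations within the rows, that is, its list of row
  contents.\<close>

definition tabloid :: "nat list \<Rightarrow> (nat \<times> nat \<Rightarrow> nat) \<Rightarrow> nat set list" where
  "tabloid p t = map (\<lambda>r. {t (r, c) |c. c < p ! r}) [0..<length p]"

definition column_stabilizer :: "nat list \<Rightarrow> (nat \<times> nat \<Rightarrow> nat) \<Rightarrow> (nat \<Rightarrow> nat) set" where
  "column_stabilizer p t = {\<sigma>. \<sigma> permutes {1..sum_list p}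
     \<and> (\<forall>c. \<sigma> ` {t (r, c) |r. (r, c) \<in> cells p} = {t (r, c) |r. (r, c) \<in> cells p})}"

definition polytabloid :: "nat list \<Rightarrow> (nat \<times> nat \<Rightarrow> nat) \<Rightarrow> nat set list \<Rightarrow> rat" where
  "polytabloid p t = (\<lambda>u. \<Sum>\<sigma>\<in>column_stabilizer p t.
     of_int (sign \<sigma>) * basis_vector (tabloid p (\<sigma> \<circ> t)) u)"

definition specht :: "nat list \<Rightarrow> (nat set list \<Rightarrow> rat) sn_module" where
  "specht p = (let M = permutation_module (tabloid p ` tableaux p) in
     M\<lparr>carrier := submodule_generated M (polytabloid p ` tableaux p)\<rparr>)"

text \<open>\<open>V n [\<mu>\<^sub>1, \<dots>, \<mu>\<^sub>s]\<close> is \<open>V(\<mu>\<^sub>1, \<dots>, \<mu>\<^sub>s)\<^sub>n\<close>. It is meaningful only if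
  \<open>n - sum_list \<mu> \<ge> \<mu>\<^sub>1\<close>. Zero parts are dropped, so that \<open>V n [0]\<close> belongs to the
  partition \<open>[n]\<close>.\<close>

definition V :: "nat \<Rightarrow> nat list \<Rightarrow> (nat set list \<Rightarrow> rat) sn_module" where
  "V n \<mu> = specht ((n - sum_list \<mu>) # filter (\<lambda>k. k \<noteq> 0) \<mu>)"

end

theory Submission
  imports Defs
begin

text \<open>Functions on colorings of \<open>{1..n}\<close> by rows carry operators that recolor one entry; these are the
  matrix units of \<open>gl\<close>, and transposed matrix units are adjoint. A branching argument that removes
  the entry \<open>n\<close> identifies the Specht module of \<open>p\<close> with the functions of weight \<open>p\<close> killed by all
  raising operators. Consequently the functions on \<open>k\<close>-subsets are the lowered functions on
  \<open>(k - 1)\<close>-subsets plus \<open>V(k)\<close>. Similarly, let \<open>W\<^sub>k\<close> consist of the functions \<open>f (x, K)\<close>, for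
  \<open>x \<in> K\<close> and \<open>card K = k + 1\<close>, whose sums over \<open>x \<in> K\<close> vanish: then
  \<open>W\<^sub>k = W\<^bsub>k - 1\<^esub> + V(k) + V(k, 1)\<close> and \<open>W\<^sub>0 = 0\<close>.

  The degree one component of the Arnold algebra is the space of functions on 2-subsets. Sending
  \<open>w\<^sub>A w\<^sub>B\<close> to the function \<open>1\<^sub>A - 1\<^sub>B\<close> on \<open>K = A \<union> B\<close> identifies the degree two component with
  \<open>W\<^sub>2 + W\<^sub>3\<close>: products with \<open>card K = 3\<close> give \<open>W\<^sub>2\<close>, and products with \<open>card K = 4\<close> give \<open>W\<^sub>3\<close>.\<close>

section \<open>Linear algebra of functions on colorings\<close>

text \<open>The obstacle is that a Specht module is given by generators, while the pieces of a
  decomposition arise as solutions of linear equations. Describing it by raising operators removes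
  it: the form with orthonormal colorings is positive definite over the rationals, so the orthogonal
  complement of a lowered space is the kernel of the adjoint raising operator. Unrolling the
  recursion from \<open>W\<^sub>0 = 0\<close> puts V(1), V(1,1), V(2) and V(2,1) once into each of
  \<open>W\<^sub>2\<close> and \<open>W\<^sub>3\<close>, but V(3) and V(3,1) only into
  \<open>W\<^sub>3\<close>, whence the multiplicities. The bounds 4 and 7 mark where
  \<open>[n - 2, 2]\<close> and \<open>[n - 4, 3, 1]\<close> become partitions. In degree two the
  map to functions kills the ideal, which bounds the component from below; it has a section to which
  every word reduces modulo the relations, which bounds it from above. On three points, three
  anticommuting products modulo one relation form the standard module of dimension two; on four
  points, the three products of disjoint generators form the standard module of dimension three. In
  both cases these are the functions on \<open>K\<close> with sum zero.\<close>

definition lin :: "('a \<Rightarrow> rat) set \<Rightarrow> bool" where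
  "lin S \<longleftrightarrow> (\<lambda>_. 0) \<in> S \<and> (\<forall>f\<in>S. \<forall>g\<in>S. \<forall>a b. (\<lambda>x. a * f x + b * g x) \<in> S)"

lemma linI:
  assumes "(\<lambda>_. 0) \<in> S" "\<And>f g a b. f \<in> S \<Longrightarrow> g \<in> S \<Longrightarrow> (\<lambda>x. a * f x + b * g x) \<in> S"
  shows "lin S"
  using assms by (auto simp: lin_def)

lemma lin_zero: "lin S \<Longrightarrow> (\<lambda>_. 0) \<in> S"
  by (simp add: lin_def)

lemma lin_comb: "lin S \<Longrightarrow> f \<in> S \<Longrightarrow> g \<in> S \<Longrightarrow> (\<lambda>x. a * f x + b * g x) \<in> S"
  by (simp add: lin_def)

lemma lin_add: "lin S \<Longrightarrow> f \<in> S \<Longrightarrow> g \<in> S \<Longrightarrow> (\<lambda>x. f x + g x) \<in> S"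
  using lin_comb[of S f g 1 1] by simp

lemma lin_diff: "lin S \<Longrightarrow> f \<in> S \<Longrightarrow> g \<in> S \<Longrightarrow> (\<lambda>x. f x - g x) \<in> S"
  using lin_comb[of S f g 1 "-1"] by simp

lemma lin_scale: "lin S \<Longrightarrow> f \<in> S \<Longrightarrow> (\<lambda>x. a * f x) \<in> S"
  using lin_comb[of S f f a 0] by simp

lemma lin_sum:
  assumes "lin S" "finite A" "\<And>a. a \<in> A \<Longrightarrow> f a \<in> S"
  shows "(\<lambda>x. \<Sum>a\<in>A. f a x) \<in> S"
  using assms(2,3)
proof (induction A rule: finite_induct)
  case empty
  then show ?case using lin_zero[OF assms(1)] by simp
next
  case (insert a A)
  then have "(\<lambda>x. f a x + (\<Sum>a\<in>A. f a x)) \<in> S"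
    using lin_add[OF assms(1), of "f a" "\<lambda>x. \<Sum>a\<in>A. f a x"] by simp
  then show ?case using insert.hyps by simp
qed

text \<open>Squares of rationals are nonnegative, so the standard form is positive definite; the
  orthogonality arguments below rest on this.\<close>

lemma sum_mult_self_eq_0:
  fixes f :: "'a \<Rightarrow> rat"
  assumes "finite Y" "(\<Sum>y\<in>Y. f y * f y) = 0" "y \<in> Y"
  shows "f y = 0"
proof -
  have "\<forall>y\<in>Y. f y * f y = 0"
    using assms(1,2) sum_nonneg_eq_0_iff[of Y "\<lambda>y. f y * f y"] by simp
  then show ?thesis using assms(3) by simp
qed

text \<open>Gram-Schmidt on the coordinates: if some \<open>s\<^sub>0 \<in> S\<close> is nonzero at \<open>y\<close>, then \<open>S\<close> is spanned
  by \<open>s\<^sub>0\<close> and the subspace of the elements that vanish at \<open>y\<close>.\<close>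

lemma orthogonal_projection:
  fixes f :: "'a \<Rightarrow> rat"
  assumes "finite Y" "lin S" "\<And>s x. s \<in> S \<Longrightarrow> x \<notin> Y \<Longrightarrow> s x = 0"
  obtains s where "s \<in> S" "\<And>s'. s' \<in> S \<Longrightarrow> (\<Sum>x\<in>Y. (f x - s x) * s' x) = 0"
proof -
  have "\<exists>s\<in>S. \<forall>s'\<in>S. (\<Sum>x\<in>Y. (f x - s x) * s' x) = 0"
    using assms
  proof (induction Y arbitrary: S f rule: finite_induct)
    case empty
    then show ?case using lin_zero by fastforce
  next
    case (insert y Y)
    have split: "(\<Sum>x\<in>insert y Y. g x) = (\<Sum>x\<in>Y. g x)" if "g y = 0" for g :: "'a \<Rightarrow> rat"
      using insert.hyps that by simp
    define S' where "S' = {s\<in>S. s y = 0}"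
    have linS': "lin S'"
      using insert.prems(1) by (auto simp: lin_def S'_def)
    have supp': "s x = 0" if "s \<in> S'" "x \<notin> Y" for s x
      using that insert.prems(2)[of s x] by (auto simp: S'_def)
    have proj': "\<exists>s\<in>S'. \<forall>s'\<in>S'. (\<Sum>x\<in>insert y Y. (g x - s x) * s' x) = 0" for g
    proof -
      obtain s where s: "s \<in> S'" "\<forall>s'\<in>S'. (\<Sum>x\<in>Y. (g x - s x) * s' x) = 0"
        using insert.IH[of S' g, OF linS'] supp' by blast
      have "(\<Sum>x\<in>insert y Y. (g x - s x) * s' x) = 0" if "s' \<in> S'" for s'
        using s(2) that split[of "\<lambda>x. (g x - s x) * s' x"] by (simp add: S'_def)
      with s(1) show ?thesis by blast
    qed
    show ?case
    proof (cases "\<forall>s\<in>S. s y = 0")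
      case True
      then have "S' = S" by (auto simp: S'_def)
      then show ?thesis using proj'[of f] by blast
    next
      case False
      then obtain s0 where s0: "s0 \<in> S" "s0 y \<noteq> 0" by blast
      obtain u where u: "u \<in> S'" "\<forall>s'\<in>S'. (\<Sum>x\<in>insert y Y. (s0 x - u x) * s' x) = 0"
        using proj' by blast
      \<comment> \<open>Elements of \<open>S'\<close> vanish at \<open>y\<close>, so subtracting
        \<open>u\<close> keeps the value at \<open>y\<close>: \<open>s1\<close> is a nonzero vector
        orthogonal to \<open>S'\<close>.\<close>
      define s1 where "s1 = (\<lambda>x. s0 x - u x)"
      have s1: "s1 \<in> S" "s1 y \<noteq> 0"
        using lin_diff[OF insert.prems(1) s0(1), of u] u(1) s0(2) by (auto simp: S'_def s1_def)
      define N where "N = (\<Sum>x\<in>insert y Y. s1 x * s1 x)"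
      have N: "N \<noteq> 0"
        using sum_mult_self_eq_0[of "insert y Y" s1 y] insert.hyps s1(2) by (auto simp: N_def)
      obtain w where w: "w \<in> S'" "\<forall>s'\<in>S'. (\<Sum>x\<in>insert y Y. (f x - w x) * s' x) = 0"
        using proj' by blast
      have s1_perp: "(\<Sum>x\<in>insert y Y. s1 x * s' x) = 0" if "s' \<in> S'" for s'
        using u(2) that by (simp add: s1_def)
      define a where "a = (\<Sum>x\<in>insert y Y. f x * s1 x) / N"
      \<comment> \<open>\<open>w\<close> is the projection of \<open>f\<close> to \<open>S'\<close>
        and \<open>a\<close> its coefficient along \<open>s1\<close>. Every element of
        \<open>S\<close> has the form \<open>v + b * s1\<close> with \<open>v\<close> in
        \<open>S'\<close>, so it remains to test against \<open>S'\<close> and \<open>s1\<close>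
        separately.\<close>
      define s where "s = (\<lambda>x. 1 * w x + a * s1 x)"
      have sS: "s \<in> S"
        unfolding s_def using lin_comb[OF insert.prems(1) _ s1(1), of w 1 a] w(1)
        by (simp only: S'_def mem_Collect_eq)
      have "(\<Sum>x\<in>insert y Y. (f x - s x) * s' x) = 0" if s': "s' \<in> S" for s'
      proof -
        define b where "b = s' y / s1 y"
        define v where "v = (\<lambda>x. 1 * s' x + (- b) * s1 x)"
        have v: "v \<in> S'"
          unfolding v_def using lin_comb[OF insert.prems(1) s' s1(1), of 1 "- b"] s1(2)
          by (simp add: S'_def b_def)
        have "(\<Sum>x\<in>insert y Y. (f x - s x) * s' x)
          = (\<Sum>x\<in>insert y Y. ((f x - w x) * v x - a * (s1 x * v x)) +
              b * (f x * s1 x - s1 x * w x - a * (s1 x * s1 x)))"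
          by (rule sum.cong[OF refl]) (simp add: s_def v_def algebra_simps)
        also have "\<dots> = ((\<Sum>x\<in>insert y Y. (f x - w x) * v x) - a * (\<Sum>x\<in>insert y Y. s1 x * v x)) +
              b * ((\<Sum>x\<in>insert y Y. f x * s1 x) - (\<Sum>x\<in>insert y Y. s1 x * w x)
                - a * (\<Sum>x\<in>insert y Y. s1 x * s1 x))"
          by (simp only: sum.distrib sum_subtractf sum_distrib_left[symmetric])
        also have "\<dots> = 0"
          using w v s1_perp N by (simp add: a_def N_def[symmetric])
        finally show ?thesis .
      qed
      with sS show ?thesis by blast
    qed
  qed
  then show ?thesis using that by blast
qed

text \<open>The matrix unit e_ij acting on the n-th tensor power of a space with basis the colors,
  in terms of coefficient functions: a basis tensor with a factor \<open>j\<close> contributes to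
  those with this factor replaced by \<open>i\<close>. Thus the function gains an entry of color
  \<open>i\<close> and loses one of color \<open>j\<close>, opposite to the recoloring of its
  argument. The notation e_ij is used below for \<open>move n i j\<close>.\<close>

definition move :: "nat \<Rightarrow> nat \<Rightarrow> nat \<Rightarrow> ((nat \<Rightarrow> nat) \<Rightarrow> rat) \<Rightarrow> (nat \<Rightarrow> nat) \<Rightarrow> rat" where
  "move n i j f c = (\<Sum>y | y \<in> {1..n} \<and> c y = i. f (c(y := j)))"

lemma move_add: "move n i j (\<lambda>c. f c + g c) = (\<lambda>c. move n i j f c + move n i j g c)"
  by (simp add: move_def sum.distrib fun_eq_iff)

lemma move_diff: "move n i j (\<lambda>c. f c - g c) = (\<lambda>c. move n i j f c - move n i j g c)"
  by (simp add: move_def sum_subtractf fun_eq_iff)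

lemma move_scale: "move n i j (\<lambda>c. a * f c) = (\<lambda>c. a * move n i j f c)"
  by (simp add: move_def sum_distrib_left fun_eq_iff)

lemma move_zero: "move n i j (\<lambda>c. 0) = (\<lambda>c. 0)"
  by (simp add: move_def fun_eq_iff)

lemmas move_linear = move_add move_diff move_scale move_zero

text \<open>Permuting the tensor factors commutes with the action of gl. Everything built from
  \<open>move\<close> is therefore equivariant.\<close>

lemma move_perm:
  assumes "\<pi> permutes {1..n}"
  shows "move n i j (\<lambda>c. f (c \<circ> \<pi>)) = (\<lambda>c. move n i j f (c \<circ> \<pi>))"
proof
  fix c
  have inj: "inj \<pi>" using assms by (rule permutes_inj)
  show "move n i j (\<lambda>c. f (c \<circ> \<pi>)) c = move n i j f (c \<circ> \<pi>)"
    unfolding move_def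
  proof (rule sum.reindex_bij_witness[of _ \<pi> "Hilbert_Choice.inv \<pi>"])
    fix y assume y: "y \<in> {y. y \<in> {1..n} \<and> c y = i}"
    show "\<pi> (Hilbert_Choice.inv \<pi> y) = y"
      using permutes_inverses(1)[OF assms] by simp
    show "Hilbert_Choice.inv \<pi> y \<in> {y. y \<in> {1..n} \<and> (c \<circ> \<pi>) y = i}"
      using y permutes_in_image[OF permutes_inv[OF assms]] permutes_inverses(1)[OF assms] by simp
    have "(c \<circ> \<pi>)(Hilbert_Choice.inv \<pi> y := j) = c(y := j) \<circ> \<pi>"
      using permutes_inverses[OF assms] by (auto simp: fun_eq_iff)
    then show "f ((c \<circ> \<pi>)(Hilbert_Choice.inv \<pi> y := j)) = f (c(y := j) \<circ> \<pi>)" by simp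
  next
    fix y assume y: "y \<in> {y. y \<in> {1..n} \<and> (c \<circ> \<pi>) y = i}"
    show "Hilbert_Choice.inv \<pi> (\<pi> y) = y"
      using permutes_inverses(2)[OF assms] by simp
    show "\<pi> y \<in> {y. y \<in> {1..n} \<and> c y = i}"
      using y permutes_in_image[OF assms] by simp
  qed
qed

text \<open>The part of a product of two recolorings that touches two different entries. Recolorings
  of different entries commute, so this part cancels in commutators.\<close>

definition exchange :: "nat \<Rightarrow> nat \<Rightarrow> nat \<Rightarrow> nat \<Rightarrow> nat \<Rightarrow> ((nat \<Rightarrow> nat) \<Rightarrow> rat) \<Rightarrow> (nat \<Rightarrow> nat) \<Rightarrow> rat"
  where "exchange n i j k l f c =
    (\<Sum>y | y \<in> {1..n} \<and> c y = i. \<Sum>z | z \<in> {1..n} \<and> c z = k \<and> z \<noteq> y. f (c(y := j, z := l)))"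

lemma exchange_sym: "exchange n i j k l f c = exchange n k l i j f c"
proof -
  have "exchange n i j k l f c =
      (\<Sum>(y, z) \<in> {(y, z). y \<in> {1..n} \<and> z \<in> {1..n} \<and> c y = i \<and> c z = k \<and> z \<noteq> y}. f (c(y := j, z := l)))"
    for i j k l
    unfolding exchange_def by (subst sum.Sigma) (auto intro!: sum.cong)
  note eq = this
  show ?thesis
    unfolding eq[of i j k l] eq[of k l i j]
    by (rule sum.reindex_bij_witness[of _ "\<lambda>(y, z). (z, y)" "\<lambda>(y, z). (z, y)"])
      (auto simp: fun_upd_twist)
qed

text \<open>The inner operator recolors either the entry \<open>y\<close> just given color
  \<open>j\<close>, which requires \<open>j = k\<close>, or another entry.\<close>

lemma move_move: "move n i j (move n k l f) c
  = (if j = k then move n i l f c else 0) + exchange n i j k l f c"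
proof -
  have "move n k l f (c(y := j)) = (if j = k then f (c(y := l)) else 0)
      + (\<Sum>z | z \<in> {1..n} \<and> c z = k \<and> z \<noteq> y. f (c(y := j, z := l)))" if "y \<in> {1..n}" for y
  proof (cases "j = k")
    case True
    have "{z. z \<in> {1..n} \<and> (c(y := j)) z = k} = insert y {z. z \<in> {1..n} \<and> c z = k \<and> z \<noteq> y}"
      using that True by auto
    then show ?thesis using True by (simp add: move_def)
  next
    case False
    have "{z. z \<in> {1..n} \<and> (c(y := j)) z = k} = {z. z \<in> {1..n} \<and> c z = k \<and> z \<noteq> y}"
      using that False by auto
    then show ?thesis using False by (simp add: move_def)
  qed
  then have "move n i j (move n k l f) c
    = (\<Sum>y | y \<in> {1..n} \<and> c y = i. (if j = k then f (c(y := l)) else 0)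
      + (\<Sum>z | z \<in> {1..n} \<and> c z = k \<and> z \<noteq> y. f (c(y := j, z := l))))"
    unfolding move_def[of n i j] by (intro sum.cong) auto
  then show ?thesis
    by (simp add: sum.distrib exchange_def move_def)
qed

text \<open>The operators \<open>move n i j\<close> satisfy the relations of the matrix units \<open>e\<^sub>i\<^sub>j\<close> of \<open>gl\<close>.\<close>

lemma move_commute: "move n i j (move n k l f) c + (if i = l then move n k j f c else 0)
  = move n k l (move n i j f) c + (if j = k then move n i l f c else 0)"
  using move_move[of n i j k l f c] move_move[of n k l i j f c] exchange_sym[of n i j k l f c] by simp

lemma move_self: "move n i i f c = of_nat (card {y \<in> {1..n}. c y = i}) * f c"
proof -
  have "move n i i f c = (\<Sum>y | y \<in> {1..n} \<and> c y = i. f c)"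
    unfolding move_def by (rule sum.cong) (auto simp: fun_upd_idem)
  then show ?thesis by simp
qed

text \<open>A tabloid is encoded as the coloring that sends every entry of \<open>{1..n}\<close> to its row;
  colorings are \<open>0\<close> outside \<open>{1..n}\<close>.\<close>

definition colorings :: "nat \<Rightarrow> nat \<Rightarrow> (nat \<Rightarrow> nat) set" where
  "colorings n m = {c. (\<forall>y. y \<notin> {1..n} \<longrightarrow> c y = 0) \<and> (\<forall>y. c y < m)}"

lemma finite_colorings: "finite (colorings n m)"
proof (rule finite_subset)
  show "colorings n m \<subseteq> {c. \<forall>y. (y \<in> {1..n} \<longrightarrow> c y \<in> {..<m}) \<and> (y \<notin> {1..n} \<longrightarrow> c y = 0)}"
    by (auto simp: colorings_def)
  show "finite {c. \<forall>y. (y \<in> {1..n} \<longrightarrow> c y \<in> {..<m}) \<and> (y \<notin> {1..n} \<longrightarrow> c y = 0)}"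
    by (rule finite_set_of_finite_funs) auto
qed

lemma colorings_upd: "c \<in> colorings n m \<Longrightarrow> y \<in> {1..n} \<Longrightarrow> j < m \<Longrightarrow> c(y := j) \<in> colorings n m"
  by (auto simp: colorings_def)

lemma colorings_upd_iff: "y \<in> {1..n} \<Longrightarrow> j < m \<Longrightarrow> c y < m \<Longrightarrow>
    c(y := j) \<in> colorings n m \<longleftrightarrow> c \<in> colorings n m"
  using colorings_upd[of c n m y j] colorings_upd[of "c(y := j)" n m y "c y"] by auto

section \<open>Inner product, weight spaces and highest weight vectors\<close>

definition ip :: "nat \<Rightarrow> nat \<Rightarrow> ((nat \<Rightarrow> nat) \<Rightarrow> rat) \<Rightarrow> ((nat \<Rightarrow> nat) \<Rightarrow> rat) \<Rightarrow> rat" where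
  "ip n m f g = (\<Sum>c\<in>colorings n m. f c * g c)"

lemma ip_sym: "ip n m f g = ip n m g f"
  by (simp add: ip_def mult.commute)

lemma ip_linear:
  "ip n m (\<lambda>c. f c + h c) g = ip n m f g + ip n m h g"
  "ip n m (\<lambda>c. f c - h c) g = ip n m f g - ip n m h g"
  "ip n m (\<lambda>c. a * f c) g = a * ip n m f g"
  "ip n m (\<lambda>c. - f c) g = - ip n m f g"
  "ip n m (\<lambda>c. 0) g = 0"
  by (simp_all add: ip_def algebra_simps sum.distrib sum_subtractf sum_distrib_left sum_negf)

lemma ip_nonneg: "ip n m f f \<ge> 0"
  by (simp add: ip_def sum_nonneg)

lemma ip_self_eq_0: "ip n m f f = 0 \<Longrightarrow> c \<in> colorings n m \<Longrightarrow> f c = 0"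
  using sum_mult_self_eq_0[OF finite_colorings, of f n m c] by (simp add: ip_def)

text \<open>Recoloring \<open>y\<close> is a bijection between the pairs \<open>(c, y)\<close> with
  \<open>c y = i\<close> and those with \<open>c y = j\<close>. The bounds on \<open>i\<close> and
  \<open>j\<close> keep the recolored functions inside the range of summation.\<close>

lemma ip_move:
  assumes "i < m" "j < m"
  shows "ip n m (move n i j f) g = ip n m f (move n j i g)"
proof -
  have "ip n m (move n i j f) g =
      (\<Sum>(c, y) \<in> {(c, y). c \<in> colorings n m \<and> y \<in> {1..n} \<and> c y = i}. f (c(y := j)) * g c)"
    unfolding ip_def move_def sum_distrib_right
    by (subst sum.Sigma) (auto intro!: sum.cong simp: finite_colorings)
  also have "\<dots> = (\<Sum>(c, y) \<in> {(c, y). c \<in> colorings n m \<and> y \<in> {1..n} \<and> c y = j}. f c * g (c(y := i)))"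
    by (rule sum.reindex_bij_witness[of _ "\<lambda>(c, y). (c(y := i), y)" "\<lambda>(c, y). (c(y := j), y)"])
      (auto simp: fun_upd_idem intro!: colorings_upd assms)
  also have "\<dots> = ip n m f (move n j i g)"
    unfolding ip_def move_def sum_distrib_left
    by (subst sum.Sigma) (auto intro!: sum.cong simp: finite_colorings)
  finally show ?thesis .
qed

definition wt :: "nat \<Rightarrow> nat list \<Rightarrow> (nat \<Rightarrow> nat) set" where
  "wt n p = {c \<in> colorings n (length p). \<forall>r < length p. card {y \<in> {1..n}. c y = r} = p ! r}"

definition wspace :: "nat \<Rightarrow> nat list \<Rightarrow> ((nat \<Rightarrow> nat) \<Rightarrow> rat) set" where
  "wspace n p = {f. \<forall>c. f c \<noteq> 0 \<longrightarrow> c \<in> wt n p}"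

text \<open>Highest weight vectors of weight \<open>p\<close>. Only the simple raising operators are
  imposed; e_ij with \<open>i < j\<close> is an iterated commutator of these and vanishes as
  well.\<close>

definition kern :: "nat \<Rightarrow> nat list \<Rightarrow> ((nat \<Rightarrow> nat) \<Rightarrow> rat) set" where
  "kern n p = {f \<in> wspace n p. \<forall>i. Suc i < length p \<longrightarrow> move n i (Suc i) f = (\<lambda>c. 0)}"

lemma wt_colorings: "c \<in> wt n p \<Longrightarrow> c \<in> colorings n (length p)"
  by (simp add: wt_def)

lemma wspace_outside: "f \<in> wspace n p \<Longrightarrow> c \<notin> wt n p \<Longrightarrow> f c = 0"
  by (auto simp: wspace_def)

lemma lin_wspace: "lin (wspace n p)"
proof (rule linI)
  fix f g a b assume "f \<in> wspace n p" "g \<in> wspace n p"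
  then have "a * f c + b * g c = 0" if "c \<notin> wt n p" for c
    using that by (simp add: wspace_outside)
  then show "(\<lambda>c. a * f c + b * g c) \<in> wspace n p"
    by (auto simp: wspace_def)
qed (simp add: wspace_def)

lemma lin_kern: "lin (kern n p)"
proof (rule linI)
  show "(\<lambda>_. 0) \<in> kern n p"
    using lin_zero[OF lin_wspace] by (simp add: kern_def move_linear)
next
  fix f g a b assume "f \<in> kern n p" "g \<in> kern n p"
  then show "(\<lambda>c. a * f c + b * g c) \<in> kern n p"
    using lin_comb[OF lin_wspace] by (simp add: kern_def move_linear)
qed

lemma kern_wspace: "f \<in> kern n p \<Longrightarrow> f \<in> wspace n p"
  by (simp add: kern_def)

lemma ip_self_wspace_eq_0:
  assumes "f \<in> wspace n p" "ip n (length p) f f = 0"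
  shows "f = (\<lambda>c. 0)"
proof
  fix c show "f c = 0"
    using ip_self_eq_0[OF assms(2), of c] wt_colorings[of c n p] wspace_outside[OF assms(1), of c]
    by blast
qed

lemma card_col_upd:
  fixes c :: "nat \<Rightarrow> nat"
  assumes "y \<in> {1..n}" "c y = i" "i \<noteq> j"
  shows "card {z \<in> {1..n}. c z = i} = Suc (card {z \<in> {1..n}. (c(y := j)) z = i})"
    and "card {z \<in> {1..n}. (c(y := j)) z = j} = Suc (card {z \<in> {1..n}. c z = j})"
    and "r \<noteq> i \<Longrightarrow> r \<noteq> j \<Longrightarrow> {z \<in> {1..n}. (c(y := j)) z = r} = {z \<in> {1..n}. c z = r}"
proof -
  have fin: "finite {z \<in> {1..n}. P z}" for P by simp
  have *: "{z \<in> {1..n}. c z = i} = insert y {z \<in> {1..n}. (c(y := j)) z = i}"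
    using assms by auto
  show "card {z \<in> {1..n}. c z = i} = Suc (card {z \<in> {1..n}. (c(y := j)) z = i})"
    unfolding * using assms(2,3) fin by (subst card_insert_disjoint) auto
  have **: "{z \<in> {1..n}. (c(y := j)) z = j} = insert y {z \<in> {1..n}. c z = j}"
    using assms by auto
  show "card {z \<in> {1..n}. (c(y := j)) z = j} = Suc (card {z \<in> {1..n}. c z = j})"
    unfolding ** using assms(2,3) fin by (subst card_insert_disjoint) auto
  show "{z \<in> {1..n}. (c(y := j)) z = r} = {z \<in> {1..n}. c z = r}" if "r \<noteq> i" "r \<noteq> j"
    using that assms by auto
qed

lemma wt_upd:
  assumes "c(y := j) \<in> wt n p" "y \<in> {1..n}" "c y = i" "i \<noteq> j" "i < length p" "j < length p"
    and "length q = length p" "q ! i = Suc (p ! i)" "p ! j = Suc (q ! j)"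
    and "\<And>r. r < length p \<Longrightarrow> r \<noteq> i \<Longrightarrow> r \<noteq> j \<Longrightarrow> q ! r = p ! r"
  shows "c \<in> wt n q"
proof -
  have "c \<in> colorings n (length p)"
    using colorings_upd_iff[of y n j "length p" c] wt_colorings[OF assms(1)] assms(2,3,5,6) by simp
  moreover have "card {z \<in> {1..n}. c z = r} = q ! r" if "r < length p" for r
  proof -
    have *: "card {z \<in> {1..n}. (c(y := j)) z = r} = p ! r" using assms(1) that by (auto simp: wt_def)
    consider "r = i" | "r = j" | "r \<noteq> i" "r \<noteq> j" by blast
    then show ?thesis
    proof cases
      case 1 then show ?thesis using * card_col_upd(1)[of y n c i j] assms(2,3,4,8) by simp
    next
      case 2 then show ?thesis using * card_col_upd(2)[of y n c i j] assms(2,3,4,9) by simp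
    next
      case 3 then show ?thesis using * card_col_upd(3)[of y n c i j r] assms(2,3,4) assms(10)[OF that] by simp
    qed
  qed
  ultimately show ?thesis using assms(7) by (simp add: wt_def)
qed

text \<open>Here \<open>q\<close> is \<open>p\<close> with one entry moved from color
  \<open>j\<close> to color \<open>i\<close>. Writing this with \<open>Suc\<close> avoids truncated
  subtraction, and for explicit lists the hypotheses are simplified away.\<close>

lemma move_wspace:
  assumes "f \<in> wspace n p" "i \<noteq> j" "i < length p" "j < length p"
    and "length q = length p" "q ! i = Suc (p ! i)" "p ! j = Suc (q ! j)"
    and "\<And>r. r < length p \<Longrightarrow> r \<noteq> i \<Longrightarrow> r \<noteq> j \<Longrightarrow> q ! r = p ! r"
  shows "move n i j f \<in> wspace n q"
  unfolding wspace_def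
proof (clarify)
  fix c assume "move n i j f c \<noteq> 0"
  then obtain y where y: "y \<in> {1..n}" "c y = i" "f (c(y := j)) \<noteq> 0"
    unfolding move_def by (metis (mono_tags, lifting) mem_Collect_eq sum.not_neutral_contains_not_neutral)
  then have "c(y := j) \<in> wt n p" using assms(1) by (auto simp: wspace_def)
  then show "c \<in> wt n q" by (rule wt_upd) (use y assms in simp_all)
qed

lemma move_self_wspace:
  assumes "f \<in> wspace n p" "i < length p"
  shows "move n i i f c = of_nat (p ! i) * f c"
  using assms by (cases "f c = 0") (auto simp: move_self wspace_def wt_def)

text \<open>The sl(2) relation: the commutator of e_ij and e_ji is the difference of the two color
  counts, which is a scalar on a weight space.\<close>

lemma move_move_swap:
  assumes "f \<in> wspace n p" "i < length p" "j < length p"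
  shows "move n i j (move n j i f) c
    = move n j i (move n i j f) c + (of_nat (p ! i) - of_nat (p ! j)) * f c"
proof -
  have "move n i j (move n j i f) c + move n j j f c = move n j i (move n i j f) c + move n i i f c"
    using move_commute[of n i j j i f c] by simp
  then show ?thesis
    unfolding move_self_wspace[OF assms(1,2)] move_self_wspace[OF assms(1,3)]
    by (simp add: left_diff_distrib)
qed

text \<open>A highest weight vector of sl(2) cannot have negative weight: if e_ij kills
  \<open>f\<close>, then the norm of e_ji \<open>f\<close> is \<open>p ! i - p ! j\<close> times the
  norm of \<open>f\<close>, and a norm is not negative. With the roles of the colors exchanged this
  also gives injectivity of lowering operators.\<close>

lemma move_inj:
  assumes "f \<in> wspace n p" "i < length p" "j < length p" "p ! i < p ! j"
    and "move n i j f = (\<lambda>c. 0)"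
  shows "f = (\<lambda>c. 0)"
proof -
  let ?m = "length p"
  let ?d = "of_nat (p ! i) - of_nat (p ! j) :: rat"
  have "move n i j (move n j i f) = (\<lambda>c. ?d * f c)"
  proof
    fix c
    show "move n i j (move n j i f) c = ?d * f c"
      unfolding move_move_swap[OF assms(1-3)] assms(5) move_zero by simp
  qed
  then have "ip n ?m (move n j i f) (move n j i f) = ?d * ip n ?m f f"
    using ip_move[OF assms(3,2), of n f "move n j i f"] ip_linear(3)[of n ?m ?d f f]
      ip_sym[of n ?m f "\<lambda>c. ?d * f c"] by metis
  then have "(of_nat (p ! i) - of_nat (p ! j)) * ip n ?m f f \<ge> 0"
    using ip_nonneg[of n ?m "move n j i f"] by simp
  moreover have "(of_nat (p ! i) - of_nat (p ! j) :: rat) < 0" using assms(4) by simp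
  ultimately have "ip n ?m f f \<le> 0"
    by (simp add: zero_le_mult_iff)
  then have "ip n ?m f f = 0"
    using ip_nonneg[of n ?m f] by simp
  then show ?thesis using ip_self_wspace_eq_0 assms(1) by blast
qed

section \<open>Polytabloids span the kernel of the raising operators\<close>

definition antitone :: "nat list \<Rightarrow> bool" where
  "antitone p \<longleftrightarrow> (\<forall>i j. i \<le> j \<longrightarrow> j < length p \<longrightarrow> p ! j \<le> p ! i)"

definition fits :: "nat list \<Rightarrow> (nat \<times> nat \<Rightarrow> nat) \<Rightarrow> (nat \<Rightarrow> nat) \<Rightarrow> bool" where
  "fits p s c \<longleftrightarrow> (\<forall>(r, k) \<in> cells p. c (s (r, k)) = r)"

text \<open>The polytabloid read on colorings: \<open>fits p s c\<close> says that \<open>c\<close>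
  assigns to each entry its row in \<open>s\<close>. This does not restrict \<open>c\<close> outside
  \<open>{1..sum_list p}\<close>, so the value 0 is imposed there to leave one coloring per
  tabloid.\<close>

definition polyt :: "nat list \<Rightarrow> (nat \<times> nat \<Rightarrow> nat) \<Rightarrow> (nat \<Rightarrow> nat) \<Rightarrow> rat" where
  "polyt p t c = (if \<forall>y. y \<notin> {1..sum_list p} \<longrightarrow> c y = 0
     then \<Sum>\<sigma>\<in>column_stabilizer p t. of_int (sign \<sigma>) * of_bool (fits p (\<sigma> \<circ> t) c) else 0)"

definition column :: "nat list \<Rightarrow> (nat \<times> nat \<Rightarrow> nat) \<Rightarrow> nat \<Rightarrow> nat set" where
  "column p t k = {t (r, k) |r. (r, k) \<in> cells p}"

lemma column_stabilizer_iff: "\<sigma> \<in> column_stabilizer p t \<longleftrightarrow>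
    \<sigma> permutes {1..sum_list p} \<and> (\<forall>k. \<sigma> ` column p t k = column p t k)"
  by (simp add: column_stabilizer_def column_def)

lemma finite_column_stabilizer: "finite (column_stabilizer p t)"
  by (rule finite_subset[OF _ finite_permutations[of "{1..sum_list p}"]])
    (auto simp: column_stabilizer_def)

lemma column_stabilizer_comp:
  "\<sigma> \<in> column_stabilizer p t \<Longrightarrow> \<tau> \<in> column_stabilizer p t \<Longrightarrow> \<sigma> \<circ> \<tau> \<in> column_stabilizer p t"
  unfolding column_stabilizer_iff image_comp[symmetric] using permutes_compose by metis

lemma column_stabilizer_cell:
  assumes "\<sigma> \<in> column_stabilizer p t" "(r, k) \<in> cells p"
  obtains r' where "(r', k) \<in> cells p" "\<sigma> (t (r, k)) = t (r', k)"
proof -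
  have "\<sigma> (t (r, k)) \<in> \<sigma> ` column p t k"
    using assms(2) by (auto simp: column_def)
  then have "\<sigma> (t (r, k)) \<in> column p t k"
    using assms(1) by (simp add: column_stabilizer_iff)
  then show ?thesis using that by (auto simp: column_def)
qed

lemma tableau_surj:
  assumes "t \<in> tableaux p" "y \<in> {1..sum_list p}"
  obtains r k where "(r, k) \<in> cells p" "y = t (r, k)"
proof -
  have "y \<in> t ` cells p" using assms by (simp add: tableaux_def bij_betw_def)
  then show ?thesis using that by auto
qed

lemma tableau_comp:
  assumes "t \<in> tableaux p" "\<sigma> permutes {1..sum_list p}"
  shows "\<sigma> \<circ> t \<in> tableaux p"
  using assms bij_betw_trans[OF _ permutes_imp_bij[OF assms(2)], of t "cells p"]
  by (simp add: tableaux_def)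

lemma column_mem:
  assumes "t \<in> tableaux p" "(r, k) \<in> cells p"
  shows "t (r, k) \<in> column p t k' \<longleftrightarrow> k = k'"
proof
  assume "t (r, k) \<in> column p t k'"
  then obtain r' where "(r', k') \<in> cells p" "t (r, k) = t (r', k')"
    by (auto simp: column_def)
  moreover have "inj_on t (cells p)" using assms(1) by (auto simp: tableaux_def bij_betw_def)
  ultimately show "k = k'" using assms(2) by (auto dest: inj_onD)
next
  assume "k = k'" then show "t (r, k) \<in> column p t k'" using assms(2) by (auto simp: column_def)
qed

lemma transpose_column_stabilizer:
  assumes "t \<in> tableaux p" "(r, k) \<in> cells p" "(r', k) \<in> cells p"
  shows "transpose (t (r, k)) (t (r', k)) \<in> column_stabilizer p t"
proof -
  have "t (r, k) \<in> {1..sum_list p}" "t (r', k) \<in> {1..sum_list p}"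
    using assms by (auto simp: tableaux_def bij_betw_def)
  then have "transpose (t (r, k)) (t (r', k)) permutes {1..sum_list p}"
    by (rule permutes_swap_id)
  moreover have "transpose (t (r, k)) (t (r', k)) ` column p t k' = column p t k'" for k'
    by (rule transpose_image_eq) (simp add: column_mem[OF assms(1)] assms(2,3))
  ultimately show ?thesis by (simp add: column_stabilizer_iff)
qed

text \<open>Composing with the transposition is an involution of the column stabilizer that flips
  the sign and keeps \<phi>, so the sum equals its own negative.\<close>

lemma sign_reversing_sum:
  fixes \<phi> :: "(nat \<Rightarrow> nat) \<Rightarrow> rat"
  assumes "a \<noteq> b" "transpose a b \<in> column_stabilizer p t"
    and "\<And>\<sigma>. \<sigma> \<in> column_stabilizer p t \<Longrightarrow> \<phi> (transpose a b \<circ> \<sigma>) = \<phi> \<sigma>"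
  shows "(\<Sum>\<sigma>\<in>column_stabilizer p t. of_int (sign \<sigma>) * \<phi> \<sigma>) = 0"
proof -
  let ?S = "column_stabilizer p t"
  have sgn: "of_int (sign (transpose a b \<circ> \<sigma>)) = (- of_int (sign \<sigma>) :: rat)" if "\<sigma> \<in> ?S" for \<sigma>
  proof -
    have "permutation \<sigma>"
      using that permutes_imp_permutation[of "{1..sum_list p}"] by (simp add: column_stabilizer_iff)
    then show ?thesis using assms(1) by (simp add: sign_compose permutation_swap_id sign_swap_id)
  qed
  have "(\<Sum>\<sigma>\<in>?S. of_int (sign \<sigma>) * \<phi> \<sigma>) =
      (\<Sum>\<sigma>\<in>?S. of_int (sign (transpose a b \<circ> \<sigma>)) * \<phi> (transpose a b \<circ> \<sigma>))"
  proof (rule sum.reindex_bij_witness[of _ "(\<circ>) (transpose a b)" "(\<circ>) (transpose a b)"])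
    fix \<sigma> assume \<sigma>: "\<sigma> \<in> ?S"
    show inv: "transpose a b \<circ> (transpose a b \<circ> \<sigma>) = \<sigma>" by (simp add: fun_eq_iff)
    show "transpose a b \<circ> \<sigma> \<in> ?S" by (rule column_stabilizer_comp[OF assms(2) \<sigma>])
    show "of_int (sign (transpose a b \<circ> (transpose a b \<circ> \<sigma>))) * \<phi> (transpose a b \<circ> (transpose a b \<circ> \<sigma>))
      = of_int (sign \<sigma>) * \<phi> \<sigma>"
      by (simp only: inv)
    show "transpose a b \<circ> (transpose a b \<circ> \<sigma>) = \<sigma>" by (rule inv)
    show "transpose a b \<circ> \<sigma> \<in> ?S" by (rule column_stabilizer_comp[OF assms(2) \<sigma>])
  qed
  also have "\<dots> = (\<Sum>\<sigma>\<in>?S. - (of_int (sign \<sigma>) * \<phi> \<sigma>))"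
    by (rule sum.cong) (simp_all add: sgn assms(3))
  also have "\<dots> = - (\<Sum>\<sigma>\<in>?S. of_int (sign \<sigma>) * \<phi> \<sigma>)"
    by (rule sum_negf)
  finally show ?thesis by simp
qed

lemma fits_wt:
  assumes "p \<noteq> []" "s \<in> tableaux p" "fits p s c" "\<forall>y. y \<notin> {1..sum_list p} \<longrightarrow> c y = 0"
  shows "c \<in> wt (sum_list p) p"
proof -
  have bij: "bij_betw s (cells p) {1..sum_list p}" using assms(2) by (simp add: tableaux_def)
  have lt: "c y < length p" for y
  proof (cases "y \<in> {1..sum_list p}")
    case True
    then obtain r k where "(r, k) \<in> cells p" "y = s (r, k)"
      using tableau_surj[OF assms(2)] by metis
    then show ?thesis using assms(3) by (fastforce simp: fits_def cells_def)
  next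
    case False
    then show ?thesis using assms(1,4) by auto
  qed
  have "card {y \<in> {1..sum_list p}. c y = r} = p ! r" if r: "r < length p" for r
  proof -
    have "{y \<in> {1..sum_list p}. c y = r} = (\<lambda>k. s (r, k)) ` {..<p ! r}"
    proof (intro equalityI subsetI)
      fix y assume y: "y \<in> {y \<in> {1..sum_list p}. c y = r}"
      then obtain q k where "(q, k) \<in> cells p" "y = s (q, k)"
        using tableau_surj[OF assms(2)] by blast
      then show "y \<in> (\<lambda>k. s (r, k)) ` {..<p ! r}"
        using assms(3) y by (force simp: fits_def cells_def)
    next
      fix y assume "y \<in> (\<lambda>k. s (r, k)) ` {..<p ! r}"
      then obtain k where k: "(r, k) \<in> cells p" "y = s (r, k)" using r by (auto simp: cells_def)
      then have "y \<in> {1..sum_list p}" using bij by (auto simp: bij_betw_def)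
      moreover have "c y = r" using k assms(3) by (auto simp: fits_def)
      ultimately show "y \<in> {y \<in> {1..sum_list p}. c y = r}" by simp
    qed
    moreover have "inj_on (\<lambda>k. s (r, k)) {..<p ! r}"
      using bij r by (auto simp: bij_betw_def inj_on_def cells_def)
    ultimately show ?thesis by (simp add: card_image)
  qed
  then show ?thesis using lt assms(4) by (auto simp: wt_def colorings_def)
qed

lemma polyt_wspace:
  assumes "p \<noteq> []" "t \<in> tableaux p"
  shows "polyt p t \<in> wspace (sum_list p) p"
  unfolding wspace_def
proof (clarify)
  fix c assume nz: "polyt p t c \<noteq> 0"
  then have out: "\<forall>y. y \<notin> {1..sum_list p} \<longrightarrow> c y = 0" by (auto simp: polyt_def split: if_splits)
  have "\<exists>\<sigma>\<in>column_stabilizer p t. fits p (\<sigma> \<circ> t) c"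
    using nz by (auto simp: polyt_def split: if_splits elim!: sum.not_neutral_contains_not_neutral)
  then obtain \<sigma> where "\<sigma> \<in> column_stabilizer p t" "fits p (\<sigma> \<circ> t) c" by blast
  then show "c \<in> wt (sum_list p) p"
    using fits_wt[OF assms(1) tableau_comp[OF assms(2)] _ out, of \<sigma>] by (simp add: column_stabilizer_iff)
qed

text \<open>In a surviving term the recolored entry \<open>y\<close> lies in row
  \<open>Suc i\<close> of the permuted tableau. As \<open>p\<close> is antitone there is a cell
  above it in row \<open>i\<close>, with entry \<open>x\<close>. Before the recoloring both entries
  have color \<open>i\<close>, so exchanging them does not change \<open>c\<close>, and they share a
  column: the terms cancel in pairs.\<close>

lemma polyt_move:
  assumes "antitone p" "t \<in> tableaux p" "Suc i < length p"
  shows "move (sum_list p) i (Suc i) (polyt p t) c = 0"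
proof (cases "\<forall>y. y \<notin> {1..sum_list p} \<longrightarrow> c y = 0")
  case False
  then show ?thesis by (auto simp: move_def polyt_def intro!: sum.neutral)
next
  case True
  let ?n = "sum_list p" and ?S = "column_stabilizer p t"
  let ?Y = "{y. y \<in> {1..?n} \<and> c y = i}"
  define \<phi> :: "(nat \<Rightarrow> nat) \<Rightarrow> rat"
    where "\<phi> \<sigma> = (\<Sum>y\<in>?Y. of_bool (fits p (\<sigma> \<circ> t) (c(y := Suc i))))" for \<sigma>
  have "move ?n i (Suc i) (polyt p t) c
      = (\<Sum>y\<in>?Y. \<Sum>\<sigma>\<in>?S. of_int (sign \<sigma>) * of_bool (fits p (\<sigma> \<circ> t) (c(y := Suc i))))"
    unfolding move_def polyt_def using True by (intro sum.cong) auto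
  also have "\<dots> = (\<Sum>\<sigma>\<in>?S. of_int (sign \<sigma>) * \<phi> \<sigma>)"
    unfolding \<phi>_def sum_distrib_left by (rule sum.swap)
  also have "\<dots> = 0"
  proof (cases "\<forall>\<sigma>\<in>?S. \<phi> \<sigma> = 0")
    case False
    \<comment> \<open>One surviving term is enough: the transposition obtained from it pairs off all
      terms of the sum.\<close>
    then obtain \<sigma> where \<sigma>: "\<sigma> \<in> ?S" "\<phi> \<sigma> \<noteq> 0" by blast
    then obtain y where y: "y \<in> ?Y" "fits p (\<sigma> \<circ> t) (c(y := Suc i))"
      unfolding \<phi>_def by (metis (mono_tags, lifting) of_bool_eq_0_iff sum.neutral)
    have perm: "\<sigma> permutes {1..?n}" using \<sigma>(1) by (simp add: column_stabilizer_iff)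
    then have tab: "\<sigma> \<circ> t \<in> tableaux p" by (rule tableau_comp[OF assms(2)])
    then have bij: "bij_betw (\<sigma> \<circ> t) (cells p) {1..?n}" by (simp add: tableaux_def)
    obtain q k where qk: "(q, k) \<in> cells p" "y = \<sigma> (t (q, k))"
      using tableau_surj[OF tab, of y] y(1) by auto
    then have "q = Suc i" using y(2) by (fastforce simp: fits_def)
    then have cell: "(Suc i, k) \<in> cells p" "(i, k) \<in> cells p"
      using qk(1) assms(3) assms(1)[unfolded antitone_def, rule_format, of i "Suc i"]
      by (auto simp: cells_def)
    define x where "x = \<sigma> (t (i, k))"
    have ne: "y \<noteq> x"
      using inj_onD[OF bij_betw_imp_inj_on[OF bij] _ cell] qk(2) \<open>q = Suc i\<close>
      by (auto simp: x_def)
    have cx: "c x = i"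
    proof -
      have "(c(y := Suc i)) x = i" using y(2) cell(2) by (fastforce simp: fits_def x_def)
      then show ?thesis using ne by simp
    qed
    obtain r1 where r1: "(r1, k) \<in> cells p" "y = t (r1, k)"
      using column_stabilizer_cell[OF \<sigma>(1) qk(1)] qk(2) by metis
    obtain r2 where r2: "(r2, k) \<in> cells p" "x = t (r2, k)"
      using column_stabilizer_cell[OF \<sigma>(1) cell(2)] x_def by metis
    let ?\<tau> = "transpose y x"
    have \<tau>: "?\<tau> \<in> ?S"
      using transpose_column_stabilizer[OF assms(2) r1(1) r2(1)] r1(2) r2(2) by simp
    have c\<tau>: "c \<circ> ?\<tau> = c" using y(1) cx by (auto simp: fun_eq_iff transpose_def)
    have mem: "?\<tau> z \<in> ?Y" if "z \<in> ?Y" for z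
    proof -
      have "c (?\<tau> z) = c z" using c\<tau> by (simp add: fun_eq_iff)
      moreover have "?\<tau> z \<in> {1..?n} \<longleftrightarrow> z \<in> {1..?n}"
        using \<tau> permutes_in_image[of ?\<tau> "{1..?n}" z] by (simp add: column_stabilizer_iff)
      ultimately show ?thesis using that by simp
    qed
    have "\<phi> (?\<tau> \<circ> \<rho>) = \<phi> \<rho>" for \<rho>
      unfolding \<phi>_def
    proof (rule sum.reindex_bij_witness[of _ ?\<tau> ?\<tau>])
      fix z assume z: "z \<in> ?Y"
      show "?\<tau> (?\<tau> z) = z" by simp
      show "?\<tau> z \<in> ?Y" using mem z .
      have "(c(z := Suc i)) \<circ> ?\<tau> = c(?\<tau> z := Suc i)"
      proof
        fix w
        have "c (?\<tau> w) = c w" using c\<tau> by (simp add: fun_eq_iff)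
        moreover have "?\<tau> w = z \<longleftrightarrow> w = ?\<tau> z" by (metis transpose_involutory)
        ultimately show "(c(z := Suc i) \<circ> ?\<tau>) w = (c(?\<tau> z := Suc i)) w" by simp
      qed
      then have "(c(z := Suc i)) (?\<tau> w) = (c(?\<tau> z := Suc i)) w" for w
        by (simp add: fun_eq_iff)
      then show "of_bool (fits p (\<rho> \<circ> t) (c(?\<tau> z := Suc i)))
          = (of_bool (fits p ((?\<tau> \<circ> \<rho>) \<circ> t) (c(z := Suc i))) :: rat)"
        by (simp add: fits_def del: fun_upd_apply)
      show "?\<tau> (?\<tau> z) = z" by simp
      show "?\<tau> z \<in> ?Y" using mem z .
    qed
    then show ?thesis by (rule sign_reversing_sum[OF ne \<tau>])
  qed simp
  finally show ?thesis .
qed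

lemma polyt_kern:
  assumes "p \<noteq> []" "antitone p" "t \<in> tableaux p"
  shows "polyt p t \<in> kern (sum_list p) p"
  using polyt_wspace[OF assms(1,3)] polyt_move[OF assms(2,3)] by (simp add: kern_def fun_eq_iff)

section \<open>Adding a corner box to a tableau\<close>

context
  fixes p p' :: "nat list" and r m :: nat and t t' :: "nat \<times> nat \<Rightarrow> nat"
  assumes r: "r < length p" "0 < p ! r" and p': "p' = p[r := p ! r - 1]"
    and anti: "antitone p'" and t': "t' \<in> tableaux p'" and t: "t = t'((r, p ! r - 1) := Suc m)"
    and m: "sum_list p = Suc m"
begin

lemma lift_sum_list: "sum_list p' = m"
  using r m unfolding p' by (simp add: sum_list_update)

lemma lift_cells_insert: "cells p = insert (r, p ! r - 1) (cells p')"
  using r by (auto simp: cells_def p' nth_list_update split: if_splits)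

lemma lift_corner_notin: "(r, p ! r - 1) \<notin> cells p'"
  using r by (auto simp: cells_def p')

lemma lift_cells: "(q, k) \<in> cells p' \<Longrightarrow> t (q, k) = t' (q, k)"
  using lift_corner_notin by (auto simp: t)

lemma lift_corner: "t (r, p ! r - 1) = Suc m"
  by (simp add: t)

lemma lift_tableau: "t \<in> tableaux p"
proof -
  have "bij_betw t' (cells p') {1..m}" using t' by (simp add: tableaux_def lift_sum_list)
  then have "bij_betw t (cells p') {1..m}"
    by (rule bij_betw_cong[THEN iffD1, rotated]) (use lift_corner_notin in \<open>auto simp: t\<close>)
  then have "bij_betw t (insert (r, p ! r - 1) (cells p')) (insert (Suc m) {1..m})"
    using notIn_Un_bij_betw3[of "(r, p ! r - 1)" "cells p'" t "{1..m}"] lift_corner_notin lift_corner by simp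
  moreover have "insert (Suc m) {1..m} = {1..Suc m}" by auto
  ultimately show ?thesis by (simp add: tableaux_def lift_cells_insert m)
qed

text \<open>A cell further down in this column would make row \<open>q\<close> of \<open>p'\<close>
  longer than row \<open>r\<close> of \<open>p'\<close>.\<close>

lemma below_corner:
  assumes "(q, p ! r - 1) \<in> cells p"
  shows "q \<le> r"
proof (rule ccontr)
  assume "\<not> q \<le> r"
  moreover from this have "p' ! q \<le> p' ! r"
    using assms anti[unfolded antitone_def, rule_format, of r q] by (simp add: cells_def p')
  ultimately show False using assms r by (auto simp: cells_def p')
qed

lemma lift_column: "column p t k = (if k = p ! r - 1 then insert (Suc m) (column p' t' k) else column p' t' k)"
proof -
  have "column p' t' k = {t (q, k) |q. (q, k) \<in> cells p'}"
    unfolding column_def using lift_cells by (metis (no_types, opaque_lifting))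
  moreover have "column p t k = {t (q, k) |q. (q, k) = (r, p ! r - 1)} \<union> {t (q, k) |q. (q, k) \<in> cells p'}"
    unfolding column_def lift_cells_insert by blast
  moreover have "{t (q, k) |q. (q, k) = (r, p ! r - 1)} = (if k = p ! r - 1 then {Suc m} else {})"
    using lift_corner by auto
  ultimately show ?thesis by (cases "k = p ! r - 1") (simp_all del: One_nat_def)
qed

lemma lift_Suc_notin_column: "Suc m \<notin> column p' t' k"
proof
  assume "Suc m \<in> column p' t' k"
  then obtain q where "(q, k) \<in> cells p'" "Suc m = t' (q, k)" by (auto simp: column_def)
  then have "Suc m \<in> t' ` cells p'" by auto
  then show False using t' by (simp add: tableaux_def bij_betw_def lift_sum_list)
qed

lemma column_stabilizer_fix: "column_stabilizer p' t' = {\<sigma> \<in> column_stabilizer p t. \<sigma> (Suc m) = Suc m}"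
proof (intro equalityI subsetI)
  fix \<sigma> assume \<sigma>: "\<sigma> \<in> column_stabilizer p' t'"
  then have perm: "\<sigma> permutes {1..m}" and im: "\<And>k. \<sigma> ` column p' t' k = column p' t' k"
    by (auto simp: column_stabilizer_iff lift_sum_list)
  have fixed: "\<sigma> (Suc m) = Suc m" using perm by (auto simp: permutes_def)
  have "\<sigma> permutes {1..Suc m}" using perm by (rule permutes_subset) auto
  then show "\<sigma> \<in> {\<sigma> \<in> column_stabilizer p t. \<sigma> (Suc m) = Suc m}"
    using im fixed by (auto simp: column_stabilizer_iff m lift_column)
next
  fix \<sigma> assume "\<sigma> \<in> {\<sigma> \<in> column_stabilizer p t. \<sigma> (Suc m) = Suc m}"
  then have perm: "\<sigma> permutes {1..Suc m}" and im: "\<And>k. \<sigma> ` column p t k = column p t k"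
    and fixed: "\<sigma> (Suc m) = Suc m"
    by (auto simp: column_stabilizer_iff m)
  have "\<sigma> permutes {1..m}"
  proof (rule permutes_superset[OF perm])
    fix x assume "x \<in> {1..Suc m} - {1..m}"
    then have "x = Suc m" by auto
    then show "\<sigma> x = x" using fixed by simp
  qed
  moreover have "\<sigma> ` column p' t' k = column p' t' k" for k
  proof -
    have inj: "inj \<sigma>" using perm by (rule permutes_inj)
    have "column p' t' k = column p t k - {Suc m}"
      using lift_Suc_notin_column[of k] by (auto simp: lift_column)
    then show ?thesis using im fixed inj by (simp add: image_set_diff)
  qed
  ultimately show "\<sigma> \<in> column_stabilizer p' t'" by (simp add: column_stabilizer_iff lift_sum_list)
qed

text \<open>The only cell of the column of \<open>Suc m\<close> in a row \<open>\<ge> r\<close> is the corner, so a term with \<open>Suc m\<close> in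
  such a row comes from a permutation fixing \<open>Suc m\<close>.\<close>

lemma fits_corner:
  assumes "\<sigma> \<in> column_stabilizer p t" "fits p (\<sigma> \<circ> t) c" "r \<le> c (Suc m)"
  shows "c (Suc m) = r" "\<sigma> (Suc m) = Suc m"
proof -
  have perm: "\<sigma> permutes {1..sum_list p}" using assms(1) by (simp add: column_stabilizer_iff)
  have "bij_betw (\<sigma> \<circ> t) (cells p) {1..Suc m}"
    using tableau_comp[OF lift_tableau perm] by (simp add: tableaux_def m)
  then obtain q k where qk: "(q, k) \<in> cells p" "\<sigma> (t (q, k)) = Suc m"
    by (force simp: bij_betw_def image_iff)
  obtain q' where q': "(q', k) \<in> cells p" "\<sigma> (t (q, k)) = t (q', k)"
    using column_stabilizer_cell[OF assms(1) qk(1)] .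
  then have "t (q', k) = t (r, p ! r - 1)" using qk lift_corner by simp
  then have k: "k = p ! r - 1"
    using lift_tableau q'(1) lift_cells_insert by (auto simp: tableaux_def bij_betw_def inj_on_def)
  have q: "c (Suc m) = q" using assms(2) qk by (fastforce simp: fits_def)
  then have "q = r" using below_corner qk(1) k assms(3) by fastforce
  then show "c (Suc m) = r" "\<sigma> (Suc m) = Suc m" using q qk(2) k lift_corner by auto
qed

text \<open>Order the colorings by the row of \<open>Suc m\<close>. This lemma and
  \<open>polyt_corner\<close> determine the leading part of \<open>polyt p t\<close>: it sits in row
  \<open>r\<close>, the lowest row in which \<open>Suc m\<close> occurs, and is
  \<open>polyt p' t'\<close>.\<close>

lemma polyt_below: "c (Suc m) > r \<Longrightarrow> polyt p t c = 0"
proof -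
  assume c: "c (Suc m) > r"
  have "\<not> fits p (\<sigma> \<circ> t) c" if "\<sigma> \<in> column_stabilizer p t" for \<sigma>
    using fits_corner(1)[OF that] c by fastforce
  then show ?thesis by (simp add: polyt_def)
qed

text \<open>With \<open>Suc m\<close> in row \<open>r\<close> only permutations fixing
  \<open>Suc m\<close> contribute, and these form the column stabilizer of \<open>t'\<close>. The
  assumption on \<open>c\<close> reflects that colorings of \<open>{1..m}\<close> take the value 0
  at \<open>Suc m\<close>.\<close>

lemma polyt_corner:
  assumes "c (Suc m) = 0"
  shows "polyt p t (c(Suc m := r)) = polyt p' t' c"
proof -
  let ?c = "c(Suc m := r)"
  have out: "(\<forall>y. y \<notin> {1..sum_list p} \<longrightarrow> ?c y = 0) \<longleftrightarrow> (\<forall>y. y \<notin> {1..sum_list p'} \<longrightarrow> c y = 0)"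
  proof -
    have "y \<notin> {1..m} \<longleftrightarrow> y = Suc m \<or> y \<notin> {1..Suc m}" for y by auto
    then show ?thesis
      unfolding m lift_sum_list using assms by (metis atLeastAtMost_iff fun_upd_apply le_refl le_add1 plus_1_eq_Suc)
  qed
  have "(\<Sum>\<sigma>\<in>column_stabilizer p t. of_int (sign \<sigma>) * of_bool (fits p (\<sigma> \<circ> t) ?c))
     = (\<Sum>\<sigma>\<in>column_stabilizer p' t'. of_int (sign \<sigma>) * of_bool (fits p (\<sigma> \<circ> t) ?c) :: rat)"
    using fits_corner(2)[of _ ?c] finite_column_stabilizer
    by (intro sum.mono_neutral_right) (auto simp: column_stabilizer_fix)
  also have "\<dots> = (\<Sum>\<sigma>\<in>column_stabilizer p' t'. of_int (sign \<sigma>) * of_bool (fits p' (\<sigma> \<circ> t') c))"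
  proof (rule sum.cong[OF refl])
    fix \<sigma> assume \<sigma>: "\<sigma> \<in> column_stabilizer p' t'"
    then have fixed: "\<sigma> (Suc m) = Suc m" by (auto simp: column_stabilizer_fix)
    have ne: "\<sigma> (t' (q, k)) \<noteq> Suc m" if cell: "(q, k) \<in> cells p'" for q k
    proof -
      obtain q' where "(q', k) \<in> cells p'" "\<sigma> (t' (q, k)) = t' (q', k)"
        using column_stabilizer_cell[OF \<sigma> cell] .
      then show ?thesis using lift_Suc_notin_column[of k] by (auto simp: column_def)
    qed
    have "fits p (\<sigma> \<circ> t) ?c \<longleftrightarrow> fits p' (\<sigma> \<circ> t') c"
      using ne fixed lift_corner lift_cells by (auto simp: fits_def lift_cells_insert)
    then show "of_int (sign \<sigma>) * of_bool (fits p (\<sigma> \<circ> t) ?c)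
        = (of_int (sign \<sigma>) * of_bool (fits p' (\<sigma> \<circ> t') c) :: rat)" by simp
  qed
  finally show ?thesis by (simp only: polyt_def out)
qed

end

text \<open>Raising operators for \<open>m\<close> and for \<open>Suc m\<close> differ by the term
  that recolors \<open>Suc m\<close>. That term occurs only for \<open>i = r\<close>, and there it
  evaluates \<open>g\<close> with \<open>Suc m\<close> in row \<open>Suc r\<close>, where
  \<open>g\<close> vanishes.\<close>

lemma kern_restrict:
  assumes g: "g \<in> kern (Suc m) p" and r: "r < length p" "0 < p ! r"
    and below: "\<And>c. c (Suc m) > r \<Longrightarrow> g c = 0"
  shows "(\<lambda>c. if c (Suc m) = 0 then g (c(Suc m := r)) else 0) \<in> kern m (p[r := p ! r - 1])"
    (is "?h \<in> _")
proof -
  have "?h \<in> wspace m (p[r := p ! r - 1])"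
    unfolding wspace_def
  proof (clarify)
    fix c assume "?h c \<noteq> 0"
    then have c0: "c (Suc m) = 0" and "g (c(Suc m := r)) \<noteq> 0" by (auto split: if_splits)
    then have wt: "c(Suc m := r) \<in> wt (Suc m) p" using g by (auto simp: kern_def wspace_def)
    have lt: "c y < length p" for y
      using wt r c0 by (cases "y = Suc m") (auto simp: wt_def colorings_def fun_upd_def split: if_splits)
    have out: "c y = 0" if "y \<notin> {1..m}" for y
    proof (cases "y = Suc m")
      case False
      then have "y \<notin> {1..Suc m}" using that by auto
      then have "(c(Suc m := r)) y = 0" using wt unfolding wt_def colorings_def by blast
      then show ?thesis using False by simp
    qed (simp add: c0)
    have "card {y \<in> {1..m}. c y = q} = p[r := p ! r - 1] ! q" if q: "q < length p" for q
    proof -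
      have card: "card {y \<in> {1..Suc m}. (c(Suc m := r)) y = q} = p ! q"
        using wt q by (auto simp: wt_def)
      show ?thesis
      proof (cases "q = r")
        case True
        then have "{y \<in> {1..Suc m}. (c(Suc m := r)) y = q} = insert (Suc m) {y \<in> {1..m}. c y = q}" by auto
        then show ?thesis using card True r by simp
      next
        case False
        then have "{y \<in> {1..Suc m}. (c(Suc m := r)) y = q} = {y \<in> {1..m}. c y = q}" by auto
        then show ?thesis using card False by simp
      qed
    qed
    then show "c \<in> wt m (p[r := p ! r - 1])" using lt out by (simp add: wt_def colorings_def)
  qed
  moreover have "move m i (Suc i) ?h c = 0" if i: "Suc i < length p" for i c
  proof (cases "c (Suc m) = 0")
    case False
    then show ?thesis by (auto simp: move_def intro!: sum.neutral)
  next
    case True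
    let ?c = "c(Suc m := r)"
    have "move (Suc m) i (Suc i) g ?c = 0" using g i by (simp add: kern_def)
    moreover have "move (Suc m) i (Suc i) g ?c = (\<Sum>y | y \<in> {1..m} \<and> c y = i. g (?c(y := Suc i)))"
      unfolding move_def
    proof (rule sum.mono_neutral_right)
      show "\<forall>y\<in>{y. y \<in> {1..Suc m} \<and> ?c y = i} - {y. y \<in> {1..m} \<and> c y = i}. g (?c(y := Suc i)) = 0"
      proof
        fix y assume "y \<in> {y. y \<in> {1..Suc m} \<and> ?c y = i} - {y. y \<in> {1..m} \<and> c y = i}"
        then have "y = Suc m" "i = r" by (auto simp: le_Suc_eq split: if_splits)
        then show "g (?c(y := Suc i)) = 0" by (intro below) simp
      qed
    qed auto
    moreover have "move m i (Suc i) ?h c = (\<Sum>y | y \<in> {1..m} \<and> c y = i. g (?c(y := Suc i)))"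
      unfolding move_def using True by (intro sum.cong) (auto simp: fun_upd_twist)
    ultimately show ?thesis by simp
  qed
  ultimately show ?thesis by (simp add: kern_def fun_eq_iff)
qed

lemma antitone_corner:
  assumes "antitone p" "r < length p" "Suc r < length p \<Longrightarrow> p ! Suc r < p ! r"
  shows "antitone (p[r := p ! r - 1])"
  unfolding antitone_def
proof (intro allI impI)
  fix i j assume ij: "i \<le> j" "j < length (p[r := p ! r - 1])"
  have le: "p ! j \<le> p ! i" using assms(1) ij by (simp add: antitone_def)
  show "p[r := p ! r - 1] ! j \<le> p[r := p ! r - 1] ! i"
  proof (cases "i = r \<and> j \<noteq> r")
    case True
    then have "p ! j \<le> p ! Suc r" "p ! Suc r < p ! r"
      using ij assms by (auto simp: antitone_def)
    then show ?thesis using True ij assms(2) by simp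
  next
    case False
    then show ?thesis using le ij assms(2) by (auto simp: nth_list_update)
  qed
qed

text \<open>Branching: the part of a kernel element in which \<open>n\<close> lies in the lowest occurring row is again a
  kernel element, for \<open>n - 1\<close>. It vanishes if removing a box from that row does not leave a
  partition, and otherwise it is the corresponding part of a combination of polytabloids.\<close>

lemma kern_generated:
  assumes "p \<noteq> []" "antitone p" "sum_list p = n" "lin H"
    and "\<And>t. t \<in> tableaux p \<Longrightarrow> polyt p t \<in> H" and "f \<in> kern n p"
  shows "f \<in> H"
  using assms
proof (induction n arbitrary: p H f)
  case 0
  have cells: "cells p = {}"
    using 0(3) by (auto simp: cells_def sum_list_eq_0_iff) (metis nth_mem not_less_zero)
  \<comment> \<open>With no cells every function is a tableau, so \<open>undefined\<close> serves as
    the empty one.\<close>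
  then have "undefined \<in> tableaux p" using 0(3) by (simp add: tableaux_def bij_betw_def)
  then have mem: "polyt p undefined \<in> H" by (rule 0(5))
  have "column_stabilizer p undefined = {id}"
    using 0(3) cells by (auto simp: column_stabilizer_def)
  then have pt: "polyt p undefined (\<lambda>_. 0) = 1"
    using cells by (simp add: polyt_def fits_def sign_id)
  have "f = (\<lambda>c. f (\<lambda>_. 0) * polyt p undefined c)"
  proof
    fix c show "f c = f (\<lambda>_. 0) * polyt p undefined c"
    proof (cases "c = (\<lambda>_. 0)")
      case False
      then have "c \<notin> wt 0 p" by (auto simp: wt_def colorings_def)
      then have "f c = 0" by (rule wspace_outside[OF kern_wspace[OF 0(6)]])
      moreover have "polyt p undefined c = 0"
        using False 0(3) by (auto simp: polyt_def fun_eq_iff)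
      ultimately show ?thesis by simp
    qed (simp add: pt)
  qed
  then show ?case using lin_scale[OF 0(4) mem, of "f (\<lambda>_. 0)"] by simp
next
  case (Suc m)
  let ?n = "Suc m"
  \<comment> \<open>Approximation row by row from below: \<open>F\<close> agrees with
    \<open>f\<close> whenever \<open>?n\<close> lies in one of the last \<open>d\<close> rows. For
    \<open>d = length p\<close> this covers all rows.\<close>
  have "\<exists>F\<in>H \<inter> kern ?n p. \<forall>c. c ?n + d \<ge> length p \<longrightarrow> F c = f c" if "d \<le> length p" for d
    using that
  proof (induction d)
    case 0
    have "f c = 0" if "c ?n \<ge> length p" for c
      using that wspace_outside[OF kern_wspace[OF Suc.prems(6)], of c]
      by (auto simp: wt_def colorings_def not_less[symmetric])
    then show ?case
      using lin_zero[OF Suc.prems(4)] lin_zero[OF lin_kern] by (intro bexI[of _ "\<lambda>_. 0"]) auto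
  next
    case (Suc d)
    define r where "r = length p - Suc d"
    have r: "r < length p" and r_le: "\<And>x. x + Suc d \<ge> length p \<longleftrightarrow> x \<ge> r"
      "\<And>x. x + d \<ge> length p \<longleftrightarrow> x > r"
      using Suc.prems by (auto simp: r_def)
    obtain F where F: "F \<in> H" "F \<in> kern ?n p" "\<And>c. c ?n > r \<Longrightarrow> F c = f c"
      using Suc.IH Suc.prems r_le by auto
    define g where "g = (\<lambda>c. f c - F c)"
    have g: "g \<in> kern ?n p" and g0: "\<And>c. c ?n > r \<Longrightarrow> g c = 0"
      using lin_diff[OF lin_kern \<open>f \<in> kern ?n p\<close> F(2)] F(3) by (auto simp: g_def)
    define h where "h = (\<lambda>c. if c ?n = 0 then g (c(?n := r)) else 0)"
    let ?p' = "p[r := p ! r - 1]"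
    have "\<exists>G\<in>H \<inter> kern ?n p. \<forall>c. c ?n \<ge> r \<longrightarrow> G c = g c"
    proof (cases "p ! r > 0 \<and> (Suc r < length p \<longrightarrow> p ! Suc r < p ! r)")
      case True
      have anti: "antitone ?p'"
        using antitone_corner[OF \<open>antitone p\<close> r] True by blast
      have hk: "h \<in> kern m ?p'"
        unfolding h_def by (rule kern_restrict[OF g r]) (use True g0 in auto)
      \<comment> \<open>The functions on colorings of \<open>{1..m}\<close> that occur as the row
        \<open>r\<close> part of an element of \<open>H\<close> in the kernel. The induction
        hypothesis is applied to this space, which is why \<open>H\<close> is generalized.\<close>
      define H' where "H' = {h. \<exists>G\<in>H \<inter> kern ?n p. (\<forall>c. c ?n > r \<longrightarrow> G c = 0) \<and>
        (\<forall>c. c ?n = 0 \<longrightarrow> G (c(?n := r)) = h c)}"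
      have linH': "lin H'"
      proof (rule linI)
        show "(\<lambda>_. 0) \<in> H'"
          unfolding H'_def using lin_zero[OF \<open>lin H\<close>] lin_zero[OF lin_kern]
          by (intro CollectI bexI[of _ "\<lambda>_. 0"]) auto
      next
        fix h1 h2 and a b :: rat assume "h1 \<in> H'" "h2 \<in> H'"
        then obtain G1 G2 where G: "G1 \<in> H \<inter> kern ?n p" "G2 \<in> H \<inter> kern ?n p"
          "\<forall>c. c ?n > r \<longrightarrow> G1 c = 0" "\<forall>c. c ?n > r \<longrightarrow> G2 c = 0"
          "\<forall>c. c ?n = 0 \<longrightarrow> G1 (c(?n := r)) = h1 c" "\<forall>c. c ?n = 0 \<longrightarrow> G2 (c(?n := r)) = h2 c"
          unfolding H'_def by blast
        have "(\<lambda>c. a * G1 c + b * G2 c) \<in> H \<inter> kern ?n p"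
          using G(1,2) lin_comb[OF \<open>lin H\<close>] lin_comb[OF lin_kern] by blast
        then show "(\<lambda>c. a * h1 c + b * h2 c) \<in> H'"
          unfolding H'_def using G(3-6) by (intro CollectI bexI[of _ "\<lambda>c. a * G1 c + b * G2 c"]) auto
      qed
      have "polyt ?p' t' \<in> H'" if t': "t' \<in> tableaux ?p'" for t'
      proof -
        let ?t = "t'((r, p ! r - 1) := ?n)"
        note lift = r conjunct1[OF True] refl anti t' refl \<open>sum_list p = ?n\<close>
        have t: "?t \<in> tableaux p" by (rule lift_tableau[OF lift])
        have "polyt p ?t \<in> kern ?n p"
          using polyt_kern[OF \<open>p \<noteq> []\<close> \<open>antitone p\<close> t] \<open>sum_list p = ?n\<close> by simp
        moreover have "polyt p ?t \<in> H" using Suc.prems t \<open>\<And>t. t \<in> tableaux p \<Longrightarrow> polyt p t \<in> H\<close> by blast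
        ultimately show ?thesis
          unfolding H'_def using polyt_below[OF lift] polyt_corner[OF lift]
          by (intro CollectI bexI[of _ "polyt p ?t"]) auto
      qed
      moreover have "?p' \<noteq> []" using \<open>p \<noteq> []\<close> by simp
      moreover have "sum_list ?p' = m"
        using r True \<open>sum_list p = ?n\<close> by (simp add: sum_list_update)
      ultimately have "h \<in> H'"
        using \<open>\<And>p H f. p \<noteq> [] \<Longrightarrow> antitone p \<Longrightarrow> sum_list p = m \<Longrightarrow> lin H \<Longrightarrow>
          (\<And>t. t \<in> tableaux p \<Longrightarrow> polyt p t \<in> H) \<Longrightarrow> f \<in> kern m p \<Longrightarrow> f \<in> H\<close> anti linH' hk by blast
      then obtain G where G: "G \<in> H \<inter> kern ?n p" "\<And>c. c ?n > r \<Longrightarrow> G c = 0"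
          "\<And>c. c ?n = 0 \<Longrightarrow> G (c(?n := r)) = h c"
        unfolding H'_def by blast
      have "G c = g c" if "c ?n \<ge> r" for c
      proof (cases "c ?n = r")
        case True
        then show ?thesis using G(3)[of "c(?n := 0)"] by (simp add: h_def fun_upd_idem)
      next
        case False
        then show ?thesis using that G(2) g0 by simp
      qed
      then show ?thesis using G(1) by blast
    next
      case False
      have "g c = 0" if c: "c ?n = r" for c
      proof (cases "p ! r > 0")
        case True
        then have *: "Suc r < length p" "p ! Suc r = p ! r"
          using False \<open>antitone p\<close> by (auto simp: antitone_def intro: le_antisym)
        have hk: "h \<in> kern m ?p'"
          unfolding h_def by (rule kern_restrict[OF g r True]) (use g0 in auto)
        \<comment> \<open>Without the box, row \<open>r\<close> is shorter than row
          \<open>Suc r\<close>, and between such rows the raising operator is injective.\<close>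
        have "h = (\<lambda>c. 0)"
          by (rule move_inj[of h m ?p' r "Suc r"]) (use hk * True in \<open>simp_all add: kern_def\<close>)
        then have "h (c(?n := 0)) = 0" by simp
        then show ?thesis using c by (simp add: h_def fun_upd_idem)
      next
        case False
        have "?n \<in> {y \<in> {1..?n}. c y = r}" using c by simp
        then have "card {y \<in> {1..?n}. c y = r} \<noteq> p ! r" using False by (auto simp: card_eq_0_iff)
        then have "c \<notin> wt ?n p" using r unfolding wt_def by blast
        then show ?thesis by (rule wspace_outside[OF kern_wspace[OF g]])
      qed
      then have "\<forall>c. c ?n \<ge> r \<longrightarrow> g c = 0" using g0 by (metis order_le_less)
      then show ?thesis
        using lin_zero[OF \<open>lin H\<close>] lin_zero[OF lin_kern] by (intro bexI[of _ "\<lambda>_. 0"]) auto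
    qed
    then obtain G where G: "G \<in> H" "G \<in> kern ?n p" "\<And>c. c ?n \<ge> r \<Longrightarrow> G c = g c" by blast
    have "(\<lambda>c. F c + G c) \<in> H \<inter> kern ?n p"
      using lin_add[OF \<open>lin H\<close> F(1) G(1)] lin_add[OF lin_kern F(2) G(2)] by blast
    then show ?case
      unfolding r_le using G(3) by (intro bexI[of _ "\<lambda>c. F c + G c"]) (auto simp: g_def)
  qed
  from this[of "length p"] obtain F where "F \<in> H" "\<And>c. F c = f c" by auto
  then show ?case by (metis ext)
qed

section \<open>Decomposition by raising and lowering\<close>

lemma ip_projection:
  assumes "lin S" "S \<subseteq> wspace n p"
  obtains s where "s \<in> S" "\<And>s'. s' \<in> S \<Longrightarrow> ip n (length p) (\<lambda>c. f c - s c) s' = 0"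
proof -
  have "s c = 0" if "s \<in> S" "c \<notin> colorings n (length p)" for s c
    using that assms(2) wt_colorings[of c n p] by (auto simp: wspace_def)
  then show ?thesis
    using orthogonal_projection[OF finite_colorings assms(1), of n "length p" f] that
    unfolding ip_def by blast
qed

lemma lin_move_image:
  assumes "lin S"
  shows "lin (move n i j ` S)"
proof (rule linI)
  show "(\<lambda>_. 0) \<in> move n i j ` S"
    using lin_zero[OF assms] by (intro image_eqI[of _ _ "\<lambda>_. 0"]) (simp_all add: move_zero)
next
  fix f g a b assume "f \<in> move n i j ` S" "g \<in> move n i j ` S"
  then obtain f' g' where "f' \<in> S" "g' \<in> S" "f = move n i j f'" "g = move n i j g'" by blast
  then show "(\<lambda>c. a * f c + b * g c) \<in> move n i j ` S"
    using lin_comb[OF assms, of f' g' a b]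
    by (intro image_eqI[of _ _ "\<lambda>c. a * f' c + b * g' c"]) (simp_all add: move_linear)
qed

lemma move_comm: "i \<noteq> l \<Longrightarrow> j \<noteq> k \<Longrightarrow> move n i j (move n k l f) = move n k l (move n i j f)"
  using move_commute[of n i j k l f] by (auto simp: fun_eq_iff)

lemma move_comp: "i \<noteq> l \<Longrightarrow> move n i j (move n j l f) c = move n j l (move n i j f) c + move n i l f c"
  using move_commute[of n i j j l f c] by simp

lemma move_zero_weight:
  assumes "f \<in> wspace n p" "j < length p" "p ! j = 0"
  shows "move n i j f = (\<lambda>c. 0)"
proof
  fix c
  have "c(y := j) \<notin> wt n p" if "y \<in> {1..n}" for y
  proof
    assume "c(y := j) \<in> wt n p"
    then have "card {z \<in> {1..n}. (c(y := j)) z = j} = 0" using assms by (simp add: wt_def)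
    then have "{z \<in> {1..n}. (c(y := j)) z = j} = {}" by (subst (asm) card_eq_0_iff) simp
    then show False using that by auto
  qed
  then show "move n i j f c = 0"
    unfolding move_def by (intro sum.neutral) (auto intro: wspace_outside[OF assms(1)])
qed

text \<open>Lets a function with two rows be viewed as one with an empty third row, so that
  operators creating an entry of color 2 can be applied to it.\<close>

lemma wt_append_zero:
  assumes "p \<noteq> []"
  shows "wt n (p @ [0]) = wt n p"
proof (intro equalityI subsetI)
  fix c assume c: "c \<in> wt n (p @ [0])"
  then have out: "c y = 0" if "y \<notin> {1..n}" for y using that unfolding wt_def colorings_def by blast
  have lt: "c y < Suc (length p)" for y using c by (simp add: wt_def colorings_def)
  have cards: "card {y \<in> {1..n}. c y = r} = (p @ [0]) ! r" if "r < Suc (length p)" for r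
    using c that by (simp add: wt_def)
  have "card {y \<in> {1..n}. c y = length p} = 0"
    using cards[of "length p"] by simp
  then have "{y \<in> {1..n}. c y = length p} = {}" by (subst (asm) card_eq_0_iff) simp
  then have "c y \<noteq> length p" for y
    using out[of y] assms by (cases "y \<in> {1..n}") auto
  then have "c y < length p" for y
    using lt[of y] by (metis less_antisym)
  moreover have "card {y \<in> {1..n}. c y = r} = p ! r" if "r < length p" for r
    using cards[of r] that by (simp add: nth_append)
  ultimately show "c \<in> wt n p" using out by (simp add: wt_def colorings_def)
next
  fix c assume c: "c \<in> wt n p"
  then have lt: "c y < length p" for y by (simp add: wt_def colorings_def)
  then have "{y \<in> {1..n}. c y = length p} = {}" by (auto simp: less_le)
  then have cards: "card {y \<in> {1..n}. c y = r} = (p @ [0]) ! r" if "r < Suc (length p)" for r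
    using c that by (cases "r = length p") (auto simp: wt_def nth_append less_Suc_eq)
  have "c \<in> colorings n (Suc (length p))"
    using wt_colorings[OF c] by (simp add: colorings_def less_SucI)
  then show "c \<in> wt n (p @ [0])"
    using cards unfolding wt_def by simp
qed

lemma wspace_append_zero: "p \<noteq> [] \<Longrightarrow> wspace n (p @ [0]) = wspace n p"
  by (simp add: wspace_def wt_append_zero)

text \<open>The image of the lowering operator e_10 has the kernel of its adjoint e_01 as orthogonal
  complement. Testing \<open>h\<close> against the lowered function e_10 e_01 \<open>h\<close> gives
  the norm of e_01 \<open>h\<close>, which is therefore zero.\<close>

lemma two_row_decomposition:
  assumes f: "f \<in> wspace n [a, Suc b]"
  obtains g h where "g \<in> wspace n [Suc a, b]" "h \<in> kern n [a, Suc b]"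
    "f = (\<lambda>c. move n 1 0 g c + h c)"
proof -
  let ?S = "move n 1 0 ` wspace n [Suc a, b]"
  have up: "move n 1 0 g \<in> wspace n [a, Suc b]" if "g \<in> wspace n [Suc a, b]" for g
    by (rule move_wspace[OF that]) (auto simp: less_Suc_eq numeral_2_eq_2)
  have "lin ?S" by (rule lin_move_image[OF lin_wspace])
  then obtain s where "s \<in> ?S" and perp: "\<And>s'. s' \<in> ?S \<Longrightarrow> ip n 2 (\<lambda>c. f c - s c) s' = 0"
    using ip_projection[of ?S n "[a, Suc b]" f] up by (auto simp: numeral_2_eq_2)
  then obtain g where g: "g \<in> wspace n [Suc a, b]" "s = move n 1 0 g" by blast
  define h where "h = (\<lambda>c. f c - s c)"
  have h: "h \<in> wspace n [a, Suc b]"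
    unfolding h_def g(2) by (rule lin_diff[OF lin_wspace f up[OF g(1)]])
  have h': "move n 0 1 h \<in> wspace n [Suc a, b]"
    by (rule move_wspace[OF h]) (auto simp: less_Suc_eq numeral_2_eq_2)
  have "ip n 2 (move n 0 1 h) (move n 0 1 h) = ip n 2 h (move n 1 0 (move n 0 1 h))"
    by (rule ip_move) auto
  also have "\<dots> = 0" unfolding h_def[symmetric] using perp h' by (simp add: h_def)
  finally have "move n 0 1 h = (\<lambda>c. 0)"
    using ip_self_wspace_eq_0[OF h'] by (simp add: numeral_2_eq_2)
  then have "h \<in> kern n [a, Suc b]" using h by (simp add: kern_def)
  then show ?thesis using that[OF g(1)] by (simp add: h_def g(2) fun_eq_iff)
qed

text \<open>Lowered functions are orthogonal to the kernel of e_01, so both summands vanish, and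
  e_10 is injective because \<open>b < Suc a\<close>.\<close>

lemma two_row_unique:
  assumes g: "g \<in> wspace n [Suc a, b]" and h: "h \<in> kern n [a, Suc b]" and "b \<le> a"
    and eq: "\<And>c. move n 1 0 g c + h c = 0"
  shows "g = (\<lambda>c. 0)" "h = (\<lambda>c. 0)"
proof -
  have up: "move n 1 0 g \<in> wspace n [a, Suc b]"
    by (rule move_wspace[OF g]) (auto simp: less_Suc_eq numeral_2_eq_2)
  have h0: "move n 0 1 h = (\<lambda>c. 0)" using h by (simp add: kern_def)
  have "ip n 2 (move n 1 0 g) h = ip n 2 g (move n 0 1 h)"
    by (rule ip_move) auto
  also have "\<dots> = 0" unfolding h0 by (simp add: ip_def)
  finally have "ip n 2 (move n 1 0 g) h = 0" .
  moreover have "h = (\<lambda>c. - move n 1 0 g c)" using eq by (auto simp: fun_eq_iff add_eq_0_iff)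
  ultimately have "ip n 2 (move n 1 0 g) (move n 1 0 g) = 0"
    by (simp add: ip_def sum_negf)
  then have g0: "move n 1 0 g = (\<lambda>c. 0)"
    using ip_self_wspace_eq_0[OF up] by (simp add: numeral_2_eq_2)
  show "g = (\<lambda>c. 0)"
    by (rule move_inj[OF g _ _ _ g0]) (use \<open>b \<le> a\<close> in auto)
  show "h = (\<lambda>c. 0)" using eq g0 by (simp add: fun_eq_iff)
qed

text \<open>A coloring with exactly one entry \<open>x\<close> of color 2 is the pointed set \<open>(x, K)\<close>, where \<open>K\<close> is the
  set of entries of color 1 or 2. The condition says that \<open>\<Sum>x\<in>K. f (x, K) = 0\<close> for all \<open>K\<close>, so this
  is the module induced from \<open>V\<^bsub>(b, 1)\<^esub>\<close> of \<open>S\<^bsub>b + 1\<^esub>\<close>. The map \<open>point\<close> is the simplest one into it: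
  \<open>h (K - x)\<close> minus its average over \<open>x \<in> K\<close>, up to a scalar.\<close>

definition hspace :: "nat \<Rightarrow> nat \<Rightarrow> nat \<Rightarrow> ((nat \<Rightarrow> nat) \<Rightarrow> rat) set" where
  "hspace n a b = {f \<in> wspace n [a, b, 1]. move n 1 2 f = (\<lambda>c. 0)}"

definition point :: "nat \<Rightarrow> nat \<Rightarrow> ((nat \<Rightarrow> nat) \<Rightarrow> rat) \<Rightarrow> (nat \<Rightarrow> nat) \<Rightarrow> rat" where
  "point n b h = (\<lambda>c. of_nat (Suc b) * move n 2 0 h c - move n 2 1 (move n 1 0 h) c)"

lemma lin_hspace: "lin (hspace n a b)"
proof (rule linI)
  show "(\<lambda>_. 0) \<in> hspace n a b"
    using lin_zero[OF lin_wspace] by (simp add: hspace_def move_linear)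
next
  fix f g a' b' assume "f \<in> hspace n a b" "g \<in> hspace n a b"
  then show "(\<lambda>c. a' * f c + b' * g c) \<in> hspace n a b"
    using lin_comb[OF lin_wspace] by (simp add: hspace_def move_linear)
qed

lemma point_linear:
  "point n b (\<lambda>c. f c + g c) = (\<lambda>c. point n b f c + point n b g c)"
  "point n b (\<lambda>c. a * f c) = (\<lambda>c. a * point n b f c)"
  "point n b (\<lambda>c. f c - g c) = (\<lambda>c. point n b f c - point n b g c)"
  "point n b (\<lambda>c. 0) = (\<lambda>c. 0)"
  by (simp_all add: point_def move_linear algebra_simps)

lemma point_perm:
  assumes "\<pi> permutes {1..n}"
  shows "point n b (\<lambda>c. f (c \<circ> \<pi>)) = (\<lambda>c. point n b f (c \<circ> \<pi>))"
  by (simp add: point_def move_perm[OF assms])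

lemma kern_hspace: "kern n [a, b, 1] \<subseteq> hspace n a b"
proof
  fix f assume f: "f \<in> kern n [a, b, 1]"
  then have "move n (Suc 0) (Suc (Suc 0)) f = (\<lambda>c. 0)" by (simp add: kern_def)
  then show "f \<in> hspace n a b" using f by (simp add: hspace_def kern_def numeral_2_eq_2)
qed

lemma hspace_kern: "f \<in> hspace n a b \<Longrightarrow> move n 0 1 f = (\<lambda>c. 0) \<Longrightarrow> f \<in> kern n [a, b, 1]"
  by (auto simp: hspace_def kern_def numeral_2_eq_2 less_Suc_eq)

lemma move_hspace:
  assumes "F \<in> hspace n (Suc a) b"
  shows "move n 1 0 F \<in> hspace n a (Suc b)"
proof -
  have "F \<in> wspace n [Suc a, b, 1]" using assms by (simp add: hspace_def)
  then have "move n 1 0 F \<in> wspace n [a, Suc b, 1]"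
    by (rule move_wspace) (auto simp: less_Suc_eq)
  moreover have "move n 1 2 (move n 1 0 F) = (\<lambda>c. 0)"
    using assms move_comm[of 1 0 2 1 n F] by (simp add: hspace_def move_zero)
  ultimately show ?thesis by (simp add: hspace_def)
qed

text \<open>For a one-element \<open>K\<close> the vanishing sum has a single term. This starts the
  recursion.\<close>

lemma hspace_zero: "hspace n a 0 = {\<lambda>c. 0}"
proof -
  have "f = (\<lambda>c. 0)" if "f \<in> hspace n a 0" for f
    by (rule move_inj[of f n "[a, 0, 1]" 1 2]) (use that in \<open>auto simp: hspace_def\<close>)
  then show ?thesis using lin_zero[OF lin_hspace] by blast
qed

context
  fixes n a b :: nat and h :: "(nat \<Rightarrow> nat) \<Rightarrow> rat"
  assumes h: "h \<in> kern n [Suc a, Suc b]"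
begin

lemma two_row_kern_wspace: "h \<in> wspace n [Suc a, Suc b, 0]"
  using h wspace_append_zero[of "[Suc a, Suc b]" n] by (simp add: kern_def)

lemma two_row_kern_move: "move n 0 1 h = (\<lambda>c. 0)" "move n 1 2 h = (\<lambda>c. 0)" "move n 0 2 h = (\<lambda>c. 0)"
  using h move_zero_weight[OF two_row_kern_wspace, of 2] by (simp_all add: kern_def)

lemma two_row_kern_up: "move n 1 0 h \<in> wspace n [a, Suc (Suc b), 0]"
  by (rule move_wspace[OF two_row_kern_wspace]) (auto simp: less_Suc_eq)

text \<open>The factor in \<open>point\<close> is forced here: e_12 e_20 \<open>h\<close> is e_10
  \<open>h\<close>, while e_12 e_21 multiplies e_10 \<open>h\<close> by the number
  \<open>b + 2\<close> of its entries of color 1, as it has none of color 2.\<close>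

lemma point_hspace: "point n (Suc b) h \<in> hspace n a (Suc b)"
proof -
  have "move n 2 0 h \<in> wspace n [a, Suc b, 1]"
    by (rule move_wspace[OF two_row_kern_wspace]) (auto simp: less_Suc_eq)
  moreover have "move n 2 1 (move n 1 0 h) \<in> wspace n [a, Suc b, 1]"
    by (rule move_wspace[OF two_row_kern_up]) (auto simp: less_Suc_eq)
  ultimately have "point n (Suc b) h \<in> wspace n [a, Suc b, 1]"
    unfolding point_def by (intro lin_diff[OF lin_wspace] lin_scale[OF lin_wspace])
  moreover have "move n 1 2 (point n (Suc b) h) c = 0" for c
  proof -
    have 1: "move n 1 2 (move n 2 0 h) c = move n 1 0 h c"
      using move_comp[of 1 0 n 2 h c] unfolding two_row_kern_move move_zero by simp
    have "move n 1 2 (move n 1 0 h) = (\<lambda>c. 0)"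
      using move_comm[of 1 0 2 1 n h] unfolding two_row_kern_move move_zero by simp
    then have 2: "move n 1 2 (move n 2 1 (move n 1 0 h)) c = of_nat (Suc (Suc b)) * move n 1 0 h c"
      using move_move_swap[OF two_row_kern_up, of 1 2 c] by (simp add: move_zero)
    show ?thesis using 1 2 by (simp add: point_def move_linear)
  qed
  ultimately show ?thesis by (auto simp: hspace_def)
qed

text \<open>The first term of \<open>point\<close> contributes the coefficient
  \<open>-(b + 2)\<close>; the second contributes \<open>-(a - b)\<close>, since e_01 e_10
  multiplies the highest weight vector \<open>h\<close> by \<open>a - b\<close>. The total is
  nonzero, so \<open>h\<close> can be recovered from \<open>point\<close>.\<close>

lemma move_point: "move n 0 1 (point n (Suc b) h) = (\<lambda>c. - (of_nat (a + 2) * move n 2 1 h c))"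
proof
  fix c
  have 1: "move n 0 1 (move n 2 0 h) c = - move n 2 1 h c"
    using move_comp[of 2 1 n 0 h c] unfolding two_row_kern_move move_zero by simp
  have "move n 0 1 (move n 1 0 h) = (\<lambda>c. (of_nat a - of_nat b) * h c)"
    using move_move_swap[OF two_row_kern_wspace, of 0 1] unfolding two_row_kern_move move_zero by (simp add: fun_eq_iff)
  then have 2: "move n 0 1 (move n 2 1 (move n 1 0 h)) c = (of_nat a - of_nat b) * move n 2 1 h c"
    using move_comm[of 0 1 1 2 n "move n 1 0 h"] by (simp add: move_scale)
  show "move n 0 1 (point n (Suc b) h) c = - (of_nat (a + 2) * move n 2 1 h c)"
    unfolding point_def move_linear 1 2 by (simp add: algebra_simps)
qed

end

text \<open>The two-row argument does not carry over directly, because e_01 does not preserve the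
  condition that e_12 vanishes: the adjoint of lowering within \<open>hspace\<close> is e_01
  followed by a projection. So the remainder \<open>g\<close>, orthogonal to the lowered functions,
  may have e_01 \<open>g\<close> nonzero. This defect is governed by \<open>q\<close>, that is e_02
  \<open>g\<close>, which turns out to be a highest weight vector with two rows, and subtracting
  \<open>point\<close> of a multiple of \<open>q\<close> removes it.\<close>

lemma hook_decomposition:
  assumes f: "f \<in> hspace n a (Suc b)"
  obtains F h \<kappa> where "F \<in> hspace n (Suc a) b" "h \<in> kern n [Suc a, Suc b]"
    "\<kappa> \<in> kern n [a, Suc b, 1]" "f = (\<lambda>c. move n 1 0 F c + point n (Suc b) h c + \<kappa> c)"
proof -
  let ?S = "move n 1 0 ` hspace n (Suc a) b"
  have sub: "hspace n a b \<subseteq> wspace n [a, b, 1]" for a b by (auto simp: hspace_def)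
  have "lin ?S" by (rule lin_move_image[OF lin_hspace])
  moreover have len: "length [a, Suc b, 1] = 3" by simp
  moreover have "?S \<subseteq> wspace n [a, Suc b, 1]" using move_hspace sub by blast
  ultimately obtain s where "s \<in> ?S"
    and perp: "\<And>s'. s' \<in> ?S \<Longrightarrow> ip n 3 (\<lambda>c. f c - s c) s' = 0"
    using ip_projection[of ?S n "[a, Suc b, 1]" f] unfolding len by blast
  then obtain F where F: "F \<in> hspace n (Suc a) b" "s = move n 1 0 F" by blast
  define g where "g = (\<lambda>c. f c - s c)"
  have g: "g \<in> hspace n a (Suc b)"
    unfolding g_def F(2) by (rule lin_diff[OF lin_hspace f move_hspace[OF F(1)]])
  then have gw: "g \<in> wspace n [a, Suc b, 1]" and g12: "move n 1 2 g = (\<lambda>c. 0)"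
    by (auto simp: hspace_def)
  define G where "G = move n 0 1 g"
  have Gw: "G \<in> wspace n [Suc a, b, 1]"
    unfolding G_def by (rule move_wspace[OF gw]) (auto simp: less_Suc_eq)
  have G_perp: "ip n 3 G F' = 0" if "F' \<in> hspace n (Suc a) b" for F'
  proof -
    have "ip n 3 G F' = ip n 3 g (move n 1 0 F')" unfolding G_def by (rule ip_move) auto
    then show ?thesis using perp[of "move n 1 0 F'"] that by (simp add: g_def)
  qed
  define q where "q = move n 0 2 g"
  have q: "q \<in> wspace n [Suc a, Suc b, 0]"
    unfolding q_def by (rule move_wspace[OF gw]) (auto simp: less_Suc_eq)
  have q12: "move n 1 2 q = (\<lambda>c. 0)"
    unfolding q_def using move_comm[of 1 2 2 0 n g] unfolding g12 move_zero by simp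
  have q02: "move n 0 2 q = (\<lambda>c. 0)" using move_zero_weight[OF q, of 2] by simp
  have G12: "move n 1 2 G c = - q c" for c
    using move_comp[of 0 2 n 1 g c] unfolding G_def q_def g12 move_zero by simp
  have q21: "move n 1 2 (move n 2 1 q) c = of_nat (Suc b) * q c" for c
    using move_move_swap[OF q, of 1 2 c] unfolding q12 move_zero by simp
  \<comment> \<open>A multiple of the projection of \<open>G\<close> to \<open>hspace\<close>; as \<open>G\<close> is orthogonal to \<open>hspace\<close>, it vanishes.\<close>
  define G' where "G' = (\<lambda>c. of_nat (Suc b) * G c + move n 2 1 q c)"
  have q21w: "move n 2 1 q \<in> wspace n [Suc a, b, 1]"
    by (rule move_wspace[OF q]) (auto simp: less_Suc_eq)
  have G'w: "G' \<in> wspace n [Suc a, b, 1]"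
    unfolding G'_def by (intro lin_add[OF lin_wspace] lin_scale[OF lin_wspace] Gw q21w)
  have G'12: "move n 1 2 G' = (\<lambda>c. 0)"
    unfolding G'_def move_linear G12 q21 by simp
  have G': "G' \<in> hspace n (Suc a) b" using G'w G'12 by (simp add: hspace_def)
  have "ip n 3 (move n 2 1 q) G' = ip n 3 q (move n 1 2 G')" by (rule ip_move) auto
  also have "\<dots> = 0" unfolding G'12 by (simp add: ip_def)
  finally have "ip n 3 (\<lambda>c. of_nat (Suc b) * G c + move n 2 1 q c) G' = 0"
    unfolding ip_linear(1,3) G_perp[OF G'] by simp
  then have "ip n 3 G' G' = 0" unfolding G'_def[symmetric] .
  then have "G' = (\<lambda>c. 0)" using ip_self_wspace_eq_0[OF G'w] by (simp add: numeral_3_eq_3)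
  then have Gq: "of_nat (Suc b) * G c = - move n 2 1 q c" for c
    unfolding G'_def by (simp add: fun_eq_iff add_eq_0_iff)
  \<comment> \<open>Applying e_02 to the equation \<open>Gq\<close> shows that \<open>b + 1\<close>
    times e_01 \<open>q\<close> is minus e_01 \<open>q\<close>, and \<open>b + 2\<close> is
    nonzero.\<close>
  have q01: "move n 0 1 q = (\<lambda>c. 0)"
  proof
    fix c
    have "of_nat (Suc b) * move n 0 1 q c = of_nat (Suc b) * move n 0 2 G c"
      unfolding q_def G_def using move_comm[of 0 2 1 0 n g] by simp
    also have "\<dots> = move n 0 2 (\<lambda>c. of_nat (Suc b) * G c) c" by (simp add: move_scale)
    also have "\<dots> = - move n 0 2 (move n 2 1 q) c"
      unfolding Gq using move_scale[of n 0 2 "-1" "move n 2 1 q"] by simp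
    also have "\<dots> = - move n 0 1 q c"
      using move_comp[of 0 1 n 2 q c] by (simp add: q02 move_zero)
    finally have "of_nat (Suc (Suc b)) * move n 0 1 q c = 0" by (simp add: algebra_simps)
    then show "move n 0 1 q c = 0" by (simp del: of_nat_Suc)
  qed
  have qk: "q \<in> kern n [Suc a, Suc b]"
    using q q01 wspace_append_zero[of "[Suc a, Suc b]" n] by (simp add: kern_def)
  \<comment> \<open>The solution of \<open>G + (a + 2) * d * move n 2 1 q = 0\<close>, given that
    \<open>(b + 1) * G\<close> is minus \<open>move n 2 1 q\<close>.\<close>
  define d :: rat where "d = 1 / (of_nat (Suc b) * of_nat (a + 2))"
  define h where "h = (\<lambda>c. d * q c)"
  have hk: "h \<in> kern n [Suc a, Suc b]" unfolding h_def by (rule lin_scale[OF lin_kern qk])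
  define \<kappa> where "\<kappa> = (\<lambda>c. g c - point n (Suc b) h c)"
  have "\<kappa> \<in> hspace n a (Suc b)"
    unfolding \<kappa>_def by (rule lin_diff[OF lin_hspace g point_hspace[OF hk]])
  moreover have "move n 0 1 \<kappa> = (\<lambda>c. 0)"
  proof
    fix c
    have "of_nat (Suc b) * move n 0 1 \<kappa> c
        = of_nat (Suc b) * G c + of_nat (Suc b) * of_nat (a + 2) * d * move n 2 1 q c"
    proof -
      have "move n 0 1 \<kappa> c = G c + of_nat (a + 2) * move n 2 1 h c"
        unfolding \<kappa>_def move_linear move_point[OF hk] G_def by simp
      moreover have "move n 2 1 h c = d * move n 2 1 q c" unfolding h_def move_scale ..
      ultimately show ?thesis by (simp only: distrib_left mult.assoc)
    qed
    also have "of_nat (Suc b) * of_nat (a + 2) * d = 1"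
      unfolding d_def by (simp del: of_nat_Suc of_nat_add)
    finally have "of_nat (Suc b) * move n 0 1 \<kappa> c = 0" by (simp only: Gq)
    then show "move n 0 1 \<kappa> c = 0" by (simp del: of_nat_Suc)
  qed
  ultimately have "\<kappa> \<in> kern n [a, Suc b, 1]" by (rule hspace_kern)
  then show ?thesis
    using that[OF F(1) hk] by (simp add: \<kappa>_def g_def F(2) fun_eq_iff)
qed

text \<open>The lowered part is orthogonal to the other two: by adjointness its product with them is
  a multiple of the product of \<open>h\<close> with e_12 \<open>F\<close>, which is zero. Once it
  is removed, e_01 leaves a nonzero multiple of e_21 \<open>h\<close>, and e_21 is injective on
  \<open>h\<close>, which has no entry of color 2.\<close>

lemma hook_unique:
  assumes F: "F \<in> hspace n (Suc a) b" and h: "h \<in> kern n [Suc a, Suc b]"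
    and \<kappa>: "\<kappa> \<in> kern n [a, Suc b, 1]" and "b \<le> a"
    and eq: "\<And>c. move n 1 0 F c + point n (Suc b) h c + \<kappa> c = 0"
  shows "F = (\<lambda>c. 0)" "h = (\<lambda>c. 0)" "\<kappa> = (\<lambda>c. 0)"
proof -
  have Fw: "F \<in> wspace n [Suc a, b, 1]" and F12: "move n 1 2 F = (\<lambda>c. 0)"
    using F by (auto simp: hspace_def)
  have up: "move n 1 0 F \<in> wspace n [a, Suc b, 1]"
    using move_hspace[OF F] by (simp add: hspace_def)
  have \<kappa>01: "move n 0 1 \<kappa> = (\<lambda>c. 0)" using \<kappa> by (simp add: kern_def)
  define g where "g = (\<lambda>c. point n (Suc b) h c + \<kappa> c)"
  have g01: "move n 0 1 g = (\<lambda>c. - of_nat (a + 2) * move n 2 1 h c)"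
    unfolding g_def move_linear \<kappa>01 move_point[OF h] by (simp add: left_diff_distrib distrib_right)
  have "ip n 3 (move n 1 0 F) g = ip n 3 F (move n 0 1 g)" by (rule ip_move) auto
  also have "\<dots> = - of_nat (a + 2) * ip n 3 (move n 2 1 h) F"
    unfolding g01 ip_sym[of n 3 F] ip_linear(3) ..
  also have "ip n 3 (move n 2 1 h) F = ip n 3 h (move n 1 2 F)" by (rule ip_move) auto
  also have "\<dots> = 0" unfolding F12 by (simp add: ip_def)
  finally have "ip n 3 (move n 1 0 F) g = 0" by simp
  moreover have g_eq: "g = (\<lambda>c. - move n 1 0 F c)"
    using eq by (auto simp: fun_eq_iff g_def add.assoc add_eq_0_iff)
  ultimately have "ip n 3 (move n 1 0 F) (move n 1 0 F) = 0" by (simp add: ip_def sum_negf)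
  then have F0: "move n 1 0 F = (\<lambda>c. 0)"
    using ip_self_wspace_eq_0[OF up] by (simp add: numeral_3_eq_3)
  show "F = (\<lambda>c. 0)"
    by (rule move_inj[OF Fw _ _ _ F0]) (use \<open>b \<le> a\<close> in auto)
  have "g = (\<lambda>c. 0)" using g_eq unfolding F0 by simp
  then have "move n 2 1 h = (\<lambda>c. 0)"
    using g01 unfolding \<open>g = (\<lambda>c. 0)\<close> move_zero by (simp add: fun_eq_iff del: of_nat_add)
  then show h0: "h = (\<lambda>c. 0)"
    by (rule move_inj[OF two_row_kern_wspace[OF h], rotated -1]) auto
  then show "\<kappa> = (\<lambda>c. 0)" using \<open>g = (\<lambda>c. 0)\<close> by (simp add: g_def point_linear)
qed

section \<open>Specht modules as kernels\<close>

definition blocks :: "nat \<Rightarrow> nat \<Rightarrow> (nat \<Rightarrow> nat) \<Rightarrow> nat set list" where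
  "blocks n m c = map (\<lambda>r. {y \<in> {1..n}. c y = r}) [0..<m]"

text \<open>Passage from functions on tabloids to functions on colorings, a tabloid being the list
  of color classes. The value 0 outside weight \<open>p\<close> makes the result an element of
  \<open>wspace\<close>.\<close>

definition hat :: "nat \<Rightarrow> nat list \<Rightarrow> (nat set list \<Rightarrow> rat) \<Rightarrow> (nat \<Rightarrow> nat) \<Rightarrow> rat" where
  "hat n p v c = (if c \<in> wt n p then v (blocks n (length p) c) else 0)"

lemma blocks_inj:
  assumes "c \<in> colorings n m" "c' \<in> colorings n m" "blocks n m c = blocks n m c'"
  shows "c = c'"
proof
  fix y
  show "c y = c' y"
  proof (cases "y \<in> {1..n}")
    case True
    have lt: "c y < m" using assms(1) by (simp add: colorings_def)
    have "blocks n m c ! c y = blocks n m c' ! c y" using assms(3) by simp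
    then have "{z \<in> {1..n}. c z = c y} = {z \<in> {1..n}. c' z = c y}" using lt by (simp add: blocks_def)
    then have "y \<in> {z \<in> {1..n}. c' z = c y}" using True by blast
    then show ?thesis by simp
  next
    case False
    then show ?thesis using assms(1,2) unfolding colorings_def by (metis (mono_tags, lifting) mem_Collect_eq)
  qed
qed

lemma tabloid_blocks_iff:
  assumes "t \<in> tableaux p"
  shows "blocks (sum_list p) (length p) c = tabloid p t \<longleftrightarrow> fits p t c"
proof
  assume eq: "blocks (sum_list p) (length p) c = tabloid p t"
  show "fits p t c"
    unfolding fits_def
  proof clarify
    fix r k assume rk: "(r, k) \<in> cells p"
    then have "r < length p" "k < p ! r" by (auto simp: cells_def)
    then have "{y \<in> {1..sum_list p}. c y = r} = {t (r, k) |k. k < p ! r}"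
      using arg_cong[OF eq, of "\<lambda>u. u ! r"] by (simp add: blocks_def tabloid_def)
    then show "c (t (r, k)) = r" using \<open>k < p ! r\<close> by blast
  qed
next
  assume fits: "fits p t c"
  have "{y \<in> {1..sum_list p}. c y = r} = {t (r, k) |k. k < p ! r}" if r: "r < length p" for r
  proof (intro equalityI subsetI)
    fix y assume y: "y \<in> {y \<in> {1..sum_list p}. c y = r}"
    then obtain q k where "(q, k) \<in> cells p" "y = t (q, k)" using tableau_surj[OF assms] by blast
    moreover from this have "q = r" using fits y by (auto simp: fits_def)
    ultimately show "y \<in> {t (r, k) |k. k < p ! r}" by (auto simp: cells_def)
  next
    fix y assume "y \<in> {t (r, k) |k. k < p ! r}"
    then obtain k where k: "(r, k) \<in> cells p" "y = t (r, k)" using r by (auto simp: cells_def)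
    then have "y \<in> t ` cells p" by blast
    then have "y \<in> {1..sum_list p}" using assms by (simp add: tableaux_def bij_betw_def)
    moreover have "c y = r" using fits k by (auto simp: fits_def)
    ultimately show "y \<in> {y \<in> {1..sum_list p}. c y = r}" by simp
  qed
  then show "blocks (sum_list p) (length p) c = tabloid p t"
    by (auto simp: blocks_def tabloid_def)
qed

text \<open>A tableau yields the coloring by rows; conversely, enumerating each color class of a
  coloring of weight \<open>p\<close> fills the rows of a tableau.\<close>

lemma tabloids_eq_blocks:
  assumes "p \<noteq> []"
  shows "tabloid p ` tableaux p = blocks (sum_list p) (length p) ` wt (sum_list p) p"
proof (intro equalityI subsetI)
  fix u assume "u \<in> tabloid p ` tableaux p"
  then obtain t where t: "t \<in> tableaux p" "u = tabloid p t" by blast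
  define c where "c y = (if y \<in> {1..sum_list p} then fst (inv_into (cells p) t y) else 0)" for y
  have bij: "bij_betw t (cells p) {1..sum_list p}" using t(1) by (simp add: tableaux_def)
  have "fits p t c"
    unfolding fits_def
  proof clarify
    fix r k assume rk: "(r, k) \<in> cells p"
    then have "t (r, k) \<in> {1..sum_list p}" using bij_betwE[OF bij] by blast
    then show "c (t (r, k)) = r"
      using inv_into_f_f[OF bij_betw_imp_inj_on[OF bij] rk] by (simp add: c_def)
  qed
  then show "u \<in> blocks (sum_list p) (length p) ` wt (sum_list p) p"
    using tabloid_blocks_iff[OF t(1), of c] fits_wt[OF assms t(1), of c] t(2)
    by (force simp: c_def)
next
  fix u assume "u \<in> blocks (sum_list p) (length p) ` wt (sum_list p) p"
  then obtain c where c: "c \<in> wt (sum_list p) p" "u = blocks (sum_list p) (length p) c" by blast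
  let ?R = "\<lambda>r. {y \<in> {1..sum_list p}. c y = r}"
  have "\<forall>r. \<exists>b. r < length p \<longrightarrow> bij_betw b {..<p ! r} (?R r)"
  proof
    fix r
    show "\<exists>b. r < length p \<longrightarrow> bij_betw b {..<p ! r} (?R r)"
    proof (cases "r < length p")
      case True
      then have "card (?R r) = p ! r" using c(1) by (simp add: wt_def)
      moreover have "finite (?R r)" by simp
      ultimately show ?thesis
        using ex_bij_betw_nat_finite[of "?R r"] by (auto simp: atLeast0LessThan)
    qed simp
  qed
  then obtain b where b: "\<And>r. r < length p \<Longrightarrow> bij_betw (b r) {..<p ! r} (?R r)" by metis
  define t where "t = (\<lambda>(r, k). b r k :: nat)"
  have val: "t (r, k) \<in> {1..sum_list p}" "c (t (r, k)) = r" if "(r, k) \<in> cells p" for r k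
    using that bij_betwE[OF b[of r]] by (auto simp: t_def cells_def)
  have "inj_on t (cells p)"
  proof (rule inj_onI, clarify)
    fix r k r' k' assume *: "(r, k) \<in> cells p" "(r', k') \<in> cells p" "t (r, k) = t (r', k')"
    then have "r = r'" using val(2) by metis
    moreover have "k = k'"
      using * \<open>r = r'\<close> bij_betw_imp_inj_on[OF b[of r]] by (auto simp: t_def cells_def inj_on_def)
    ultimately show "r = r' \<and> k = k'" by simp
  qed
  moreover have "t ` cells p = {1..sum_list p}"
  proof (intro equalityI subsetI)
    fix y assume y: "y \<in> {1..sum_list p}"
    have lt: "c y < length p" using c(1) by (simp add: wt_def colorings_def)
    have "y \<in> b (c y) ` {..<p ! c y}" using b[OF lt] y by (simp add: bij_betw_def)
    then show "y \<in> t ` cells p" using lt by (force simp: t_def cells_def)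
  qed (use val in auto)
  ultimately have t: "t \<in> tableaux p" by (simp add: tableaux_def bij_betw_def)
  moreover have "fits p t c" using val by (auto simp: fits_def)
  ultimately show "u \<in> tabloid p ` tableaux p" using tabloid_blocks_iff[of t p c] c(2) by auto
qed

lemma finite_wt: "finite (wt n p)"
  by (rule finite_subset[OF _ finite_colorings[of n "length p"]]) (auto simp: wt_def)

lemma carrier_tabloid_module:
  assumes "p \<noteq> []"
  shows "v \<in> carrier (permutation_module (tabloid p ` tableaux p)) \<longleftrightarrow>
    (\<forall>u. u \<notin> blocks (sum_list p) (length p) ` wt (sum_list p) p \<longrightarrow> v u = 0)"
proof -
  have "finite (tabloid p ` tableaux p)"
    unfolding tabloids_eq_blocks[OF assms] using finite_wt by blast
  then have "v \<in> carrier (permutation_module (tabloid p ` tableaux p))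
      \<longleftrightarrow> {u. v u \<noteq> 0} \<subseteq> tabloid p ` tableaux p"
    by (auto simp: permutation_module_def intro: finite_subset)
  then show ?thesis unfolding tabloids_eq_blocks[OF assms] by blast
qed

lemma hat_linear:
  "hat n p (\<lambda>u. v u + w u) = (\<lambda>c. hat n p v c + hat n p w c)"
  "hat n p (\<lambda>u. a * v u) = (\<lambda>c. a * hat n p v c)"
  "hat n p (\<lambda>u. 0) = (\<lambda>c. 0)"
  by (auto simp: hat_def)

lemma hat_inj:
  assumes "p \<noteq> []" "v \<in> carrier (permutation_module (tabloid p ` tableaux p))"
    "w \<in> carrier (permutation_module (tabloid p ` tableaux p))"
    and "hat (sum_list p) p v = hat (sum_list p) p w"
  shows "v = w"
proof
  fix u
  show "v u = w u"
  proof (cases "u \<in> blocks (sum_list p) (length p) ` wt (sum_list p) p")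
    case True
    then obtain c where c: "c \<in> wt (sum_list p) p" "u = blocks (sum_list p) (length p) c" by blast
    then show ?thesis using fun_cong[OF assms(4), of c] by (simp add: hat_def)
  next
    case False
    then show ?thesis
      using assms(2,3) unfolding carrier_tabloid_module[OF assms(1)] by simp
  qed
qed

lemma hat_surj:
  assumes "p \<noteq> []" "f \<in> wspace (sum_list p) p"
  obtains v where "v \<in> carrier (permutation_module (tabloid p ` tableaux p))" "hat (sum_list p) p v = f"
proof -
  let ?n = "sum_list p" and ?m = "length p"
  define v where "v u = (if u \<in> blocks ?n ?m ` wt ?n p then f (inv_into (wt ?n p) (blocks ?n ?m) u) else 0)"
    for u
  have "inj_on (blocks ?n ?m) (wt ?n p)"
    using blocks_inj wt_colorings by (intro inj_onI) blast
  then have "hat ?n p v = f"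
    using wspace_outside[OF assms(2)] by (auto simp: hat_def v_def fun_eq_iff)
  moreover have "v \<in> carrier (permutation_module (tabloid p ` tableaux p))"
    unfolding carrier_tabloid_module[OF assms(1)] by (simp add: v_def)
  ultimately show ?thesis using that by blast
qed

lemma hat_polytabloid:
  assumes "p \<noteq> []" "t \<in> tableaux p"
  shows "hat (sum_list p) p (polytabloid p t) = polyt p t"
proof
  fix c
  show "hat (sum_list p) p (polytabloid p t) c = polyt p t c"
  proof (cases "c \<in> wt (sum_list p) p")
    case True
    then have out: "\<forall>y. y \<notin> {1..sum_list p} \<longrightarrow> c y = 0" unfolding wt_def colorings_def by blast
    have "basis_vector (tabloid p (\<sigma> \<circ> t)) (blocks (sum_list p) (length p) c)
        = of_bool (fits p (\<sigma> \<circ> t) c)" if "\<sigma> \<in> column_stabilizer p t" for \<sigma>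
      using that tabloid_blocks_iff[OF tableau_comp[OF assms(2)], of \<sigma> c]
      by (auto simp: basis_vector_def column_stabilizer_iff)
    then show ?thesis using True out by (simp add: hat_def polyt_def polytabloid_def)
  next
    case False
    then show ?thesis
      using wspace_outside[OF polyt_wspace[OF assms]] by (simp add: hat_def)
  qed
qed

text \<open>\<open>submodule\<close> asks for closure under the inverse of the additive group. That
  inverse is a definite description and is computed here from uniqueness.\<close>

lemma m_inv_permutation_module:
  assumes "v \<in> carrier (permutation_module B)"
  shows "inv\<^bsub>add_monoid (permutation_module B)\<^esub> v = (\<lambda>u. - v u)"
  unfolding m_inv_def
proof (rule the_equality)
  have "(\<lambda>u. - v u) \<in> carrier (permutation_module B)"
    using assms by (simp add: permutation_module_def)
  then show "(\<lambda>u. - v u) \<in> carrier (add_monoid (permutation_module B)) \<and>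
      v \<otimes>\<^bsub>add_monoid (permutation_module B)\<^esub> (\<lambda>u. - v u) = \<one>\<^bsub>add_monoid (permutation_module B)\<^esub> \<and>
      (\<lambda>u. - v u) \<otimes>\<^bsub>add_monoid (permutation_module B)\<^esub> v = \<one>\<^bsub>add_monoid (permutation_module B)\<^esub>"
    by (simp add: permutation_module_def)
next
  fix w assume "w \<in> carrier (add_monoid (permutation_module B)) \<and>
      v \<otimes>\<^bsub>add_monoid (permutation_module B)\<^esub> w = \<one>\<^bsub>add_monoid (permutation_module B)\<^esub> \<and>
      w \<otimes>\<^bsub>add_monoid (permutation_module B)\<^esub> v = \<one>\<^bsub>add_monoid (permutation_module B)\<^esub>"
  then have "w u + v u = 0" for u by (simp add: permutation_module_def fun_eq_iff)
  then show "w = (\<lambda>u. - v u)" by (simp add: fun_eq_iff eq_neg_iff_add_eq_0)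
qed

lemma carrier_rationals: "carrier rationals = UNIV"
  by (simp add: ring_of_type_algebra_def)

text \<open>The kernel is a submodule containing the polytabloids, so it contains the module they
  generate. Conversely, a submodule containing all polytabloids is carried by \<open>hat\<close> to
  a linear space of functions on colorings containing every \<open>polyt p t\<close>, to which
  \<open>kern_generated\<close> applies; injectivity of \<open>hat\<close> brings the result
  back.\<close>

lemma carrier_specht:
  assumes "p \<noteq> []" "antitone p"
  shows "carrier (specht p) = {v \<in> carrier (permutation_module (tabloid p ` tableaux p)).
    hat (sum_list p) p v \<in> kern (sum_list p) p}"
    (is "_ = ?K")
proof -
  let ?M = "permutation_module (tabloid p ` tableaux p)" and ?n = "sum_list p"
  have car: "carrier (specht p) = submodule_generated ?M (polytabloid p ` tableaux p)"
    by (simp add: specht_def)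
  have poly: "polytabloid p t \<in> carrier ?M" if t: "t \<in> tableaux p" for t
    unfolding carrier_tabloid_module[OF assms(1)]
  proof (intro allI impI)
    fix u assume u: "u \<notin> blocks ?n (length p) ` wt ?n p"
    have "basis_vector (tabloid p (\<sigma> \<circ> t)) u = 0" if "\<sigma> \<in> column_stabilizer p t" for \<sigma>
    proof -
      have "\<sigma> \<circ> t \<in> tableaux p" using that t tableau_comp by (simp add: column_stabilizer_iff)
      then show ?thesis
        using u unfolding tabloids_eq_blocks[OF assms(1), symmetric] by (auto simp: basis_vector_def)
    qed
    then show "polytabloid p t u = 0" by (simp add: polytabloid_def)
  qed
  have K_lin: "(\<lambda>u. a * v u + b * w u) \<in> ?K" if "v \<in> ?K" "w \<in> ?K" for a b v w
    using that lin_comb[OF lin_kern, of "hat ?n p v" ?n p "hat ?n p w" a b]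
    by (auto simp: carrier_tabloid_module[OF assms(1)] hat_linear)
  have "submodule ?K rationals ?M"
    unfolding submodule_def submodule_axioms_def subgroup_def
  proof (intro conjI allI impI)
    show "?K \<subseteq> carrier (add_monoid ?M)" by auto
    show "v \<otimes>\<^bsub>add_monoid ?M\<^esub> w \<in> ?K" if "v \<in> ?K" "w \<in> ?K" for v w
      using K_lin[OF that, of 1 1] by (simp add: permutation_module_def)
    show "\<one>\<^bsub>add_monoid ?M\<^esub> \<in> ?K"
      using lin_zero[OF lin_kern] by (simp add: permutation_module_def hat_linear)
    show "inv\<^bsub>add_monoid ?M\<^esub> v \<in> ?K" if "v \<in> ?K" for v
      using K_lin[OF that that, of "-1" 0] that by (simp add: m_inv_permutation_module)
    show "a \<odot>\<^bsub>?M\<^esub> v \<in> ?K" if "a \<in> carrier rationals" "v \<in> ?K" for a v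
      using K_lin[OF that(2) that(2), of a 0] by (simp add: permutation_module_def)
  qed
  moreover have "polytabloid p ` tableaux p \<subseteq> ?K"
    using poly hat_polytabloid[OF assms(1)] polyt_kern[OF assms] by auto
  ultimately have "submodule_generated ?M (polytabloid p ` tableaux p) \<subseteq> ?K"
    unfolding submodule_generated_def by blast
  moreover have "?K \<subseteq> submodule_generated ?M (polytabloid p ` tableaux p)"
    unfolding submodule_generated_def
  proof (intro subsetI InterI)
    fix v H assume v: "v \<in> ?K" and "H \<in> {H. submodule H rationals ?M \<and> polytabloid p ` tableaux p \<subseteq> H}"
    then have H: "submodule H rationals ?M" and polyH: "\<And>t. t \<in> tableaux p \<Longrightarrow> polytabloid p t \<in> H"
      by auto
    have sub: "H \<subseteq> carrier ?M" using H by (simp add: submodule_def subgroup_def)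
    have add: "(\<lambda>u. v u + w u) \<in> H" if "v \<in> H" "w \<in> H" for v w
      using H that by (simp add: submodule_def subgroup_def permutation_module_def)
    have zero: "(\<lambda>u. 0) \<in> H"
      using H by (simp add: submodule_def subgroup_def permutation_module_def)
    have smult: "(\<lambda>u. a * v u) \<in> H" if "v \<in> H" for v a
      using H that carrier_rationals by (simp add: submodule_def submodule_axioms_def permutation_module_def)
    have "lin (hat ?n p ` H)"
    proof (rule linI)
      show "(\<lambda>_. 0) \<in> hat ?n p ` H"
        using zero by (intro image_eqI[of _ _ "\<lambda>u. 0"]) (simp_all add: hat_linear)
    next
      fix f g a b assume "f \<in> hat ?n p ` H" "g \<in> hat ?n p ` H"
      then obtain v w where "v \<in> H" "w \<in> H" "f = hat ?n p v" "g = hat ?n p w" by blast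
      then show "(\<lambda>c. a * f c + b * g c) \<in> hat ?n p ` H"
        using add[OF smult[of v a] smult[of w b]]
        by (intro image_eqI[of _ _ "\<lambda>u. a * v u + b * w u"]) (simp_all add: hat_linear)
    qed
    moreover have "polyt p t \<in> hat ?n p ` H" if "t \<in> tableaux p" for t
      using polyH[OF that] hat_polytabloid[OF assms(1) that] by (metis image_eqI)
    ultimately have "hat ?n p v \<in> hat ?n p ` H"
      using kern_generated[OF assms refl] v by blast
    then obtain w where "w \<in> H" "hat ?n p v = hat ?n p w" by blast
    then show "v \<in> H" using hat_inj[OF assms(1), of v w] v sub by auto
  qed
  ultimately show ?thesis using car by simp
qed

lemma wt_perm:
  assumes "\<pi> permutes {1..n}"
  shows "c \<circ> \<pi> \<in> wt n p \<longleftrightarrow> c \<in> wt n p"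
proof -
  have *: "c \<circ> \<pi> \<in> wt n p" if c: "c \<in> wt n p" and \<pi>: "\<pi> permutes {1..n}" for c \<pi>
  proof -
    have "(c \<circ> \<pi>) y = 0" if "y \<notin> {1..n}" for y
      using c that permutes_not_in[OF \<pi> that] unfolding wt_def colorings_def by simp
    moreover have "card {y \<in> {1..n}. (c \<circ> \<pi>) y = r} = card {y \<in> {1..n}. c y = r}" for r
    proof (rule bij_betw_same_card)
      have "\<pi> ` {y \<in> {1..n}. (c \<circ> \<pi>) y = r} = {y \<in> {1..n}. c y = r}"
      proof (intro equalityI subsetI)
        fix y assume y: "y \<in> {y \<in> {1..n}. c y = r}"
        then have "y \<in> \<pi> ` {1..n}" using permutes_image[OF \<pi>] by blast
        then show "y \<in> \<pi> ` {y \<in> {1..n}. (c \<circ> \<pi>) y = r}" using y by auto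
      qed (use permutes_in_image[OF \<pi>] in auto)
      then show "bij_betw \<pi> {y \<in> {1..n}. (c \<circ> \<pi>) y = r} {y \<in> {1..n}. c y = r}"
        using inj_on_subset[OF permutes_inj[OF \<pi>], of "{y \<in> {1..n}. (c \<circ> \<pi>) y = r}"]
        by (simp add: bij_betw_def)
    qed
    ultimately show ?thesis using c by (simp add: wt_def colorings_def)
  qed
  have "c \<in> wt n p" if "c \<circ> \<pi> \<in> wt n p"
    using *[OF that permutes_inv[OF assms]] permutes_inv_o(1)[OF assms] by (simp add: o_assoc[symmetric])
  then show ?thesis using * assms by blast
qed

lemma blocks_perm:
  assumes "\<pi> permutes {1..n}"
  shows "map (image (Hilbert_Choice.inv \<pi>)) (blocks n m c) = blocks n m (c \<circ> \<pi>)"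
proof -
  have "Hilbert_Choice.inv \<pi> ` {y \<in> {1..n}. c y = r} = {y \<in> {1..n}. (c \<circ> \<pi>) y = r}" for r
  proof (intro equalityI subsetI)
    fix y assume "y \<in> {y \<in> {1..n}. (c \<circ> \<pi>) y = r}"
    then have "\<pi> y \<in> {y \<in> {1..n}. c y = r}" using permutes_in_image[OF assms] by auto
    then show "y \<in> Hilbert_Choice.inv \<pi> ` {y \<in> {1..n}. c y = r}"
      using permutes_inverses(2)[OF assms, of y] by (metis imageI)
  qed (use permutes_in_image[OF permutes_inv[OF assms]] permutes_inverses(1)[OF assms] in auto)
  then show ?thesis by (simp add: blocks_def)
qed

lemma kern_perm:
  assumes "\<pi> permutes {1..n}" "f \<in> kern n p"
  shows "(\<lambda>c. f (c \<circ> \<pi>)) \<in> kern n p"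
  using assms(2) wt_perm[OF assms(1)] by (auto simp: kern_def wspace_def move_perm[OF assms(1)])

lemma hat_act:
  assumes "\<pi> permutes {1..n}"
  shows "hat n p (\<lambda>u. v (map (image (Hilbert_Choice.inv \<pi>)) u)) = (\<lambda>c. hat n p v (c \<circ> \<pi>))"
  by (auto simp: hat_def blocks_perm[OF assms] wt_perm[OF assms])

lemma specht_simps:
  "v \<oplus>\<^bsub>specht p\<^esub> w = (\<lambda>u. v u + w u)"
  "a \<odot>\<^bsub>specht p\<^esub> v = (\<lambda>u. a * v u)"
  "act (specht p) \<pi> v = (\<lambda>u. v (map (image (Hilbert_Choice.inv \<pi>)) u))"
  by (simp_all add: specht_def permutation_module_def)

lemma specht_closed:
  assumes "p \<noteq> []" "antitone p" "v \<in> carrier (specht p)" "w \<in> carrier (specht p)"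
  shows "(\<lambda>u. v u + w u) \<in> carrier (specht p)" "(\<lambda>u. a * v u) \<in> carrier (specht p)"
    and "\<pi> permutes {1..sum_list p} \<Longrightarrow>
      (\<lambda>u. v (map (image (Hilbert_Choice.inv \<pi>)) u)) \<in> carrier (specht p)"
proof -
  show "(\<lambda>u. v u + w u) \<in> carrier (specht p)" "(\<lambda>u. a * v u) \<in> carrier (specht p)"
    using assms(3,4) lin_add[OF lin_kern] lin_scale[OF lin_kern]
    by (auto simp: carrier_specht[OF assms(1,2)] carrier_tabloid_module[OF assms(1)] hat_linear)
  show "(\<lambda>u. v (map (image (Hilbert_Choice.inv \<pi>)) u)) \<in> carrier (specht p)"
    if \<pi>: "\<pi> permutes {1..sum_list p}"
  proof -
    have "v (map (image (Hilbert_Choice.inv \<pi>)) u) = 0"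
      if u: "u \<notin> blocks (sum_list p) (length p) ` wt (sum_list p) p" for u
    proof -
      have "map (image (Hilbert_Choice.inv \<pi>)) u \<notin> blocks (sum_list p) (length p) ` wt (sum_list p) p"
      proof
        assume "map (image (Hilbert_Choice.inv \<pi>)) u \<in> blocks (sum_list p) (length p) ` wt (sum_list p) p"
        then obtain c where c: "c \<in> wt (sum_list p) p"
          "map (image (Hilbert_Choice.inv \<pi>)) u = blocks (sum_list p) (length p) c" by blast
        have "u = map (image (Hilbert_Choice.inv (Hilbert_Choice.inv \<pi>))) (map (image (Hilbert_Choice.inv \<pi>)) u)"
          using permutes_inv_inv[OF \<pi>] permutes_inv_o(1)[OF \<pi>] by (simp add: image_comp o_def map_idI fun_eq_iff)
        also have "\<dots> = blocks (sum_list p) (length p) (c \<circ> Hilbert_Choice.inv \<pi>)"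
          unfolding c(2) by (rule blocks_perm[OF permutes_inv[OF \<pi>]])
        finally show False using u c(1) wt_perm[OF permutes_inv[OF \<pi>]] by blast
      qed
      then show ?thesis
        using assms(3) carrier_specht[OF assms(1,2)] carrier_tabloid_module[OF assms(1)] by blast
    qed
    then show ?thesis
      using assms(3) kern_perm[OF \<pi>]
      by (auto simp: carrier_specht[OF assms(1,2)] carrier_tabloid_module[OF assms(1)] hat_act[OF \<pi>])
  qed
qed

lemma hat_bij:
  assumes "p \<noteq> []" "antitone p"
  shows "bij_betw (hat (sum_list p) p) (carrier (specht p)) (kern (sum_list p) p)"
  unfolding bij_betw_def
proof
  show "inj_on (hat (sum_list p) p) (carrier (specht p))"
    using hat_inj[OF assms(1)] by (auto simp: carrier_specht[OF assms] inj_on_def)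
  show "hat (sum_list p) p ` carrier (specht p) = kern (sum_list p) p"
  proof (intro equalityI subsetI)
    fix f assume f: "f \<in> kern (sum_list p) p"
    then obtain v where "v \<in> carrier (permutation_module (tabloid p ` tableaux p))"
        "hat (sum_list p) p v = f"
      using hat_surj[OF assms(1)] by (auto simp: kern_def)
    then show "f \<in> hat (sum_list p) p ` carrier (specht p)" using f by (auto simp: carrier_specht[OF assms])
  qed (auto simp: carrier_specht[OF assms])
qed

lemma listset_iff: "xs \<in> listset As \<longleftrightarrow> length xs = length As \<and> (\<forall>i < length As. xs ! i \<in> As ! i)"
proof (induction As arbitrary: xs)
  case (Cons A As)
  show ?case
    by (cases xs) (auto simp: set_Cons_def Cons.IH nth_Cons split: nat.splits)
qed auto

text \<open>The decompositions are built as maps from the summands into \<open>M\<close>, while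
  \<open>sn_iso\<close> asks for a map out of \<open>M\<close>. Closure of \<open>N\<close> under
  its operations allows the inverse to be evaluated on their results.\<close>

lemma sn_isoI:
  assumes bij: "bij_betw \<Theta> (carrier N) (carrier M)"
    and add: "\<And>x y. x \<in> carrier N \<Longrightarrow> y \<in> carrier N \<Longrightarrow>
      x \<oplus>\<^bsub>N\<^esub> y \<in> carrier N \<and> \<Theta> (x \<oplus>\<^bsub>N\<^esub> y) = \<Theta> x \<oplus>\<^bsub>M\<^esub> \<Theta> y"
    and smult: "\<And>a x. x \<in> carrier N \<Longrightarrow> a \<odot>\<^bsub>N\<^esub> x \<in> carrier N \<and> \<Theta> (a \<odot>\<^bsub>N\<^esub> x) = a \<odot>\<^bsub>M\<^esub> \<Theta> x"
    and equivariant: "\<And>\<pi> x. \<pi> permutes {1..n} \<Longrightarrow> x \<in> carrier N \<Longrightarrow>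
      act N \<pi> x \<in> carrier N \<and> \<Theta> (act N \<pi> x) = act M \<pi> (\<Theta> x)"
  shows "sn_iso n M N"
proof -
  define \<phi> where "\<phi> = inv_into (carrier N) \<Theta>"
  have inv: "\<phi> (\<Theta> x) = x" if "x \<in> carrier N" for x
    unfolding \<phi>_def using bij that by (simp add: bij_betw_def)
  have surj: "\<exists>x\<in>carrier N. y = \<Theta> x" if "y \<in> carrier M" for y
    using bij that by (auto simp: bij_betw_def)
  have "bij_betw \<phi> (carrier M) (carrier N)"
    unfolding \<phi>_def by (rule bij_betw_inv_into[OF bij])
  moreover have "\<phi> (x \<oplus>\<^bsub>M\<^esub> y) = \<phi> x \<oplus>\<^bsub>N\<^esub> \<phi> y" if "x \<in> carrier M" "y \<in> carrier M" for x y
    using surj[OF that(1)] surj[OF that(2)] add inv by metis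
  ultimately have "\<phi> \<in> iso (add_monoid M) (add_monoid N)"
    by (auto simp: iso_def hom_def bij_betw_def)
  moreover have "\<phi> (c \<odot>\<^bsub>M\<^esub> x) = c \<odot>\<^bsub>N\<^esub> \<phi> x" if "x \<in> carrier M" for c x
    using surj[OF that] smult inv by metis
  moreover have "\<phi> (act M \<pi> x) = act N \<pi> (\<phi> x)" if "\<pi> \<in> carrier (sym_group n)" "x \<in> carrier M" for \<pi> x
    using surj[OF that(2)] equivariant inv that(1) unfolding sym_group_carrier by metis
  ultimately show ?thesis unfolding sn_iso_def by blast
qed

text \<open>Applying \<open>hat\<close> in each entry replaces Specht modules by kernels. What
  remains to be supplied is a linear equivariant bijection defined on tuples of highest weight
  vectors.\<close>

lemma specht_sum_iso:
  assumes ps: "\<And>p. p \<in> set ps \<Longrightarrow> p \<noteq> [] \<and> antitone p \<and> sum_list p = n"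
    and bij: "bij_betw \<Psi> (listset (map (kern n) ps)) (carrier A)"
    and add: "\<And>fs gs. fs \<in> listset (map (kern n) ps) \<Longrightarrow> gs \<in> listset (map (kern n) ps) \<Longrightarrow>
      \<Psi> (map2 (\<lambda>f g c. f c + g c) fs gs) = \<Psi> fs \<oplus>\<^bsub>A\<^esub> \<Psi> gs"
    and smult: "\<And>a fs. fs \<in> listset (map (kern n) ps) \<Longrightarrow>
      \<Psi> (map (\<lambda>f c. a * f c) fs) = a \<odot>\<^bsub>A\<^esub> \<Psi> fs"
    and equivariant: "\<And>\<pi> fs. \<pi> permutes {1..n} \<Longrightarrow> fs \<in> listset (map (kern n) ps) \<Longrightarrow>
      \<Psi> (map (\<lambda>f c. f (c \<circ> \<pi>)) fs) = act A \<pi> (\<Psi> fs)"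
  shows "sn_iso n A (direct_sum (map specht ps))"
proof -
  let ?D = "direct_sum (map specht ps)"
  define hats where "hats = map2 (hat n) ps"
  have car: "xs \<in> carrier ?D \<longleftrightarrow> length xs = length ps \<and> (\<forall>i<length ps. xs ! i \<in> carrier (specht (ps ! i)))"
    for xs by (auto simp: direct_sum_def listset_iff)
  have kern: "fs \<in> listset (map (kern n) ps) \<longleftrightarrow> length fs = length ps \<and> (\<forall>i<length ps. fs ! i \<in> kern n (ps ! i))"
    for fs by (auto simp: listset_iff)
  have p: "ps ! i \<noteq> []" "antitone (ps ! i)" "sum_list (ps ! i) = n" if "i < length ps" for i
    using ps[OF nth_mem[OF that]] by auto
  have hbij: "bij_betw (hat n (ps ! i)) (carrier (specht (ps ! i))) (kern n (ps ! i))" if "i < length ps" for i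
    using hat_bij[OF p(1,2)[OF that]] p(3)[OF that] by simp
  have nth_hats: "hats xs ! i = hat n (ps ! i) (xs ! i)" if "i < length ps" "length xs = length ps" for i xs
    using that by (simp add: hats_def)
  have hats: "hats xs \<in> listset (map (kern n) ps)" if "xs \<in> carrier ?D" for xs
    unfolding kern
  proof (intro conjI allI impI)
    show "hats xs ! i \<in> kern n (ps ! i)" if i: "i < length ps" for i
      using bij_betwE[OF hbij[OF i]] nth_hats[OF i] \<open>xs \<in> carrier ?D\<close> i unfolding car by auto
  qed (use that in \<open>simp add: car hats_def\<close>)
  have "bij_betw hats (carrier ?D) (listset (map (kern n) ps))"
    unfolding bij_betw_def
  proof
    show "inj_on hats (carrier ?D)"
    proof (rule inj_onI)
      fix xs ys assume *: "xs \<in> carrier ?D" "ys \<in> carrier ?D" "hats xs = hats ys"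
      show "xs = ys"
      proof (rule nth_equalityI)
        show "length xs = length ys" using * by (simp add: car)
        fix i assume i: "i < length xs"
        then have "hat n (ps ! i) (xs ! i) = hat n (ps ! i) (ys ! i)"
        proof -
          have "hats xs ! i = hats ys ! i" using *(3) by (rule arg_cong)
          then show ?thesis
            using nth_hats[of i xs] nth_hats[of i ys] *(1,2) i unfolding car by simp
        qed
        then show "xs ! i = ys ! i"
          using inj_onD[OF bij_betw_imp_inj_on[OF hbij[of i]]] * i unfolding car by metis
      qed
    qed
    show "hats ` carrier ?D = listset (map (kern n) ps)"
    proof (intro equalityI subsetI)
      fix fs assume fs: "fs \<in> listset (map (kern n) ps)"
      define xs where "xs = map2 (\<lambda>p. inv_into (carrier (specht p)) (hat n p)) ps fs"
      have len: "length fs = length ps" and mem: "\<And>i. i < length ps \<Longrightarrow> fs ! i \<in> kern n (ps ! i)"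
        using fs unfolding kern by blast+
      have "xs \<in> carrier ?D"
        unfolding car
      proof (intro conjI allI impI)
        show "xs ! i \<in> carrier (specht (ps ! i))" if "i < length ps" for i
          using bij_betwE[OF bij_betw_inv_into[OF hbij[OF that]]] mem[OF that] that len
          by (simp add: xs_def)
      qed (simp add: xs_def len)
      moreover have "hats xs = fs"
      proof (rule nth_equalityI)
        fix i assume "i < length (hats xs)"
        then have i: "i < length ps" by (simp add: hats_def)
        then show "hats xs ! i = fs ! i"
          using bij_betw_inv_into_right[OF hbij[OF i] mem[OF i]] len by (simp add: hats_def xs_def)
      qed (simp add: hats_def xs_def len)
      ultimately show "fs \<in> hats ` carrier ?D" by blast
    next
      fix fs assume "fs \<in> hats ` carrier ?D"
      then show "fs \<in> listset (map (kern n) ps)" using hats by blast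
    qed
  qed
  then have "bij_betw (\<Psi> \<circ> hats) (carrier ?D) (carrier A)" using bij by (rule bij_betw_trans)
  then show ?thesis
  proof (rule sn_isoI)
    fix xs ys assume xs: "xs \<in> carrier ?D" and ys: "ys \<in> carrier ?D"
    have len: "length xs = length ps" "length ys = length ps" using xs ys unfolding car by auto
    have eq: "xs \<oplus>\<^bsub>?D\<^esub> ys = map2 (\<lambda>x y u. x u + y u) xs ys"
      using len by (intro nth_equalityI) (simp_all add: direct_sum_def specht_simps)
    have "hats (xs \<oplus>\<^bsub>?D\<^esub> ys) = map2 (\<lambda>f g c. f c + g c) (hats xs) (hats ys)"
      using xs ys by (intro nth_equalityI) (auto simp: eq car hats_def hat_linear)
    moreover have "xs \<oplus>\<^bsub>?D\<^esub> ys \<in> carrier ?D"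
      using xs ys specht_closed(1) p unfolding eq by (auto simp: car)
    ultimately show "xs \<oplus>\<^bsub>?D\<^esub> ys \<in> carrier ?D \<and> (\<Psi> \<circ> hats) (xs \<oplus>\<^bsub>?D\<^esub> ys) = (\<Psi> \<circ> hats) xs \<oplus>\<^bsub>A\<^esub> (\<Psi> \<circ> hats) ys"
      using add[OF hats[OF xs] hats[OF ys]] by simp
  next
    fix a xs assume xs: "xs \<in> carrier ?D"
    have len: "length xs = length ps" using xs unfolding car by auto
    have eq: "a \<odot>\<^bsub>?D\<^esub> xs = map (\<lambda>x u. a * x u) xs"
      using len by (intro nth_equalityI) (simp_all add: direct_sum_def specht_simps)
    have "hats (a \<odot>\<^bsub>?D\<^esub> xs) = map (\<lambda>f c. a * f c) (hats xs)"
      using xs by (intro nth_equalityI) (auto simp: eq car hats_def hat_linear)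
    moreover have "a \<odot>\<^bsub>?D\<^esub> xs \<in> carrier ?D"
      using xs specht_closed(2) p unfolding eq by (auto simp: car)
    ultimately show "a \<odot>\<^bsub>?D\<^esub> xs \<in> carrier ?D \<and> (\<Psi> \<circ> hats) (a \<odot>\<^bsub>?D\<^esub> xs) = a \<odot>\<^bsub>A\<^esub> (\<Psi> \<circ> hats) xs"
      using smult[OF hats[OF xs]] by simp
  next
    fix \<pi> xs assume \<pi>: "\<pi> permutes {1..n}" and xs: "xs \<in> carrier ?D"
    have len: "length xs = length ps" using xs unfolding car by auto
    have eq: "act ?D \<pi> xs = map (\<lambda>x u. x (map (image (Hilbert_Choice.inv \<pi>)) u)) xs"
      using len by (intro nth_equalityI) (simp_all add: direct_sum_def specht_simps)
    have "hats (act ?D \<pi> xs) = map (\<lambda>f c. f (c \<circ> \<pi>)) (hats xs)"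
      using xs by (intro nth_equalityI) (auto simp: eq car hats_def hat_act[OF \<pi>])
    moreover have "act ?D \<pi> xs \<in> carrier ?D"
      using xs specht_closed(3) p \<pi> unfolding eq by (auto simp: car)
    ultimately show "act ?D \<pi> xs \<in> carrier ?D \<and> (\<Psi> \<circ> hats) (act ?D \<pi> xs) = act A \<pi> ((\<Psi> \<circ> hats) xs)"
      using equivariant[OF \<pi> hats[OF xs]] by simp
  qed
qed

section \<open>The Arnold ideal\<close>

lemma tensor_algebra_simps:
  "carrier (tensor_algebra n) = {f. finite {u. f u \<noteq> 0} \<and> {u. f u \<noteq> 0} \<subseteq> lists (generators n)}"
  "f \<oplus>\<^bsub>tensor_algebra n\<^esub> g = (\<lambda>u. f u + g u)"
  "\<zero>\<^bsub>tensor_algebra n\<^esub> = (\<lambda>u. 0)"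
  "f \<otimes>\<^bsub>tensor_algebra n\<^esub> g = (\<lambda>u. \<Sum>k\<le>length u. f (take k u) * g (drop k u))"
  "\<one>\<^bsub>tensor_algebra n\<^esub> = basis_vector []"
  "a \<odot>\<^bsub>tensor_algebra n\<^esub> f = (\<lambda>u. a * f u)"
  "act (tensor_algebra n) \<pi> f = (\<lambda>u. f (map (image (Hilbert_Choice.inv \<pi>)) u))"
  by (simp_all add: tensor_algebra_def permutation_module_def)

lemma lin_tensor_algebra: "lin (carrier (tensor_algebra n))"
proof (rule linI)
  fix f g a b assume *: "f \<in> carrier (tensor_algebra n)" "g \<in> carrier (tensor_algebra n)"
  have "{u. a * f u + b * g u \<noteq> 0} \<subseteq> {u. f u \<noteq> 0} \<union> {u. g u \<noteq> 0}" by auto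
  then show "(\<lambda>u. a * f u + b * g u) \<in> carrier (tensor_algebra n)"
    using * unfolding tensor_algebra_simps(1) mem_Collect_eq
    by (meson finite_UnI finite_subset subset_trans Un_least)
qed (simp add: tensor_algebra_simps)

lemma tensor_mult_closed:
  assumes "f \<in> carrier (tensor_algebra n)" "g \<in> carrier (tensor_algebra n)"
  shows "f \<otimes>\<^bsub>tensor_algebra n\<^esub> g \<in> carrier (tensor_algebra n)"
proof -
  let ?S = "\<lambda>f. {u. f u \<noteq> (0::rat)}"
  have sub: "?S (f \<otimes>\<^bsub>tensor_algebra n\<^esub> g) \<subseteq> (\<lambda>(x, y). x @ y) ` (?S f \<times> ?S g)"
  proof
    fix u assume "u \<in> ?S (f \<otimes>\<^bsub>tensor_algebra n\<^esub> g)"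
    then obtain k where "f (take k u) \<noteq> 0" "g (drop k u) \<noteq> 0"
      by (auto simp: tensor_algebra_simps elim!: sum.not_neutral_contains_not_neutral)
    then show "u \<in> (\<lambda>(x, y). x @ y) ` (?S f \<times> ?S g)"
      by (intro image_eqI[of _ _ "(take k u, drop k u)"]) auto
  qed
  moreover have "finite ((\<lambda>(x, y). x @ y) ` (?S f \<times> ?S g))"
    using assms by (simp add: tensor_algebra_simps)
  moreover have "(\<lambda>(x, y). x @ y) ` (?S f \<times> ?S g) \<subseteq> lists (generators n)"
    using assms unfolding tensor_algebra_simps(1) mem_Collect_eq by (auto dest!: subsetD)
  ultimately show ?thesis
    unfolding tensor_algebra_simps(1) mem_Collect_eq by (meson finite_subset subset_trans)
qed

text \<open>Both sides sum over two cut points of the word; the reindexing measures the second one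
  from the first instead of from the start.\<close>

lemma tensor_mult_assoc:
  "(f \<otimes>\<^bsub>tensor_algebra n\<^esub> g) \<otimes>\<^bsub>tensor_algebra n\<^esub> h
    = f \<otimes>\<^bsub>tensor_algebra n\<^esub> (g \<otimes>\<^bsub>tensor_algebra n\<^esub> h)"
proof
  fix u :: "nat set list"
  let ?N = "length u"
  have "((f \<otimes>\<^bsub>tensor_algebra n\<^esub> g) \<otimes>\<^bsub>tensor_algebra n\<^esub> h) u
     = (\<Sum>k\<le>?N. \<Sum>j\<le>k. f (take j u) * g (drop j (take k u)) * h (drop k u))"
    unfolding tensor_algebra_simps(4) sum_distrib_right
    by (intro sum.cong refl) (auto simp: min_absorb1 min_absorb2)
  also have "\<dots> = (\<Sum>(k, j) \<in> (SIGMA k:{..?N}. {..k}). f (take j u) * g (drop j (take k u)) * h (drop k u))"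
    by (simp add: sum.Sigma)
  also have "\<dots> = (\<Sum>(j, i) \<in> (SIGMA j:{..?N}. {..?N - j}).
      f (take j u) * (g (take i (drop j u)) * h (drop i (drop j u))))"
    by (rule sum.reindex_bij_witness[of _ "\<lambda>(j, i). (i + j, j)" "\<lambda>(k, j). (j, k - j)"])
      (auto simp: drop_take)
  also have "\<dots> = (f \<otimes>\<^bsub>tensor_algebra n\<^esub> (g \<otimes>\<^bsub>tensor_algebra n\<^esub> h)) u"
    by (simp add: tensor_algebra_simps sum_distrib_left sum.Sigma)
  finally show "((f \<otimes>\<^bsub>tensor_algebra n\<^esub> g) \<otimes>\<^bsub>tensor_algebra n\<^esub> h) u
    = (f \<otimes>\<^bsub>tensor_algebra n\<^esub> (g \<otimes>\<^bsub>tensor_algebra n\<^esub> h)) u" .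
qed

lemma basis_vector_carrier: "u \<in> lists (generators n) \<Longrightarrow> basis_vector u \<in> carrier (tensor_algebra n)"
  by (auto simp: tensor_algebra_simps basis_vector_def)

lemma tensor_one_mult: "basis_vector [] \<otimes>\<^bsub>tensor_algebra n\<^esub> f = f"
proof
  fix u
  have "(basis_vector [] \<otimes>\<^bsub>tensor_algebra n\<^esub> f) u = (\<Sum>k\<le>length u. if k = 0 then f u else 0)"
    unfolding tensor_algebra_simps by (rule sum.cong) (auto simp: basis_vector_def)
  then show "(basis_vector [] \<otimes>\<^bsub>tensor_algebra n\<^esub> f) u = f u" by simp
qed

lemma tensor_mult_one: "f \<otimes>\<^bsub>tensor_algebra n\<^esub> basis_vector [] = f"
proof
  fix u
  have "(f \<otimes>\<^bsub>tensor_algebra n\<^esub> basis_vector []) u = (\<Sum>k\<le>length u. if k = length u then f u else 0)"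
    unfolding tensor_algebra_simps by (rule sum.cong) (auto simp: basis_vector_def)
  then show "(f \<otimes>\<^bsub>tensor_algebra n\<^esub> basis_vector []) u = f u" by simp
qed

lemma ring_tensor_algebra: "ring (tensor_algebra n)"
proof (rule ringI)
  let ?T = "tensor_algebra n"
  note lin = lin_tensor_algebra[of n]
  show "abelian_group ?T"
  proof (rule abelian_groupI)
    fix f assume "f \<in> carrier ?T"
    then have "(\<lambda>u. - f u) \<in> carrier ?T" using lin_scale[OF lin, of f "-1"] by simp
    then show "\<exists>g\<in>carrier ?T. g \<oplus>\<^bsub>?T\<^esub> f = \<zero>\<^bsub>?T\<^esub>"
      by (intro bexI[of _ "\<lambda>u. - f u"]) (simp_all add: tensor_algebra_simps)
  next
    show "\<zero>\<^bsub>?T\<^esub> \<in> carrier ?T" using lin_zero[OF lin] by (simp add: tensor_algebra_simps)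
  next
    fix f g assume "f \<in> carrier ?T" "g \<in> carrier ?T"
    then show "f \<oplus>\<^bsub>?T\<^esub> g \<in> carrier ?T" unfolding tensor_algebra_simps(2) by (rule lin_add[OF lin])
  qed (simp_all add: tensor_algebra_simps(2,3) add_ac)
  show "Group.monoid ?T"
  proof (rule monoidI)
    show "\<one>\<^bsub>?T\<^esub> \<in> carrier ?T"
      using basis_vector_carrier[of "[]" n] by (simp add: tensor_algebra_simps(5))
  qed (simp_all only: tensor_mult_closed tensor_mult_assoc tensor_algebra_simps(5) tensor_one_mult tensor_mult_one)
qed (simp_all add: tensor_algebra_simps fun_eq_iff distrib_left distrib_right sum.distrib)

lemma tensor_mult_basis:
  "basis_vector u \<otimes>\<^bsub>tensor_algebra n\<^esub> basis_vector v = basis_vector (u @ v)"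
proof
  fix w
  have "(basis_vector u \<otimes>\<^bsub>tensor_algebra n\<^esub> basis_vector v) w
      = (\<Sum>k\<le>length w. if k = length u then basis_vector (u @ v) w else 0)"
    unfolding tensor_algebra_simps
  proof (rule sum.cong[OF refl])
    fix k assume k: "k \<in> {..length w}"
    have "take k w = u \<and> drop k w = v \<longleftrightarrow> k = length u \<and> w = u @ v"
    proof
      assume *: "take k w = u \<and> drop k w = v"
      then have "w = u @ v" by (metis append_take_drop_id)
      moreover have "k = length u" using * k by auto
      ultimately show "k = length u \<and> w = u @ v" by simp
    qed simp
    moreover have "basis_vector u (take k w) * basis_vector v (drop k w)
        = of_bool (take k w = u \<and> drop k w = v)" by (simp add: basis_vector_def)
    ultimately show "basis_vector u (take k w) * basis_vector v (drop k w)
        = (if k = length u then basis_vector (u @ v) w else 0)"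
      by (simp add: basis_vector_def)
  qed
  then show "(basis_vector u \<otimes>\<^bsub>tensor_algebra n\<^esub> basis_vector v) w = basis_vector (u @ v) w"
    by (auto simp: basis_vector_def)
qed

lemma tensor_minus:
  assumes "f \<in> carrier (tensor_algebra n)" "g \<in> carrier (tensor_algebra n)"
  shows "f \<ominus>\<^bsub>tensor_algebra n\<^esub> g = (\<lambda>u. f u - g u)"
proof -
  interpret ring "tensor_algebra n" by (rule ring_tensor_algebra)
  have "\<ominus>\<^bsub>tensor_algebra n\<^esub> g = (\<lambda>u. - g u)"
    by (rule minus_equality)
      (use assms lin_scale[OF lin_tensor_algebra, of g n "-1"] in \<open>simp_all add: tensor_algebra_simps(2,3)\<close>)
  then show ?thesis by (simp add: a_minus_def tensor_algebra_simps(2))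
qed

lemma generators_iff: "A \<in> generators n \<longleftrightarrow> A \<subseteq> {1..n} \<and> card A = 2"
proof
  assume "A \<in> generators n"
  then show "A \<subseteq> {1..n} \<and> card A = 2" by (auto simp: generators_def)
next
  assume A: "A \<subseteq> {1..n} \<and> card A = 2"
  then obtain x y where xy: "A = {x, y}" "x \<noteq> y" by (auto simp: card_2_iff)
  have "\<exists>i j. A = {i, j} \<and> i < j"
  proof (cases "x < y")
    case True then show ?thesis using xy by blast
  next
    case False
    then have "A = {y, x} \<and> y < x" using xy by auto
    then show ?thesis by blast
  qed
  then obtain i j where ij: "A = {i, j}" "i < j" by blast
  then have "1 \<le> i" "j \<le> n" using A by auto
  then show "A \<in> generators n" using ij unfolding generators_def by blast
qed

lemma generators_doubleton: "i \<in> {1..n} \<Longrightarrow> j \<in> {1..n} \<Longrightarrow> i \<noteq> j \<Longrightarrow> {i, j} \<in> generators n"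
  by (simp add: generators_iff)

lemma finite_generators: "finite (generators n)"
  by (rule finite_subset[of _ "Pow {1..n}"]) (use generators_iff in blast, simp)

definition word :: "nat set \<Rightarrow> nat set \<Rightarrow> nat set list \<Rightarrow> rat" where
  "word A B = basis_vector [A, B]"

lemma word_carrier: "A \<in> generators n \<Longrightarrow> B \<in> generators n \<Longrightarrow> word A B \<in> carrier (tensor_algebra n)"
  unfolding word_def by (rule basis_vector_carrier) simp

lemma YB_words:
  assumes "1 \<le> i" "i < j" "j < k" "k \<le> n"
  shows "YB n i j k = (\<lambda>u. word {i, j} {i, k} u - word {i, j} {j, k} u + word {i, k} {j, k} u)"
proof -
  have G: "{i, j} \<in> generators n" "{i, k} \<in> generators n" "{j, k} \<in> generators n"
    using assms by (auto intro!: generators_doubleton)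
  show ?thesis
    unfolding YB_def Let_def w_gen_def tensor_mult_basis append.simps word_def[symmetric]
      tensor_minus[OF word_carrier[OF G(1,2)] word_carrier[OF G(1,3)]] tensor_algebra_simps(2) ..
qed

lemma arnold_relations_carrier: "arnold_relations n \<subseteq> carrier (tensor_algebra n)"
proof
  fix f assume "f \<in> arnold_relations n"
  then consider v where "v \<in> tensor_component 1 n" "f = v \<otimes>\<^bsub>tensor_algebra n\<^esub> v"
    | i j k where "1 \<le> i" "i < j" "j < k" "k \<le> n" "f = YB n i j k"
    unfolding arnold_relations_def by blast
  then show "f \<in> carrier (tensor_algebra n)"
  proof cases
    case 1
    then show ?thesis using tensor_mult_closed by (simp add: tensor_component_def)
  next
    case 2
    have G: "{i, j} \<in> generators n" "{i, k} \<in> generators n" "{j, k} \<in> generators n"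
      using 2 by (auto intro!: generators_doubleton)
    show ?thesis
      unfolding 2(5) YB_words[OF 2(1-4)]
      by (intro lin_add[OF lin_tensor_algebra] lin_diff[OF lin_tensor_algebra] word_carrier G)
  qed
qed

lemma arnold_ideal_ideal: "ideal (arnold_ideal n) (tensor_algebra n)"
  unfolding arnold_ideal_def
  by (rule ring.genideal_ideal[OF ring_tensor_algebra arnold_relations_carrier])

lemma arnold_relations_ideal: "arnold_relations n \<subseteq> arnold_ideal n"
  unfolding arnold_ideal_def
  by (rule ring.genideal_self[OF ring_tensor_algebra arnold_relations_carrier])

text \<open>Scalars are realized in the ring as multiples of the empty word, so an ideal is a
  rational subspace.\<close>

lemma lin_ideal:
  assumes "ideal I (tensor_algebra n)"
  shows "lin I"
proof -
  interpret ideal I "tensor_algebra n" by (rule assms)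
  have scale: "(\<lambda>u. a * f u) \<in> I" if f: "f \<in> I" for a f
  proof -
    have "(\<lambda>u. a * basis_vector [] u) \<in> carrier (tensor_algebra n)"
      using lin_scale[OF lin_tensor_algebra basis_vector_carrier[of "[]" n]] by simp
    then have "(\<lambda>u. a * basis_vector [] u) \<otimes>\<^bsub>tensor_algebra n\<^esub> f \<in> I"
      using f by (rule I_l_closed[rotated])
    moreover have "(\<lambda>u. a * basis_vector [] u) \<otimes>\<^bsub>tensor_algebra n\<^esub> f
        = (\<lambda>u. a * (basis_vector [] \<otimes>\<^bsub>tensor_algebra n\<^esub> f) u)"
      by (simp add: tensor_algebra_simps(4) sum_distrib_left mult.assoc)
    ultimately show ?thesis by (simp add: tensor_one_mult)
  qed
  show ?thesis
  proof (rule linI)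
    show "(\<lambda>_. 0) \<in> I" using additive_subgroup.zero_closed[OF is_additive_subgroup] by (simp add: tensor_algebra_simps(3))
    fix f g a b assume "f \<in> I" "g \<in> I"
    then show "(\<lambda>u. a * f u + b * g u) \<in> I"
      using additive_subgroup.a_closed[OF is_additive_subgroup scale[of f a] scale[of g b]] by (simp add: tensor_algebra_simps(2))
  qed
qed

lemmas lin_arnold_ideal = lin_ideal[OF arnold_ideal_ideal]

lemma basis_vector_tensor_component: "A \<in> generators n \<Longrightarrow> basis_vector [A] \<in> tensor_component 1 n"
  using basis_vector_carrier[of "[A]" n] by (auto simp: tensor_component_def basis_vector_def)

lemma square_in_arnold_ideal: "A \<in> generators n \<Longrightarrow> word A A \<in> arnold_ideal n"
  using arnold_relations_ideal[of n] basis_vector_tensor_component[of A n] tensor_mult_basis[of n "[A]" "[A]"]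
  by (auto simp: arnold_relations_def word_def)

lemma lin_tensor_component: "lin (tensor_component d n)"
proof (rule linI)
  show "(\<lambda>_. 0) \<in> tensor_component d n"
    using lin_zero[OF lin_tensor_algebra] by (simp add: tensor_component_def)
next
  fix f g a b assume *: "f \<in> tensor_component d n" "g \<in> tensor_component d n"
  then have "length u = d" if "a * f u + b * g u \<noteq> 0" for u
    using that by (cases "f u = 0") (auto simp: tensor_component_def)
  then show "(\<lambda>x. a * f x + b * g x) \<in> tensor_component d n"
    using * lin_comb[OF lin_tensor_algebra] by (simp add: tensor_component_def)
qed

text \<open>Polarization: expand the square of the sum of two generators and subtract the two
  squares.\<close>

lemma anticommute:
  assumes "A \<in> generators n" "B \<in> generators n"
  shows "(\<lambda>u. word A B u + word B A u) \<in> arnold_ideal n"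
proof -
  let ?v = "\<lambda>u. basis_vector [A] u + basis_vector [B] u"
  have "?v \<in> tensor_component 1 n"
    using assms by (intro lin_add[OF lin_tensor_component] basis_vector_tensor_component)
  then have "?v \<otimes>\<^bsub>tensor_algebra n\<^esub> ?v \<in> arnold_ideal n"
    using arnold_relations_ideal[of n] unfolding arnold_relations_def by blast
  moreover have "?v \<otimes>\<^bsub>tensor_algebra n\<^esub> ?v = (\<lambda>u. (word A A u + word B B u) + (word A B u + word B A u))"
  proof -
    interpret ring "tensor_algebra n" by (rule ring_tensor_algebra)
    have c: "basis_vector [A] \<in> carrier (tensor_algebra n)" "basis_vector [B] \<in> carrier (tensor_algebra n)"
      using assms by (simp_all add: basis_vector_carrier)
    have "?v \<otimes>\<^bsub>tensor_algebra n\<^esub> ?v = (basis_vector [A] \<oplus>\<^bsub>tensor_algebra n\<^esub> basis_vector [B])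
      \<otimes>\<^bsub>tensor_algebra n\<^esub> (basis_vector [A] \<oplus>\<^bsub>tensor_algebra n\<^esub> basis_vector [B])"
      by (simp add: tensor_algebra_simps(2))
    also have "\<dots> = (word A A \<oplus>\<^bsub>tensor_algebra n\<^esub> word B A) \<oplus>\<^bsub>tensor_algebra n\<^esub>
        (word A B \<oplus>\<^bsub>tensor_algebra n\<^esub> word B B)"
      using c by (simp add: l_distr r_distr tensor_mult_basis word_def)
    finally show ?thesis by (simp add: tensor_algebra_simps(2) algebra_simps)
  qed
  ultimately have f: "(\<lambda>u. (word A A u + word B B u) + (word A B u + word B A u)) \<in> arnold_ideal n"
    by simp
  have "(\<lambda>u. ((word A A u + word B B u) + (word A B u + word B A u)) - (word A A u + word B B u))
      \<in> arnold_ideal n"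
    by (rule lin_diff[OF lin_arnold_ideal f lin_add[OF lin_arnold_ideal
      square_in_arnold_ideal[OF assms(1)] square_in_arnold_ideal[OF assms(2)]]])
  then show ?thesis by simp
qed

text \<open>Modulo anticommutativity this is the relation \<open>YB\<close>, in a form that does not depend on the order
  of \<open>a, b, c\<close>.\<close>

definition cyc :: "nat \<Rightarrow> nat \<Rightarrow> nat \<Rightarrow> nat set list \<Rightarrow> rat" where
  "cyc a b c = (\<lambda>u. word {a, c} {b, c} u + word {b, a} {c, a} u + word {c, b} {a, b} u)"

lemma cyc_rotate: "cyc b c a = cyc a b c"
  by (simp add: cyc_def fun_eq_iff)

text \<open>Exchanging \<open>a\<close> and \<open>b\<close> reverses the order in each of the three
  products, so up to three anticommutators it changes the sign of \<open>cyc\<close>.\<close>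

lemma cyc_swap:
  assumes "a \<in> {1..n}" "b \<in> {1..n}" "c \<in> {1..n}" "a \<noteq> b" "a \<noteq> c" "b \<noteq> c"
    and "cyc a b c \<in> arnold_ideal n"
  shows "cyc b a c \<in> arnold_ideal n"
proof -
  have G: "{a, c} \<in> generators n" "{b, c} \<in> generators n" "{a, b} \<in> generators n"
    using assms by (auto intro!: generators_doubleton)
  have "(\<lambda>u. (word {a, c} {b, c} u + word {b, c} {a, c} u) + (word {a, b} {a, c} u + word {a, c} {a, b} u)
      + (word {b, c} {a, b} u + word {a, b} {b, c} u) - cyc a b c u) \<in> arnold_ideal n"
    by (intro lin_diff[OF lin_arnold_ideal] lin_add[OF lin_arnold_ideal] anticommute G assms)
  moreover have "(\<lambda>u. (word {a, c} {b, c} u + word {b, c} {a, c} u) + (word {a, b} {a, c} u + word {a, c} {a, b} u)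
      + (word {b, c} {a, b} u + word {a, b} {b, c} u) - cyc a b c u) = cyc b a c"
    by (simp add: cyc_def fun_eq_iff insert_commute)
  ultimately show ?thesis by simp
qed

lemma cyc_ordered:
  assumes "1 \<le> i" "i < j" "j < k" "k \<le> n"
  shows "cyc i j k \<in> arnold_ideal n"
proof -
  have G: "{i, j} \<in> generators n" "{j, k} \<in> generators n"
    using assms by (auto intro!: generators_doubleton)
  have "YB n i j k \<in> arnold_ideal n"
    using assms arnold_relations_ideal[of n] unfolding arnold_relations_def by blast
  then have "(\<lambda>u. YB n i j k u + (word {i, j} {j, k} u + word {j, k} {i, j} u)) \<in> arnold_ideal n"
    by (intro lin_add[OF lin_arnold_ideal] anticommute G)
  moreover have "(\<lambda>u. YB n i j k u + (word {i, j} {j, k} u + word {j, k} {i, j} u)) = cyc i j k"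
    by (simp add: YB_words[OF assms] cyc_def fun_eq_iff insert_commute)
  ultimately show ?thesis by simp
qed

text \<open>The relations are imposed only for increasing indices. Rotations and one swap reach all
  six orders, which is what makes the ideal stable under permutations.\<close>

lemma cyc_in_arnold_ideal:
  assumes "a \<in> {1..n}" "b \<in> {1..n}" "c \<in> {1..n}" "a \<noteq> b" "a \<noteq> c" "b \<noteq> c"
  shows "cyc a b c \<in> arnold_ideal n"
proof -
  have ord: "cyc x y z \<in> arnold_ideal n" if "x < y" "y < z" "x \<in> {1..n}" "y \<in> {1..n}" "z \<in> {1..n}" for x y z
    using cyc_ordered[of x y z n] that by simp
  have swap: "cyc y x z \<in> arnold_ideal n" if "x < y" "y < z" "x \<in> {1..n}" "y \<in> {1..n}" "z \<in> {1..n}" for x y z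
    by (rule cyc_swap) (use that ord in auto)
  consider "a < b" "b < c" | "a < c" "c < b" | "b < a" "a < c" | "b < c" "c < a" | "c < a" "a < b" | "c < b" "b < a"
    using assms by linarith
  then show ?thesis
  proof cases
    case 1 then show ?thesis using ord assms by blast
  next
    case 2 then show ?thesis using swap[of a c b] assms cyc_rotate by metis
  next
    case 3 then show ?thesis using swap[of b a c] assms cyc_rotate by metis
  next
    case 4 then show ?thesis using ord[of b c a] assms cyc_rotate by metis
  next
    case 5 then show ?thesis using ord[of c a b] assms cyc_rotate by metis
  next
    case 6 then show ?thesis using swap[of c b a] assms cyc_rotate by metis
  qed
qed

text \<open>The word \<open>[A, B]\<close> is sent to \<open>1\<^sub>A - 1\<^sub>B\<close> on \<open>K = A \<union> B\<close>. This kills the squares, the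
  anticommutators and the relations \<open>YB\<close>, and it does so for \<open>card K = 3\<close> and \<open>card K = 4\<close> alike.\<close>

definition theta :: "nat \<Rightarrow> (nat set list \<Rightarrow> rat) \<Rightarrow> nat \<Rightarrow> nat set \<Rightarrow> rat" where
  "theta n f x K = (\<Sum>(A, B) \<in> {(A, B) \<in> generators n \<times> generators n. A \<union> B = K}.
     f [A, B] * (of_bool (x \<in> A) - of_bool (x \<in> B)))"

lemma theta_linear:
  "theta n (\<lambda>u. f u + g u) x K = theta n f x K + theta n g x K"
  "theta n (\<lambda>u. a * f u) x K = a * theta n f x K"
  "theta n (\<lambda>u. f u - g u) x K = theta n f x K - theta n g x K"
  "theta n (\<lambda>u. 0) x K = 0"
  by (simp_all add: theta_def case_prod_unfold algebra_simps sum.distrib sum_subtractf sum_distrib_left)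

lemma finite_pairs: "finite {(A, B) \<in> generators n \<times> generators n. A \<union> B = K}"
  by (rule finite_subset[of _ "generators n \<times> generators n"]) (auto simp: finite_generators)

lemma theta_word:
  assumes "A \<in> generators n" "B \<in> generators n"
  shows "theta n (word A B) x K = (if A \<union> B = K then of_bool (x \<in> A) - of_bool (x \<in> B) else 0)"
proof -
  have "theta n (word A B) x K = (\<Sum>p \<in> {(A, B) \<in> generators n \<times> generators n. A \<union> B = K}.
      if p = (A, B) then of_bool (x \<in> A) - of_bool (x \<in> B) else 0)"
    unfolding theta_def
  proof (rule sum.cong[OF refl])
    fix p :: "nat set \<times> nat set"
    obtain A' B' where p: "p = (A', B')" by (cases p)
    show "(case p of (A', B') \<Rightarrow> word A B [A', B'] * (of_bool (x \<in> A') - of_bool (x \<in> B')))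
        = (if p = (A, B) then of_bool (x \<in> A) - of_bool (x \<in> B) else 0)"
      by (simp add: p word_def basis_vector_def)
  qed
  then show ?thesis using assms finite_pairs[of n K] by (simp add: sum.delta)
qed

text \<open>The factor in \<open>theta\<close> changes sign when \<open>A\<close> and
  \<open>B\<close> are exchanged. The coefficients of the square of a degree one element are
  symmetric, so such squares are killed.\<close>

lemma theta_antisym:
  assumes "\<And>A B. f [A, B] = f [B, A]"
  shows "theta n f x K = 0"
proof -
  have "theta n f x K = (\<Sum>(A, B) \<in> {(A, B) \<in> generators n \<times> generators n. A \<union> B = K}.
     f [B, A] * (of_bool (x \<in> B) - of_bool (x \<in> A)))"
    unfolding theta_def
    by (rule sum.reindex_bij_witness[of _ "\<lambda>(A, B). (B, A)" "\<lambda>(A, B). (B, A)"]) auto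
  also have "\<dots> = - theta n f x K"
    unfolding theta_def sum_negf[symmetric]
    by (rule sum.cong[OF refl]) (auto simp: assms algebra_simps split: prod.splits)
  finally show ?thesis by simp
qed

lemma idealI_lin:
  assumes J: "lin J" "J \<subseteq> carrier (tensor_algebra n)"
    and mult: "\<And>f g. f \<in> J \<Longrightarrow> g \<in> carrier (tensor_algebra n) \<Longrightarrow>
      g \<otimes>\<^bsub>tensor_algebra n\<^esub> f \<in> J \<and> f \<otimes>\<^bsub>tensor_algebra n\<^esub> g \<in> J"
  shows "ideal J (tensor_algebra n)"
proof (rule idealI[OF ring_tensor_algebra])
  let ?T = "tensor_algebra n"
  interpret ring ?T by (rule ring_tensor_algebra)
  show "subgroup J (add_monoid ?T)"
  proof (rule add.subgroupI)
    show "J \<subseteq> carrier ?T" by (rule J(2))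
    show "J \<noteq> {}" using lin_zero[OF J(1)] by blast
  next
    fix f assume f: "f \<in> J"
    then have "(\<lambda>u. - f u) \<in> J" using lin_scale[OF J(1), of f "-1"] by simp
    moreover from this have "\<ominus>\<^bsub>?T\<^esub> f = (\<lambda>u. - f u)"
      using f J(2) by (intro minus_equality) (auto simp: tensor_algebra_simps(2,3))
    ultimately show "\<ominus>\<^bsub>?T\<^esub> f \<in> J" by simp
  next
    fix f g assume "f \<in> J" "g \<in> J"
    then show "f \<oplus>\<^bsub>?T\<^esub> g \<in> J" unfolding tensor_algebra_simps(2) by (rule lin_add[OF J(1)])
  qed
qed (use mult in blast)+

text \<open>The generated ideal is the smallest one containing the relations, so an ideal of
  elements with these vanishing properties is exhibited. This is the lower bound for the quotient in
  degrees one and two.\<close>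

lemma arnold_ideal_theta:
  assumes "f \<in> arnold_ideal n"
  shows "f [A] = 0" "theta n f x K = 0"
proof -
  let ?T = "tensor_algebra n"
  \<comment> \<open>An ideal since its elements start in degree two.\<close>
  let ?J = "{f \<in> carrier ?T. f [] = 0 \<and> (\<forall>A. f [A] = 0) \<and> (\<forall>x K. theta n f x K = 0)}"
  have linJ: "lin ?J"
  proof (rule linI)
    show "(\<lambda>_. 0) \<in> ?J" using lin_zero[OF lin_tensor_algebra] by (simp add: theta_linear)
  next
    fix f g a b assume "f \<in> ?J" "g \<in> ?J"
    then show "(\<lambda>u. a * f u + b * g u) \<in> ?J"
      using lin_comb[OF lin_tensor_algebra] by (simp add: theta_linear)
  qed
  have "ideal ?J ?T"
  proof (rule idealI_lin[OF linJ])
    fix f g assume f: "f \<in> ?J" and g: "g \<in> carrier ?T"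
    have 1: "(g \<otimes>\<^bsub>?T\<^esub> f) [A, B] = g [] * f [A, B]" "(f \<otimes>\<^bsub>?T\<^esub> g) [A, B] = g [] * f [A, B]" for A B
      using f by (simp_all add: tensor_algebra_simps(4) numeral_2_eq_2)
    have 2: "theta n h x K = 0" if "\<And>A B. h [A, B] = g [] * f [A, B]" for h x K
    proof -
      have "theta n h x K = theta n (\<lambda>u. g [] * f u) x K" by (simp add: theta_def that)
      then show ?thesis using f by (simp add: theta_linear)
    qed
    show "g \<otimes>\<^bsub>?T\<^esub> f \<in> ?J \<and> f \<otimes>\<^bsub>?T\<^esub> g \<in> ?J"
      using f g tensor_mult_closed[OF g, of f] tensor_mult_closed[OF _ g, of f] 2[OF 1(1)] 2[OF 1(2)]
      by (simp add: tensor_algebra_simps(4))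
  qed blast
  moreover have "arnold_relations n \<subseteq> ?J"
  proof
    fix f assume f: "f \<in> arnold_relations n"
    then have car: "f \<in> carrier ?T" using arnold_relations_carrier by blast
    from f consider v where "v \<in> tensor_component 1 n" "f = v \<otimes>\<^bsub>?T\<^esub> v"
      | i j k where "1 \<le> i" "i < j" "j < k" "k \<le> n" "f = YB n i j k"
      unfolding arnold_relations_def by blast
    then show "f \<in> ?J"
    proof cases
      case 1
      have v: "v u = 0" if "length u \<noteq> 1" for u
        using 1(1) that by (auto simp: tensor_component_def)
      have "f [A, B] = v [A] * v [B]" for A B
        by (simp add: 1(2) tensor_algebra_simps(4) numeral_2_eq_2 v)
      then have "theta n f x K = 0" for x K by (intro theta_antisym) simp
      then show ?thesis using car by (simp add: 1(2) tensor_algebra_simps(4) v)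
    next
      case 2
      have G: "{i, j} \<in> generators n" "{i, k} \<in> generators n" "{j, k} \<in> generators n"
        using 2 by (auto intro!: generators_doubleton)
      \<comment> \<open>All three words of \<open>YB\<close> have the union
        \<open>{i, j, k}\<close>, and with the signs of \<open>YB\<close> the differences of
        indicators cancel.\<close>
      have "{i, j} \<union> {j, k} = {i, j} \<union> {i, k}" "{i, k} \<union> {j, k} = {i, j} \<union> {i, k}" by auto
      then have "theta n f x K = 0" for x K
        unfolding 2(5) YB_words[OF 2(1-4)] theta_linear theta_word[OF G(1,2)] theta_word[OF G(1,3)]
          theta_word[OF G(2,3)] by simp
      then show ?thesis
        using car by (simp add: 2(5) YB_words[OF 2(1-4)] word_def basis_vector_def)
    qed
  qed
  ultimately have "arnold_ideal n \<subseteq> ?J"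
    unfolding arnold_ideal_def by (rule ring.genideal_minimal[OF ring_tensor_algebra])
  then show "f [A] = 0" "theta n f x K = 0" using assms by auto
qed

section \<open>Components of the Arnold algebra\<close>

definition relabel :: "(nat \<Rightarrow> nat) \<Rightarrow> (nat set list \<Rightarrow> rat) \<Rightarrow> nat set list \<Rightarrow> rat" where
  "relabel \<pi> f = (\<lambda>u. f (map (image (Hilbert_Choice.inv \<pi>)) u))"

lemma relabel_linear:
  "relabel \<pi> (\<lambda>u. f u + g u) = (\<lambda>u. relabel \<pi> f u + relabel \<pi> g u)"
  "relabel \<pi> (\<lambda>u. f u - g u) = (\<lambda>u. relabel \<pi> f u - relabel \<pi> g u)"
  "relabel \<pi> (\<lambda>u. a * f u) = (\<lambda>u. a * relabel \<pi> f u)"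
  "relabel \<pi> (\<lambda>u. 0) = (\<lambda>u. 0)"
  by (simp_all add: relabel_def)

lemma relabel_mult:
  "relabel \<pi> (f \<otimes>\<^bsub>tensor_algebra n\<^esub> g) = relabel \<pi> f \<otimes>\<^bsub>tensor_algebra n\<^esub> relabel \<pi> g"
  by (simp add: relabel_def tensor_algebra_simps(4) take_map drop_map)

lemma generators_image:
  assumes "\<pi> permutes {1..n}"
  shows "\<pi> ` A \<in> generators n \<longleftrightarrow> A \<in> generators n"
proof -
  have "card (\<pi> ` A) = card A"
    using inj_on_subset[OF permutes_inj[OF assms]] by (intro card_image) blast
  moreover have "\<pi> ` A \<subseteq> {1..n} \<longleftrightarrow> A \<subseteq> {1..n}"
    using permutes_in_image[OF assms] by blast
  ultimately show ?thesis by (simp add: generators_iff)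
qed

lemma relabel_carrier:
  assumes "\<pi> permutes {1..n}" "f \<in> carrier (tensor_algebra n)"
  shows "relabel \<pi> f \<in> carrier (tensor_algebra n)"
proof -
  let ?m = "map (image (Hilbert_Choice.inv \<pi>))"
  have inv: "Hilbert_Choice.inv \<pi> permutes {1..n}" by (rule permutes_inv[OF assms(1)])
  have "inj ?m" using permutes_inj[OF inv] by (intro inj_mapI injI) (simp add: inj_image_eq_iff)
  then have "finite (?m -` {u. f u \<noteq> 0})"
    using assms(2) by (intro finite_vimageI) (simp_all add: tensor_algebra_simps(1))
  moreover have "?m -` {u. f u \<noteq> 0} \<subseteq> lists (generators n)"
  proof
    fix u assume "u \<in> ?m -` {u. f u \<noteq> 0}"
    then have "?m u \<in> lists (generators n)" using assms(2) by (auto simp: tensor_algebra_simps(1))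
    then show "u \<in> lists (generators n)" using generators_image[OF inv] by (auto simp: in_lists_conv_set)
  qed
  moreover have "{u. relabel \<pi> f u \<noteq> 0} = ?m -` {u. f u \<noteq> 0}" by (auto simp: relabel_def)
  ultimately show ?thesis by (simp add: tensor_algebra_simps(1))
qed

lemma relabel_component:
  assumes "\<pi> permutes {1..n}" "f \<in> tensor_component d n"
  shows "relabel \<pi> f \<in> tensor_component d n"
  using relabel_carrier[OF assms(1)] assms(2)
  by (simp add: tensor_component_def) (metis length_map relabel_def)

lemma image_inv_permutes:
  assumes "\<pi> permutes {1..n}"
  shows "Hilbert_Choice.inv \<pi> ` B = A \<longleftrightarrow> B = \<pi> ` A"
proof
  assume "Hilbert_Choice.inv \<pi> ` B = A"
  then have "\<pi> ` A = (\<pi> \<circ> Hilbert_Choice.inv \<pi>) ` B" by (auto simp: image_comp)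
  then show "B = \<pi> ` A" by (simp add: permutes_inv_o(1)[OF assms])
next
  assume "B = \<pi> ` A"
  then have "Hilbert_Choice.inv \<pi> ` B = (Hilbert_Choice.inv \<pi> \<circ> \<pi>) ` A" by (auto simp: image_comp)
  then show "Hilbert_Choice.inv \<pi> ` B = A" by (simp add: permutes_inv_o(2)[OF assms])
qed

lemma relabel_word:
  assumes "\<pi> permutes {1..n}"
  shows "relabel \<pi> (word A B) = word (\<pi> ` A) (\<pi> ` B)"
proof
  fix u
  have "map (image (Hilbert_Choice.inv \<pi>)) u = [A, B] \<longleftrightarrow> u = [\<pi> ` A, \<pi> ` B]"
    by (auto simp: map_eq_Cons_conv image_inv_permutes[OF assms])
  then show "relabel \<pi> (word A B) u = word (\<pi> ` A) (\<pi> ` B) u"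
    by (simp add: relabel_def word_def basis_vector_def)
qed

text \<open>The preimage of the ideal under relabeling is an ideal, so it suffices that it contains
  the relations. This makes the action on cosets well defined.\<close>

lemma relabel_arnold_ideal:
  assumes \<pi>: "\<pi> permutes {1..n}" and "f \<in> arnold_ideal n"
  shows "relabel \<pi> f \<in> arnold_ideal n"
proof -
  let ?T = "tensor_algebra n"
  let ?H = "{f \<in> carrier ?T. relabel \<pi> f \<in> arnold_ideal n}"
  interpret I: ideal "arnold_ideal n" ?T by (rule arnold_ideal_ideal)
  have linH: "lin ?H"
  proof (rule linI)
    show "(\<lambda>_. 0) \<in> ?H"
      using lin_zero[OF lin_tensor_algebra] lin_zero[OF lin_arnold_ideal] by (simp add: relabel_linear)
  next
    fix f g a b assume "f \<in> ?H" "g \<in> ?H"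
    then show "(\<lambda>u. a * f u + b * g u) \<in> ?H"
      using lin_comb[OF lin_tensor_algebra] lin_comb[OF lin_arnold_ideal] by (simp add: relabel_linear)
  qed
  have "ideal ?H ?T"
  proof (rule idealI_lin[OF linH])
    fix f g assume f: "f \<in> ?H" and g: "g \<in> carrier ?T"
    show "g \<otimes>\<^bsub>?T\<^esub> f \<in> ?H \<and> f \<otimes>\<^bsub>?T\<^esub> g \<in> ?H"
      using f g relabel_carrier[OF \<pi> g] tensor_mult_closed I.I_l_closed I.I_r_closed
      by (auto simp: relabel_mult)
  qed blast
  moreover have "arnold_relations n \<subseteq> ?H"
  proof
    fix f assume f: "f \<in> arnold_relations n"
    then have car: "f \<in> carrier ?T" using arnold_relations_carrier by blast
    from f consider v where "v \<in> tensor_component 1 n" "f = v \<otimes>\<^bsub>?T\<^esub> v"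
      | i j k where "1 \<le> i" "i < j" "j < k" "k \<le> n" "f = YB n i j k"
      unfolding arnold_relations_def by blast
    then have "relabel \<pi> f \<in> arnold_ideal n"
    proof cases
      case 1
      then show ?thesis
        using relabel_component[OF \<pi> 1(1)] arnold_relations_ideal[of n]
        unfolding 1(2) relabel_mult arnold_relations_def by blast
    next
      case 2
      have X: "\<pi> i \<in> {1..n}" "\<pi> j \<in> {1..n}" "\<pi> k \<in> {1..n}"
        using 2 permutes_in_image[OF \<pi>] by auto
      have ne: "\<pi> i \<noteq> \<pi> j" "\<pi> i \<noteq> \<pi> k" "\<pi> j \<noteq> \<pi> k"
        using 2 permutes_inj[OF \<pi>] by (auto simp: inj_eq)
      \<comment> \<open>The images of \<open>i, j, k\<close> need not be increasing, so the
        relabeled \<open>YB\<close> is expressed through \<open>cyc\<close>, which makes sense in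
        every order.\<close>
      have "(\<lambda>u. cyc (\<pi> i) (\<pi> j) (\<pi> k) u
          - (word {\<pi> i, \<pi> j} {\<pi> j, \<pi> k} u + word {\<pi> j, \<pi> k} {\<pi> i, \<pi> j} u)) \<in> arnold_ideal n"
        by (intro lin_diff[OF lin_arnold_ideal] cyc_in_arnold_ideal anticommute generators_doubleton X ne)
      moreover have "(\<lambda>u. cyc (\<pi> i) (\<pi> j) (\<pi> k) u
          - (word {\<pi> i, \<pi> j} {\<pi> j, \<pi> k} u + word {\<pi> j, \<pi> k} {\<pi> i, \<pi> j} u)) = relabel \<pi> f"
        by (simp add: 2(5) YB_words[OF 2(1-4)] relabel_linear relabel_word[OF \<pi>] cyc_def fun_eq_iff insert_commute)
      ultimately show ?thesis by simp
    qed
    then show "f \<in> ?H" using car by blast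
  qed
  ultimately have "arnold_ideal n \<subseteq> ?H"
    unfolding arnold_ideal_def[of n] by (rule ring.genideal_minimal[OF ring_tensor_algebra])
  then show ?thesis using assms(2) by blast
qed

section \<open>Cosets of the ideal and their module operations\<close>

definition coset :: "nat \<Rightarrow> (nat set list \<Rightarrow> rat) \<Rightarrow> (nat set list \<Rightarrow> rat) set" where
  "coset n f = arnold_ideal n +>\<^bsub>tensor_algebra n\<^esub> f"

lemma coset_iff: "g \<in> coset n f \<longleftrightarrow> (\<lambda>u. g u - f u) \<in> arnold_ideal n"
proof
  assume "g \<in> coset n f"
  then obtain h where "h \<in> arnold_ideal n" "g = (\<lambda>u. h u + f u)"
    by (auto simp: coset_def a_r_coset_def' tensor_algebra_simps(2))
  then show "(\<lambda>u. g u - f u) \<in> arnold_ideal n" by simp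
next
  assume "(\<lambda>u. g u - f u) \<in> arnold_ideal n"
  moreover have "g = (\<lambda>u. (g u - f u) + f u)" by simp
  ultimately show "g \<in> coset n f"
    unfolding coset_def a_r_coset_def' tensor_algebra_simps(2) by blast
qed

lemma coset_eq_iff: "coset n f = coset n g \<longleftrightarrow> (\<lambda>u. f u - g u) \<in> arnold_ideal n"
proof
  assume "coset n f = coset n g"
  moreover have "f \<in> coset n f" using lin_zero[OF lin_arnold_ideal] by (simp add: coset_iff)
  ultimately show "(\<lambda>u. f u - g u) \<in> arnold_ideal n" by (simp add: coset_iff)
next
  assume fg: "(\<lambda>u. f u - g u) \<in> arnold_ideal n"
  show "coset n f = coset n g"
  proof (intro equalityI subsetI)
    fix h assume "h \<in> coset n f"
    then show "h \<in> coset n g"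
      using lin_add[OF lin_arnold_ideal _ fg, of "\<lambda>u. h u - f u"] by (simp add: coset_iff)
  next
    fix h assume "h \<in> coset n g"
    then show "h \<in> coset n f"
      using lin_diff[OF lin_arnold_ideal _ fg, of "\<lambda>u. h u - g u"] by (simp add: coset_iff)
  qed
qed

lemma arnold_component_simps:
  "carrier (arnold_component d n) = coset n ` tensor_component d n"
  "C \<oplus>\<^bsub>arnold_component d n\<^esub> D = C <+>\<^bsub>tensor_algebra n\<^esub> D"
  "a \<odot>\<^bsub>arnold_component d n\<^esub> C = (\<Union>x\<in>C. coset n (\<lambda>u. a * x u))"
  "act (arnold_component d n) \<pi> C = relabel \<pi> ` C"
  by (simp_all add: arnold_component_def arnold_algebra_def Let_def FactRing_def coset_def
    tensor_algebra_simps(6) tensor_algebra_simps(7)[abs_def] relabel_def[abs_def])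

lemma coset_add:
  assumes "f \<in> carrier (tensor_algebra n)" "g \<in> carrier (tensor_algebra n)"
  shows "coset n f \<oplus>\<^bsub>arnold_component d n\<^esub> coset n g = coset n (\<lambda>u. f u + g u)"
proof -
  interpret ideal "arnold_ideal n" "tensor_algebra n" by (rule arnold_ideal_ideal)
  show ?thesis
    unfolding arnold_component_simps(2) coset_def a_rcos_sum[OF assms] tensor_algebra_simps(2) ..
qed

lemma coset_smult: "a \<odot>\<^bsub>arnold_component d n\<^esub> coset n f = coset n (\<lambda>u. a * f u)"
proof -
  have "coset n (\<lambda>u. a * x u) = coset n (\<lambda>u. a * f u)" if "x \<in> coset n f" for x
    using lin_scale[OF lin_arnold_ideal, of "\<lambda>u. x u - f u" n a] that
    by (simp add: coset_eq_iff coset_iff right_diff_distrib)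
  moreover have "f \<in> coset n f" using lin_zero[OF lin_arnold_ideal] by (simp add: coset_iff)
  ultimately show ?thesis unfolding arnold_component_simps(3) by blast
qed

text \<open>The action maps a coset elementwise. That the image is a whole coset follows from
  stability of the ideal under the inverse permutation.\<close>

lemma coset_act:
  assumes \<pi>: "\<pi> permutes {1..n}"
  shows "act (arnold_component d n) \<pi> (coset n f) = coset n (relabel \<pi> f)"
  unfolding arnold_component_simps(4)
proof (intro equalityI subsetI)
  fix g assume "g \<in> relabel \<pi> ` coset n f"
  then show "g \<in> coset n (relabel \<pi> f)"
    using relabel_arnold_ideal[OF \<pi>] by (auto simp: coset_iff relabel_linear(2)[symmetric])
next
  fix g assume g: "g \<in> coset n (relabel \<pi> f)"
  let ?\<rho> = "Hilbert_Choice.inv \<pi>"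
  have inverse: "relabel \<pi> (relabel ?\<rho> h) = h" "relabel ?\<rho> (relabel \<pi> h) = h" for h
    using permutes_inv_o[OF \<pi>] permutes_inv_inv[OF \<pi>]
    by (simp_all add: relabel_def image_comp o_def[of "image _"] fun_eq_iff map_idI)
  have "relabel ?\<rho> (\<lambda>u. g u - relabel \<pi> f u) \<in> arnold_ideal n"
    using relabel_arnold_ideal[OF permutes_inv[OF \<pi>]] g by (simp add: coset_iff)
  then have "relabel ?\<rho> g \<in> coset n f" by (simp add: coset_iff relabel_linear inverse)
  then show "g \<in> relabel \<pi> ` coset n f" using inverse(1)[of g] by (metis imageI)
qed

text \<open>A linear section \<open>S\<close> of the projection onto the quotient, defined on a model \<open>N\<close> of the
  degree \<open>d\<close> component, identifies that component with \<open>N\<close>.\<close>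

lemma arnold_component_iso:
  assumes ps: "\<And>p. p \<in> set ps \<Longrightarrow> p \<noteq> [] \<and> antitone p \<and> sum_list p = n"
    and N: "lin N"
    and S: "\<And>F. F \<in> N \<Longrightarrow> S F \<in> tensor_component d n"
    and S_add: "\<And>F G. S (\<lambda>c. F c + G c) = (\<lambda>u. S F u + S G u)"
    and S_scale: "\<And>a F. S (\<lambda>c. a * F c) = (\<lambda>u. a * S F u)"
    and S_perm: "\<And>\<pi> F. \<pi> permutes {1..n} \<Longrightarrow> S (\<lambda>c. F (c \<circ> \<pi>)) = relabel \<pi> (S F)"
    and inj: "\<And>F. F \<in> N \<Longrightarrow> S F \<in> arnold_ideal n \<Longrightarrow> F = (\<lambda>c. 0)"
    and surj: "\<And>f. f \<in> tensor_component d n \<Longrightarrow> \<exists>F\<in>N. (\<lambda>u. f u - S F u) \<in> arnold_ideal n"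
    and \<Theta>: "bij_betw \<Theta> (listset (map (kern n) ps)) N"
    and \<Theta>_add: "\<And>fs gs. fs \<in> listset (map (kern n) ps) \<Longrightarrow> gs \<in> listset (map (kern n) ps) \<Longrightarrow>
      \<Theta> (map2 (\<lambda>f g c. f c + g c) fs gs) = (\<lambda>c. \<Theta> fs c + \<Theta> gs c)"
    and \<Theta>_scale: "\<And>a fs. fs \<in> listset (map (kern n) ps) \<Longrightarrow>
      \<Theta> (map (\<lambda>f c. a * f c) fs) = (\<lambda>c. a * \<Theta> fs c)"
    and \<Theta>_perm: "\<And>\<pi> fs. \<pi> permutes {1..n} \<Longrightarrow> fs \<in> listset (map (kern n) ps) \<Longrightarrow>
      \<Theta> (map (\<lambda>f c. f (c \<circ> \<pi>)) fs) = (\<lambda>c. \<Theta> fs (c \<circ> \<pi>))"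
  shows "sn_iso n (arnold_component d n) (direct_sum (map specht ps))"
proof -
  let ?A = "arnold_component d n"
  have \<Theta>N: "\<Theta> fs \<in> N" if "fs \<in> listset (map (kern n) ps)" for fs
    using bij_betwE[OF \<Theta>] that by blast
  have S_car: "S F \<in> carrier (tensor_algebra n)" if "F \<in> N" for F
    using S[OF that] by (simp add: tensor_component_def)
  have S_diff: "S (\<lambda>c. F c - G c) = (\<lambda>u. S F u - S G u)" for F G
    using S_add[of F "\<lambda>c. -1 * G c"] S_scale[of "-1" G] by simp
  have "bij_betw (\<lambda>F. coset n (S F)) N (carrier ?A)"
    unfolding bij_betw_def arnold_component_simps(1)
  proof
    show "inj_on (\<lambda>F. coset n (S F)) N"
    proof (rule inj_onI)
      fix F G assume "F \<in> N" "G \<in> N" "coset n (S F) = coset n (S G)"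
      then have "(\<lambda>c. F c - G c) = (\<lambda>c. 0)"
        by (intro inj lin_diff[OF N]) (simp_all add: coset_eq_iff S_diff)
      then show "F = G" by (simp add: fun_eq_iff)
    qed
    show "(\<lambda>F. coset n (S F)) ` N = coset n ` tensor_component d n"
    proof (intro equalityI subsetI)
      fix C assume "C \<in> coset n ` tensor_component d n"
      then obtain f where "f \<in> tensor_component d n" "C = coset n f" by blast
      then show "C \<in> (\<lambda>F. coset n (S F)) ` N" using surj[of f] coset_eq_iff by blast
    qed (use S in blast)
  qed
  with \<Theta> have bij: "bij_betw ((\<lambda>F. coset n (S F)) \<circ> \<Theta>) (listset (map (kern n) ps)) (carrier ?A)"
    by (rule bij_betw_trans)
  show ?thesis
    by (rule specht_sum_iso[OF ps bij])
      (simp_all add: \<Theta>_add \<Theta>_scale \<Theta>_perm S_add S_scale S_perm coset_add coset_smult coset_act S_car \<Theta>N)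
qed

section \<open>A model of the degree two component\<close>

text \<open>The coloring of the pointed set \<open>(x, K)\<close>.\<close>

definition col :: "nat \<Rightarrow> nat set \<Rightarrow> nat \<Rightarrow> nat" where
  "col x K = (\<lambda>y. if y = x then 2 else if y \<in> K then 1 else 0)"

lemma col_wt:
  assumes "K \<subseteq> {1..n}" "x \<in> K" "card K = Suc k"
  shows "col x K \<in> wt n [n - Suc k, k, 1]"
proof -
  have fin: "finite K" using assms(1) by (rule finite_subset) simp
  have 0: "{y \<in> {1..n}. col x K y = 0} = {1..n} - K" using assms(2) by (auto simp: col_def)
  have 1: "{y \<in> {1..n}. col x K y = 1} = K - {x}" using assms(1) by (auto simp: col_def)
  have 2: "{y \<in> {1..n}. col x K y = 2} = {x}" using assms(1,2) by (auto simp: col_def)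
  have c0: "card {y \<in> {1..n}. col x K y = 0} = n - Suc k"
    unfolding 0 using card_Diff_subset[OF fin assms(1)] assms(3) by simp
  have c1: "card {y \<in> {1..n}. col x K y = 1} = k"
    unfolding 1 using assms(2,3) fin by simp
  have c2: "card {y \<in> {1..n}. col x K y = 2} = 1" unfolding 2 by simp
  have "card {y \<in> {1..n}. col x K y = r} = [n - Suc k, k, 1] ! r" if "r < 3" for r
  proof -
    have "r = 0 \<or> r = 1 \<or> r = 2" using that by arith
    then show ?thesis
    proof (elim disjE)
      assume "r = 0" then show ?thesis using c0 by simp
    next
      assume "r = 1" then show ?thesis using c1 by simp
    next
      assume "r = 2" then show ?thesis using c2 by simp
    qed
  qed
  moreover have "col x K y = 0" if "y \<notin> {1..n}" for y using that assms(1,2) by (auto simp: col_def)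
  moreover have "col x K y < 3" for y by (simp add: col_def)
  moreover have len: "length [n - Suc k, k, 1] = 3" by simp
  ultimately show ?thesis unfolding wt_def colorings_def len by blast
qed

lemma wt_col:
  assumes "c \<in> wt n [a, k, 1]"
  obtains x K where "K \<subseteq> {1..n}" "x \<in> K" "card K = Suc k" "c = col x K"
proof -
  have out: "c y = 0" if "y \<notin> {1..n}" for y using assms that unfolding wt_def colorings_def by blast
  have lt: "c y < 3" for y using assms by (simp add: wt_def colorings_def numeral_3_eq_3)
  have cards: "card {y \<in> {1..n}. c y = r} = [a, k, 1] ! r" if "r < 3" for r
    using assms that by (simp add: wt_def)
  have "card {y \<in> {1..n}. c y = 2} = 1" using cards[of 2] by simp
  then obtain x where x: "{y \<in> {1..n}. c y = 2} = {x}" by (rule card_1_singletonE)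
  have c1: "card {y \<in> {1..n}. c y = 1} = k" using cards[of 1] by simp
  define K where "K = insert x {y \<in> {1..n}. c y = 1}"
  have "x \<in> {y \<in> {1..n}. c y = 2}" unfolding x by simp
  then have x': "x \<in> {1..n}" "c x = 2" by simp_all
  have "card K = Suc k"
    unfolding K_def using c1 x'(2) card_insert_disjoint[of "{y \<in> {1..n}. c y = 1}" x] by simp
  moreover have "c = col x K"
  proof
    fix y
    show "c y = col x K y"
    proof (cases "y \<in> {1..n}")
      case True
      have "c y = 2 \<longleftrightarrow> y = x" using x True by auto
      moreover have "c y = 0 \<or> c y = 1 \<or> c y = 2" using lt[of y] by linarith
      ultimately show ?thesis using True by (auto simp: col_def K_def)
    next
      case False
      then have "y \<noteq> x" "y \<notin> K" using x'(1) by (auto simp: K_def)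
      then show ?thesis using out[OF False] by (simp add: col_def)
    qed
  qed
  moreover have "K \<subseteq> {1..n}" "x \<in> K" using x'(1) by (auto simp: K_def)
  ultimately show ?thesis using that by blast
qed

text \<open>Evaluate e_12 at the coloring with color 1 on \<open>K\<close> and 0 elsewhere:
  recoloring \<open>x\<close> in \<open>K\<close> by 2 gives \<open>col x K\<close>.\<close>

lemma hspace_sum:
  assumes "F \<in> hspace n a k" "K \<subseteq> {1..n}"
  shows "(\<Sum>x\<in>K. F (col x K)) = 0"
proof -
  let ?c = "\<lambda>y. of_bool (y \<in> K) :: nat"
  have "{y. y \<in> {1..n} \<and> ?c y = 1} = K" using assms(2) by auto
  moreover have "?c(x := 2) = col x K" for x by (auto simp: col_def)
  ultimately have "move n 1 2 F ?c = (\<Sum>x\<in>K. F (col x K))" unfolding move_def by simp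
  then show ?thesis using assms(1) by (simp add: hspace_def)
qed

text \<open>Colorings that are not indicators of a set of size \<open>Suc k\<close> have no
  recoloring of weight \<open>[a, k, 1]\<close>, so e_12 of \<open>F\<close> vanishes there
  anyway.\<close>

lemma hspaceI:
  assumes F: "F \<in> wspace n [a, k, 1]"
    and sum: "\<And>K. K \<subseteq> {1..n} \<Longrightarrow> card K = Suc k \<Longrightarrow> (\<Sum>x\<in>K. F (col x K)) = 0"
  shows "F \<in> hspace n a k"
proof -
  have "move n 1 2 F c = 0" for c
  proof (cases "\<exists>K. K \<subseteq> {1..n} \<and> card K = Suc k \<and> c = (\<lambda>y. of_bool (y \<in> K))")
    case True
    then obtain K where K: "K \<subseteq> {1..n}" "card K = Suc k" "c = (\<lambda>y. of_bool (y \<in> K))" by blast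
    have "{y. y \<in> {1..n} \<and> c y = 1} = K" using K(1) by (auto simp: K(3))
    moreover have "c(x := 2) = col x K" for x by (auto simp: col_def K(3))
    ultimately show ?thesis unfolding move_def using sum[OF K(1,2)] by simp
  next
    case False
    have "F (c(y := 2)) = 0" if y: "y \<in> {1..n}" "c y = 1" for y
    proof (rule ccontr)
      assume "F (c(y := 2)) \<noteq> 0"
      then have "c(y := 2) \<in> wt n [a, k, 1]" using wspace_outside[OF F] by blast
      then obtain x K where K: "K \<subseteq> {1..n}" "x \<in> K" "card K = Suc k" "c(y := 2) = col x K"
        by (rule wt_col)
      have "(c(y := 2)) y = col x K y" using K(4) by simp
      then have "y = x" by (simp add: col_def split: if_splits)
      have "c z = of_bool (z \<in> K)" for z
        using fun_cong[OF K(4), of z] y(2) K(2) \<open>y = x\<close> by (cases "z = x") (auto simp: col_def)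
      then show False using False K(1,3) by blast
    qed
    then show ?thesis by (simp add: move_def)
  qed
  then show ?thesis using F by (auto simp: hspace_def)
qed

text \<open>A section of \<open>theta\<close> on functions with vanishing sums over \<open>K\<close>, see \<open>theta_sec\<close>; the
  denominator \<open>2 * card K\<close> is right both for the six words with \<open>card K = 3\<close> and for the six words
  with \<open>card K = 4\<close>.\<close>

definition sec :: "nat \<Rightarrow> (nat \<Rightarrow> nat set \<Rightarrow> rat) \<Rightarrow> nat set list \<Rightarrow> rat" where
  "sec n g u = (case u of [A, B] \<Rightarrow>
     if A \<in> generators n \<and> B \<in> generators n
     then ((\<Sum>a\<in>A. g a (A \<union> B)) - (\<Sum>b\<in>B. g b (A \<union> B))) / (2 * of_nat (card (A \<union> B))) else 0
   | _ \<Rightarrow> 0)"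

lemma sec_eq: "sec n g u = (if \<exists>A\<in>generators n. \<exists>B\<in>generators n. u = [A, B] then
    ((\<Sum>a\<in>u ! 0. g a (u ! 0 \<union> u ! 1)) - (\<Sum>b\<in>u ! 1. g b (u ! 0 \<union> u ! 1))) / (2 * of_nat (card (u ! 0 \<union> u ! 1))) else 0)"
  by (auto simp: sec_def split: list.splits)

lemma sec_linear:
  "sec n (\<lambda>x K. f x K + g x K) = (\<lambda>u. sec n f u + sec n g u)"
  "sec n (\<lambda>x K. a * f x K) = (\<lambda>u. a * sec n f u)"
  by (rule ext, simp add: sec_eq sum.distrib add_divide_distrib diff_divide_distrib)
    (rule ext, simp add: sec_eq sum_distrib_left[symmetric] right_diff_distrib[symmetric])

lemma sec_component: "sec n g \<in> tensor_component 2 n"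
proof -
  have ex: "\<exists>A\<in>generators n. \<exists>B\<in>generators n. u = [A, B]" if "sec n g u \<noteq> 0" for u
  proof (rule ccontr)
    assume "\<not> ?thesis"
    then have "sec n g u = 0" by (subst sec_eq) (rule if_not_P)
    then show False using that by simp
  qed
  then have sub: "{u. sec n g u \<noteq> 0} \<subseteq> (\<lambda>(A, B). [A, B]) ` (generators n \<times> generators n)"
    by force
  then have "finite {u. sec n g u \<noteq> 0}"
    by (rule finite_subset) (simp add: finite_generators)
  moreover have "{u. sec n g u \<noteq> 0} \<subseteq> lists (generators n)" using sub by auto
  moreover have "\<forall>u. sec n g u \<noteq> 0 \<longrightarrow> length u = 2" using ex by force
  ultimately show ?thesis by (simp add: tensor_component_def tensor_algebra_simps(1))
qed

lemma two_subset_3: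
  assumes "A \<subseteq> {x, y, z}" "card A = 2"
  shows "A = {x, y} \<or> A = {x, z} \<or> A = {y, z}"
proof -
  obtain u v where A: "A = {u, v}" "u \<noteq> v" using assms(2) by (auto simp: card_2_iff)
  then have "u \<in> {x, y, z}" "v \<in> {x, y, z}" using assms(1) by blast+
  then show ?thesis using A(2) unfolding A(1)
    by (elim insertE emptyE) (simp_all add: doubleton_eq_iff)
qed

lemma two_subset_4:
  assumes "A \<subseteq> {x, y, z, w}" "card A = 2"
  shows "A = {x, y} \<or> A = {x, z} \<or> A = {x, w} \<or> A = {y, z} \<or> A = {y, w} \<or> A = {z, w}"
proof -
  obtain u v where A: "A = {u, v}" "u \<noteq> v" using assms(2) by (auto simp: card_2_iff)
  then have "u \<in> {x, y, z, w}" "v \<in> {x, y, z, w}" using assms(1) by blast+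
  then show ?thesis using A(2) unfolding A(1)
    by (elim insertE emptyE) (simp_all add: doubleton_eq_iff)
qed

lemma pairs_3:
  assumes "x \<in> {1..n}" "y \<in> {1..n}" "z \<in> {1..n}" "x \<noteq> y" "x \<noteq> z" "y \<noteq> z"
  shows "{(A, B) \<in> generators n \<times> generators n. A \<union> B = {x, y, z}} =
    {({x, y}, {x, z}), ({x, z}, {x, y}), ({x, y}, {y, z}), ({y, z}, {x, y}), ({x, z}, {y, z}), ({y, z}, {x, z})}"
    (is "?P = ?Q")
proof
  show "?Q \<subseteq> ?P" using assms by (auto intro!: generators_doubleton)
  show "?P \<subseteq> ?Q"
  proof (rule subrelI)
    fix A B assume "(A, B) \<in> ?P"
    then have *: "A \<in> generators n" "B \<in> generators n" "A \<union> B = {x, y, z}" by simp_all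
    have card: "card A = 2" "card B = 2" using * by (simp_all add: generators_iff)
    have "A \<subseteq> {x, y, z}" "B \<subseteq> {x, y, z}" using *(3) by blast+
    then have A: "A = {x, y} \<or> A = {x, z} \<or> A = {y, z}" and B: "B = {x, y} \<or> B = {x, z} \<or> B = {y, z}"
      using two_subset_3[of A x y z] two_subset_3[of B x y z] card by blast+
    have "card (A \<union> B) = 3" using *(3) assms by simp
    then have "A \<noteq> B" using card(1) by auto
    then show "(A, B) \<in> ?Q" using A B by (elim disjE) simp_all
  qed
qed

lemma pairs_4:
  assumes "x \<in> {1..n}" "y \<in> {1..n}" "z \<in> {1..n}" "w \<in> {1..n}" "distinct [x, y, z, w]"
  shows "{(A, B) \<in> generators n \<times> generators n. A \<union> B = {x, y, z, w}} =
    {({x, y}, {z, w}), ({z, w}, {x, y}), ({x, z}, {y, w}), ({y, w}, {x, z}), ({x, w}, {y, z}), ({y, z}, {x, w})}"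
    (is "?P = ?Q")
proof
  show "?Q \<subseteq> ?P" using assms by (auto intro!: generators_doubleton)
  show "?P \<subseteq> ?Q"
  proof (rule subrelI)
    fix A B assume "(A, B) \<in> ?P"
    then have *: "A \<in> generators n" "B \<in> generators n" "A \<union> B = {x, y, z, w}" by simp_all
    have fin: "finite A" "finite B" using * by (auto simp: generators_iff intro: card_ge_0_finite)
    have "card (A \<union> B) = 4" using *(3) assms(5) by simp
    then have "card (A \<inter> B) = 0"
      using card_Un_Int[OF fin] * by (simp add: generators_iff)
    then have "A \<inter> B = {}" using fin by simp
    then have B: "B = {x, y, z, w} - A" using *(3) by blast
    have "A \<subseteq> {x, y, z, w}" "card A = 2" using * by (auto simp: generators_iff)
    then have "A = {x, y} \<or> A = {x, z} \<or> A = {x, w} \<or> A = {y, z} \<or> A = {y, w} \<or> A = {z, w}"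
      by (rule two_subset_4)
    then show "(A, B) \<in> ?Q"
      using assms(5) unfolding B by (elim disjE) (simp_all add: insert_Diff_if)
  qed
qed

lemma sum_pairs_3:
  assumes "x \<noteq> y" "x \<noteq> z" "y \<noteq> z"
  shows "(\<Sum>p\<in>{({x, y}, {x, z}), ({x, z}, {x, y}), ({x, y}, {y, z}), ({y, z}, {x, y}), ({x, z}, {y, z}), ({y, z}, {x, z})}. F p)
    = F ({x, y}, {x, z}) + (F ({x, z}, {x, y}) + (F ({x, y}, {y, z}) + (F ({y, z}, {x, y})
      + (F ({x, z}, {y, z}) + F ({y, z}, {x, z})))))"
  using assms by (simp add: doubleton_eq_iff)

lemma sum_pairs_4:
  assumes "distinct [x, y, z, w]"
  shows "(\<Sum>p\<in>{({x, y}, {z, w}), ({z, w}, {x, y}), ({x, z}, {y, w}), ({y, w}, {x, z}), ({x, w}, {y, z}), ({y, z}, {x, w})}. F p)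
    = F ({x, y}, {z, w}) + (F ({z, w}, {x, y}) + (F ({x, z}, {y, w}) + (F ({y, w}, {x, z})
      + (F ({x, w}, {y, z}) + F ({y, z}, {x, w})))))"
  using assms by (simp add: doubleton_eq_iff)

lemma sec_pair:
  assumes "A \<in> generators n" "B \<in> generators n" "A \<union> B = K"
  shows "sec n g [A, B] = ((\<Sum>a\<in>A. g a K) - (\<Sum>b\<in>B. g b K)) / (2 * of_nat (card K))"
  using assms by (simp add: sec_def)

text \<open>On three points, the pairs with \<open>x\<close> in both sets drop out and the rest give
  4 times the value at \<open>x\<close> minus 2 times the sum of the others, over 6. On four points
  the six pairs give 6 times that value minus 2 times the sum of the others, over 8. Since the total
  is zero, the others sum to minus the value at \<open>x\<close>, and both quotients equal
  it.\<close>

lemma theta_sec: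
  assumes "K \<subseteq> {1..n}" "x \<in> K" "card K = 3 \<or> card K = 4" "(\<Sum>x\<in>K. g x K) = 0"
  shows "theta n (sec n g) x K = g x K"
  using assms(3)
proof
  assume card: "card K = 3"
  then have "card (K - {x}) = 2" using assms(2) by simp
  then obtain y z where yz: "K - {x} = {y, z}" "y \<noteq> z" by (auto simp: card_2_iff)
  then have K: "K = {x, y, z}" and ne: "x \<noteq> y" "x \<noteq> z" "y \<noteq> z" using assms(2) by auto
  have X: "x \<in> {1..n}" "y \<in> {1..n}" "z \<in> {1..n}" using assms(1) K by auto
  have g: "g x K + (g y K + g z K) = 0" using assms(4) ne by (simp add: K)
  have G: "{x, y} \<in> generators n" "{x, z} \<in> generators n" "{y, z} \<in> generators n"
    using X ne by (auto intro!: generators_doubleton)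
  have U: "{x, y} \<union> {y, z} = K" "{y, z} \<union> {x, y} = K" "{x, z} \<union> {y, z} = K" "{y, z} \<union> {x, z} = K"
    by (auto simp: K)
  note sp = sec_pair[of _ n _ _ g, OF G(1,3) U(1)] sec_pair[of _ n _ _ g, OF G(3,1) U(2)]
    sec_pair[of _ n _ _ g, OF G(2,3) U(3)] sec_pair[of _ n _ _ g, OF G(3,2) U(4)]
  have "sec n g [{x, y}, {y, z}] = (g x K - g z K) / 6" "sec n g [{y, z}, {x, y}] = (g z K - g x K) / 6"
    "sec n g [{x, z}, {y, z}] = (g x K - g y K) / 6" "sec n g [{y, z}, {x, z}] = (g y K - g x K) / 6"
    using ne unfolding sp card by simp_all
  then have "theta n (sec n g) x K = (4 * g x K - 2 * (g y K + g z K)) / 6"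
    unfolding theta_def pairs_3[OF X ne, folded K] sum_pairs_3[OF ne]
    using ne by (simp add: field_simps)
  then show ?thesis using g by (simp add: field_simps)
next
  assume card: "card K = 4"
  then have "card (K - {x}) = 3" using assms(2) by simp
  then obtain y z w where yz: "K - {x} = {y, z, w}" "y \<noteq> z" "y \<noteq> w" "z \<noteq> w" by (auto simp: card_3_iff)
  then have K: "K = {x, y, z, w}" and ne: "distinct [x, y, z, w]" using assms(2) by auto
  have X: "x \<in> {1..n}" "y \<in> {1..n}" "z \<in> {1..n}" "w \<in> {1..n}" using assms(1) K by auto
  have g: "g x K + (g y K + (g z K + g w K)) = 0" using assms(4) ne by (simp add: K)
  have G: "{x, y} \<in> generators n" "{x, z} \<in> generators n" "{x, w} \<in> generators n"
    "{y, z} \<in> generators n" "{y, w} \<in> generators n" "{z, w} \<in> generators n"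
    using X ne by (auto intro!: generators_doubleton)
  have U: "{x, y} \<union> {z, w} = K" "{z, w} \<union> {x, y} = K" "{x, z} \<union> {y, w} = K" "{y, w} \<union> {x, z} = K"
    "{x, w} \<union> {y, z} = K" "{y, z} \<union> {x, w} = K" by (auto simp: K)
  note sp = sec_pair[of _ n _ _ g, OF G(1,6) U(1)] sec_pair[of _ n _ _ g, OF G(6,1) U(2)]
    sec_pair[of _ n _ _ g, OF G(2,5) U(3)] sec_pair[of _ n _ _ g, OF G(5,2) U(4)]
    sec_pair[of _ n _ _ g, OF G(3,4) U(5)] sec_pair[of _ n _ _ g, OF G(4,3) U(6)]
  have "sec n g [{x, y}, {z, w}] = ((g x K + g y K) - (g z K + g w K)) / 8"
    "sec n g [{z, w}, {x, y}] = ((g z K + g w K) - (g x K + g y K)) / 8"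
    "sec n g [{x, z}, {y, w}] = ((g x K + g z K) - (g y K + g w K)) / 8"
    "sec n g [{y, w}, {x, z}] = ((g y K + g w K) - (g x K + g z K)) / 8"
    "sec n g [{x, w}, {y, z}] = ((g x K + g w K) - (g y K + g z K)) / 8"
    "sec n g [{y, z}, {x, w}] = ((g y K + g z K) - (g x K + g w K)) / 8"
    using ne unfolding sp card by simp_all
  then have "theta n (sec n g) x K = (6 * g x K - 2 * (g y K + (g z K + g w K))) / 8"
    unfolding theta_def pairs_4[OF X ne, folded K] sum_pairs_4[OF ne] prod.case
    using ne by (simp add: add_divide_distrib diff_divide_distrib)
  then show ?thesis using g by (simp add: field_simps)
qed

text \<open>\<open>A\<close> and \<open>B\<close> have the same size, so the difference of their
  indicators sums to zero.\<close>

lemma theta_sum: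
  assumes "finite K"
  shows "(\<Sum>x\<in>K. theta n f x K) = 0"
proof -
  have count: "(\<Sum>x\<in>A \<union> B. of_bool (x \<in> A) - of_bool (x \<in> B)) = (0 :: rat)"
    if "A \<in> generators n" "B \<in> generators n" for A B
  proof -
    have fin: "finite A" "finite B" "card A = 2" "card B = 2"
      using that by (auto simp: generators_iff intro: card_ge_0_finite)
    have "(\<Sum>x\<in>A \<union> B. of_bool (x \<in> A)) = (of_nat (card A) :: rat)"
      "(\<Sum>x\<in>A \<union> B. of_bool (x \<in> B)) = (of_nat (card B) :: rat)"
      using fin by (simp_all add: Int_absorb1 Int_absorb2 Un_Int_eq)
    then show ?thesis using fin by (simp add: sum_subtractf)
  qed
  have "(\<Sum>x\<in>K. theta n f x K) = (\<Sum>(A, B) \<in> {(A, B) \<in> generators n \<times> generators n. A \<union> B = K}.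
     f [A, B] * (\<Sum>x\<in>K. of_bool (x \<in> A) - of_bool (x \<in> B)))"
    unfolding theta_def case_prod_unfold sum_distrib_left by (rule sum.swap)
  also have "\<dots> = 0"
    using count by (intro sum.neutral) auto
  finally show ?thesis .
qed

lemma sec_theta_word:
  assumes "A \<in> generators n" "B \<in> generators n" "(A', B') \<in> {(A', B') \<in> generators n \<times> generators n. A' \<union> B' = K}"
    and "A \<union> B = K"
  shows "sec n (theta n (word A B)) [A', B']
    = ((\<Sum>a\<in>A'. of_bool (a \<in> A) - of_bool (a \<in> B)) - (\<Sum>a\<in>B'. of_bool (a \<in> A) - of_bool (a \<in> B)))
      / (2 * of_nat (card K))"
  using assms(3,4) sec_pair[of A' n B' K "theta n (word A B)"] by (simp add: theta_word[OF assms(1,2)])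

lemma sec_theta_word_outside:
  assumes "A \<in> generators n" "B \<in> generators n" "A \<union> B = K"
    and u: "u \<notin> (\<lambda>(A', B'). [A', B']) ` {(A', B') \<in> generators n \<times> generators n. A' \<union> B' = K}"
  shows "sec n (theta n (word A B)) u = 0"
proof (cases "\<exists>A'\<in>generators n. \<exists>B'\<in>generators n. u = [A', B']")
  case True
  then obtain A' B' where *: "A' \<in> generators n" "B' \<in> generators n" "u = [A', B']" by blast
  have "A' \<union> B' \<noteq> A \<union> B"
  proof
    assume "A' \<union> B' = A \<union> B"
    then have "(A', B') \<in> {(A', B') \<in> generators n \<times> generators n. A' \<union> B' = K}"
      using *(1,2) assms(3) by simp
    then have "u \<in> (\<lambda>(A', B'). [A', B']) ` {(A', B') \<in> generators n \<times> generators n. A' \<union> B' = K}"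
      by (rule rev_image_eqI) (simp add: *(3))
    then show False using u by blast
  qed
  then have "theta n (word A B) x (A' \<union> B') = 0" for x
    using theta_word[OF assms(1,2)] by simp
  then show ?thesis using sec_pair[OF *(1,2) refl, of "theta n (word A B)"] *(3) by simp
next
  case False
  then show ?thesis by (subst sec_eq) (rule if_not_P)
qed

lemma word_apply: "word A B [A', B'] = of_bool (A' = A \<and> B' = B)"
  by (simp add: word_def basis_vector_def)

text \<open>Any other splitting of the four points into pairs puts one point of
  \<open>{a, c}\<close> and one of \<open>{b, d}\<close> into each pair, and \<open>sec\<close>
  vanishes on it. On the word and its reverse \<open>sec\<close> is 4/8 and -4/8.\<close>

lemma word_minus_sec_disjoint:
  assumes X: "a \<in> {1..n}" "c \<in> {1..n}" "b \<in> {1..n}" "d \<in> {1..n}" and ne: "distinct [a, c, b, d]"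
  shows "word {a, c} {b, d} u - sec n (theta n (word {a, c} {b, d})) u
    = 1 / 2 * (word {a, c} {b, d} u + word {b, d} {a, c} u)"
proof -
  let ?K = "{a, c, b, d}"
  let ?P = "{(A', B') \<in> generators n \<times> generators n. A' \<union> B' = ?K}"
  have G: "{a, c} \<in> generators n" "{b, d} \<in> generators n"
    using X ne by (auto intro!: generators_doubleton)
  have U: "{a, c} \<union> {b, d} = ?K" by auto
  have card: "card ?K = 4" using ne by simp
  note P = pairs_4[OF X ne]
  note val = sec_theta_word[OF G _ U, unfolded P card]
  show ?thesis
  proof (cases "u \<in> (\<lambda>(A', B'). [A', B']) ` ?P")
    case True
    then have "u = [{a, c}, {b, d}] \<or> u = [{b, d}, {a, c}] \<or> u = [{a, b}, {c, d}] \<or> u = [{c, d}, {a, b}]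
      \<or> u = [{a, d}, {c, b}] \<or> u = [{c, b}, {a, d}]"
      unfolding P by simp
    moreover have "sec n (theta n (word {a, c} {b, d})) [{a, c}, {b, d}] = 1 / 2"
      "sec n (theta n (word {a, c} {b, d})) [{b, d}, {a, c}] = - 1 / 2"
      "sec n (theta n (word {a, c} {b, d})) [{a, b}, {c, d}] = 0"
      "sec n (theta n (word {a, c} {b, d})) [{c, d}, {a, b}] = 0"
      "sec n (theta n (word {a, c} {b, d})) [{a, d}, {c, b}] = 0"
      "sec n (theta n (word {a, c} {b, d})) [{c, b}, {a, d}] = 0"
      using ne by (simp_all add: val)
    ultimately show ?thesis
      using ne by (elim disjE) (simp_all add: word_apply doubleton_eq_iff)
  next
    case False
    then have "u \<noteq> [{a, c}, {b, d}]" "u \<noteq> [{b, d}, {a, c}]" unfolding P by auto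
    then show ?thesis
      using sec_theta_word_outside[OF G U False] by (simp add: word_def basis_vector_def)
  qed
qed

text \<open>Here \<open>theta\<close> is 1 at \<open>a\<close>, -1 at \<open>b\<close> and 0 at
  \<open>c\<close>, so \<open>sec\<close> takes the values 1/3 and -1/3 on the word and its reverse
  and 1/6 or -1/6 on the other four words. Modulo anticommutators, if X, Y, Z are the three summands
  of \<open>cyc a b c\<close>, then \<open>sec\<close> is (2X - Y - Z)/3 and X minus it is a third
  of \<open>cyc a b c\<close>; the remaining terms account for the anticommutators.\<close>

lemma word_minus_sec_meet:
  assumes X: "a \<in> {1..n}" "b \<in> {1..n}" "c \<in> {1..n}" and ne: "a \<noteq> b" "a \<noteq> c" "b \<noteq> c"
  shows "word {a, c} {b, c} u - sec n (theta n (word {a, c} {b, c})) u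
    = 1 / 3 * cyc a b c u + (1 / 3 * (word {a, c} {b, c} u + word {b, c} {a, c} u)
        + (- 1 / 6 * (word {a, b} {b, c} u + word {b, c} {a, b} u)
          + - 1 / 6 * (word {a, b} {a, c} u + word {a, c} {a, b} u)))"
proof -
  let ?K = "{a, b, c}"
  let ?P = "{(A', B') \<in> generators n \<times> generators n. A' \<union> B' = ?K}"
  have G: "{a, c} \<in> generators n" "{b, c} \<in> generators n"
    using X ne by (auto intro!: generators_doubleton)
  have U: "{a, c} \<union> {b, c} = ?K" by auto
  have card: "card ?K = 3" using ne by simp
  note P = pairs_3[OF X ne]
  note val = sec_theta_word[OF G _ U, unfolded P card]
  have comm: "{b, a} = {a, b}" "{c, a} = {a, c}" "{c, b} = {b, c}" by auto
  show ?thesis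
  proof (cases "u \<in> (\<lambda>(A', B'). [A', B']) ` ?P")
    case True
    then have "u = [{a, b}, {a, c}] \<or> u = [{a, c}, {a, b}] \<or> u = [{a, b}, {b, c}] \<or> u = [{b, c}, {a, b}]
      \<or> u = [{a, c}, {b, c}] \<or> u = [{b, c}, {a, c}]"
      unfolding P by simp
    then show ?thesis
      unfolding cyc_def comm
      using ne by (elim disjE) (simp_all add: val word_apply doubleton_eq_iff)
  next
    case False
    then have "u \<noteq> [{a, b}, {a, c}]" "u \<noteq> [{a, c}, {a, b}]" "u \<noteq> [{a, b}, {b, c}]" "u \<noteq> [{b, c}, {a, b}]"
      "u \<noteq> [{a, c}, {b, c}]" "u \<noteq> [{b, c}, {a, c}]"
      unfolding P by simp_all
    then show ?thesis
      unfolding cyc_def comm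
      using sec_theta_word_outside[OF G U False] by (simp add: word_def basis_vector_def)
  qed
qed

text \<open>The upper bound on words: squares have zero \<open>theta\<close> and lie in the ideal,
  disjoint pairs need only anticommutativity, and meeting pairs need \<open>cyc\<close> as
  well.\<close>

lemma word_minus_sec:
  assumes A: "A \<in> generators n" and B: "B \<in> generators n"
  shows "(\<lambda>u. word A B u - sec n (theta n (word A B)) u) \<in> arnold_ideal n"
proof (cases "A = B")
  case True
  have "theta n (word A B) x K = 0" for x K using theta_word[OF A A, of x K] True by simp
  then have "sec n (theta n (word A B)) u = 0" for u by (subst sec_eq) simp
  then show ?thesis using square_in_arnold_ideal[OF A] True by simp
next
  case False
  obtain a c where ac: "A = {a, c}" "a \<noteq> c" using A by (auto simp: generators_iff card_2_iff)
  obtain b d where bd: "B = {b, d}" "b \<noteq> d" using B by (auto simp: generators_iff card_2_iff)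
  have X: "a \<in> {1..n}" "c \<in> {1..n}" "b \<in> {1..n}" "d \<in> {1..n}"
    using A B ac bd by (auto simp: generators_iff)
  show ?thesis
  proof (cases "A \<inter> B = {}")
    case True
    then have ne: "distinct [a, c, b, d]" using ac bd by auto
    have "(\<lambda>u. 1 / 2 * (word A B u + word B A u)) \<in> arnold_ideal n"
      by (rule lin_scale[OF lin_arnold_ideal anticommute[OF A B]])
    then show ?thesis
      unfolding ac(1) bd(1) word_minus_sec_disjoint[OF X ne] .
  next
    case meet: False
    have "\<exists>a b c. A = {a, c} \<and> B = {b, c} \<and> a \<noteq> b \<and> a \<noteq> c \<and> b \<noteq> c"
    proof -
      obtain c' where c': "c' \<in> A" "c' \<in> B" using meet by blast
      have "\<exists>a'. A = {a', c'} \<and> a' \<noteq> c'" using c'(1) ac by auto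
      moreover have "\<exists>b'. B = {b', c'} \<and> b' \<noteq> c'" using c'(2) bd by auto
      ultimately show ?thesis using \<open>A \<noteq> B\<close> by blast
    qed
    then obtain a b c where AB: "A = {a, c}" "B = {b, c}" and ne: "a \<noteq> b" "a \<noteq> c" "b \<noteq> c" by blast
    have X: "a \<in> {1..n}" "b \<in> {1..n}" "c \<in> {1..n}" using A B AB by (auto simp: generators_iff)
    have G: "{a, b} \<in> generators n" "{a, c} \<in> generators n" "{b, c} \<in> generators n"
      using X ne by (auto intro!: generators_doubleton)
    show ?thesis
      unfolding AB word_minus_sec_meet[OF X ne]
      by (intro lin_add[OF lin_arnold_ideal] lin_scale[OF lin_arnold_ideal] cyc_in_arnold_ideal anticommute X ne G)
  qed
qed

lemma component_minus_sec:
  assumes f: "f \<in> tensor_component 2 n"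
  shows "(\<lambda>u. f u - sec n (theta n f) u) \<in> arnold_ideal n"
proof -
  let ?Z = "{f. (\<lambda>u. f u - sec n (theta n f) u) \<in> arnold_ideal n}"
  have th: "theta n (\<lambda>u. a * f u + b * g u) = (\<lambda>x K. a * theta n f x K + b * theta n g x K)" for a b f g
    by (simp add: theta_linear fun_eq_iff)
  \<comment> \<open>Zero is written as a multiple by 0 so that homogeneity of \<open>sec\<close>
    shows that \<open>sec\<close> maps it to zero.\<close>
  have th0: "theta n (\<lambda>u. 0) = (\<lambda>x K. 0 * theta n (\<lambda>u. 0) x K)" by (simp add: theta_linear fun_eq_iff)
  have linZ: "lin ?Z"
  proof (rule linI)
    have "sec n (theta n (\<lambda>u. 0)) = (\<lambda>u. 0)" by (subst th0, subst sec_linear(2)) simp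
    then show "(\<lambda>_. 0) \<in> ?Z" using lin_zero[OF lin_arnold_ideal] by simp
  next
    fix f g a b assume "f \<in> ?Z" "g \<in> ?Z"
    then have "(\<lambda>u. a * (f u - sec n (theta n f) u) + b * (g u - sec n (theta n g) u)) \<in> arnold_ideal n"
      using lin_comb[OF lin_arnold_ideal] by blast
    moreover have "(\<lambda>u. a * (f u - sec n (theta n f) u) + b * (g u - sec n (theta n g) u))
      = (\<lambda>u. (a * f u + b * g u) - sec n (theta n (\<lambda>u. a * f u + b * g u)) u)"
      unfolding th sec_linear by (simp add: fun_eq_iff algebra_simps)
    ultimately show "(\<lambda>u. a * f u + b * g u) \<in> ?Z" by simp
  qed
  \<comment> \<open>Expansion of \<open>f\<close> in words of length two; the set \<open>?Z\<close>
    is linear and contains the words.\<close>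
  have "(\<lambda>u. \<Sum>p\<in>generators n \<times> generators n. f [fst p, snd p] * word (fst p) (snd p) u) \<in> ?Z"
    by (rule lin_sum[OF linZ])
      (use finite_generators lin_scale[OF linZ] word_minus_sec in auto)
  moreover have "(\<Sum>p\<in>generators n \<times> generators n. f [fst p, snd p] * word (fst p) (snd p) u) = f u" for u
  proof (cases "\<exists>A\<in>generators n. \<exists>B\<in>generators n. u = [A, B]")
    case True
    then obtain A B where AB: "A \<in> generators n" "B \<in> generators n" "u = [A, B]" by blast
    have "(\<Sum>p\<in>generators n \<times> generators n. f [fst p, snd p] * word (fst p) (snd p) u)
        = (\<Sum>p\<in>generators n \<times> generators n. if p = (A, B) then f u else 0)"
      by (rule sum.cong) (auto simp: word_def basis_vector_def AB(3) prod_eq_iff simp del: generators_iff)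
    then show ?thesis using AB(1,2) finite_generators by (simp add: sum.delta)
  next
    case False
    have "f u = 0"
    proof (rule ccontr)
      assume "f u \<noteq> 0"
      then have "length u = 2" "u \<in> lists (generators n)"
        using f by (auto simp: tensor_component_def tensor_algebra_simps(1))
      then show False using False by (auto simp: length_Suc_conv numeral_2_eq_2)
    qed
    moreover have "word A B u = 0" if "A \<in> generators n" "B \<in> generators n" for A B
      using False that by (auto simp: word_def basis_vector_def)
    ultimately show ?thesis by (auto intro!: sum.neutral)
  qed
  ultimately show ?thesis by simp
qed

section \<open>Degree one: functions on two-element sets\<close>

definition model1 :: "nat \<Rightarrow> ((nat \<Rightarrow> nat) \<Rightarrow> rat) \<Rightarrow> nat set list \<Rightarrow> rat" where
  "model1 n F u = (case u of [A] \<Rightarrow> if A \<in> generators n then F (\<lambda>y. of_bool (y \<in> A)) else 0 | _ \<Rightarrow> 0)"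

lemma model1_eq: "model1 n F u = (if \<exists>A\<in>generators n. u = [A] then F (\<lambda>y. of_bool (y \<in> u ! 0)) else 0)"
  by (auto simp: model1_def split: list.splits)

lemma model1_nonzero: "model1 n F u \<noteq> 0 \<Longrightarrow> \<exists>A\<in>generators n. u = [A]"
  by (metis model1_eq)

lemma model1_component: "model1 n F \<in> tensor_component 1 n"
proof -
  have sub: "{u. model1 n F u \<noteq> 0} \<subseteq> (\<lambda>A. [A]) ` generators n" using model1_nonzero by force
  then have "finite {u. model1 n F u \<noteq> 0}" by (rule finite_subset) (simp add: finite_generators)
  moreover have "{u. model1 n F u \<noteq> 0} \<subseteq> lists (generators n)" using sub by auto
  moreover have "\<forall>u. model1 n F u \<noteq> 0 \<longrightarrow> length u = 1" using model1_nonzero by force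
  ultimately show ?thesis by (simp add: tensor_component_def tensor_algebra_simps(1))
qed

lemma model1_perm:
  assumes \<pi>: "\<pi> permutes {1..n}"
  shows "model1 n (\<lambda>c. F (c \<circ> \<pi>)) = relabel \<pi> (model1 n F)"
proof
  fix u
  let ?\<rho> = "Hilbert_Choice.inv \<pi>"
  have gen: "?\<rho> ` A \<in> generators n \<longleftrightarrow> A \<in> generators n" for A
    by (rule generators_image[OF permutes_inv[OF \<pi>]])
  have "(\<lambda>y. of_bool (y \<in> A)) \<circ> \<pi> = (\<lambda>y. of_bool (y \<in> ?\<rho> ` A) :: nat)" for A
  proof
    fix y
    have "y \<in> ?\<rho> ` A \<longleftrightarrow> \<pi> y \<in> A"
      using permutes_inverses[OF \<pi>] by (metis image_iff)
    then show "((\<lambda>y. of_bool (y \<in> A)) \<circ> \<pi>) y = (of_bool (y \<in> ?\<rho> ` A) :: nat)" by simp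
  qed
  then show "model1 n (\<lambda>c. F (c \<circ> \<pi>)) u = relabel \<pi> (model1 n F) u"
    by (auto simp: model1_def relabel_def gen split: list.split)
qed

lemma wt_indicator:
  assumes "A \<in> generators n"
  shows "(\<lambda>y. of_bool (y \<in> A)) \<in> wt n [n - 2, 2]"
proof -
  let ?c = "\<lambda>y. of_bool (y \<in> A) :: nat"
  have A: "A \<subseteq> {1..n}" "card A = 2" using assms by (auto simp: generators_iff)
  then have fin: "finite A" by (intro card_ge_0_finite) simp
  have 1: "{y \<in> {1..n}. ?c y = 1} = A" using A(1) by auto
  have 0: "{y \<in> {1..n}. ?c y = 0} = {1..n} - A" by auto
  have c0: "card {y \<in> {1..n}. ?c y = 0} = n - 2" unfolding 0 using card_Diff_subset[OF fin A(1)] A(2) by simp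
  have c1: "card {y \<in> {1..n}. ?c y = 1} = 2" unfolding 1 by (rule A(2))
  have "card {y \<in> {1..n}. ?c y = r} = [n - 2, 2] ! r" if "r < 2" for r
  proof -
    have "r = 0 \<or> r = 1" using that by arith
    then show ?thesis using c0 c1 by (elim disjE) simp_all
  qed
  moreover have "?c y = 0" if "y \<notin> {1..n}" for y using that A(1) by auto
  moreover have "?c y < 2" for y by simp
  moreover have len: "length [n - 2, 2] = 2" by simp
  ultimately show ?thesis unfolding wt_def colorings_def len by blast
qed

lemma indicator_wt:
  assumes "c \<in> wt n [a, 2]"
  obtains A where "A \<in> generators n" "c = (\<lambda>y. of_bool (y \<in> A))"
proof -
  have out: "c y = 0" if "y \<notin> {1..n}" for y using assms that unfolding wt_def colorings_def by blast
  have lt: "c y < 2" for y using assms by (simp add: wt_def colorings_def numeral_2_eq_2)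
  have "card {y \<in> {1..n}. c y = r} = [a, 2] ! r" if "r < 2" for r
    using assms that by (simp add: wt_def)
  from this[of 1] have "card {y \<in> {1..n}. c y = 1} = 2" by simp
  then have "{y \<in> {1..n}. c y = 1} \<in> generators n" unfolding generators_iff by blast
  moreover have "c = (\<lambda>y. of_bool (y \<in> {y \<in> {1..n}. c y = 1}))"
  proof
    fix y
    have "c y = 0 \<or> c y = 1" using lt[of y] by arith
    then show "c y = of_bool (y \<in> {y \<in> {1..n}. c y = 1})" using out[of y] by (cases "y \<in> {1..n}") auto
  qed
  ultimately show ?thesis using that by blast
qed

text \<open>The ideal vanishes on words of length one, so the coefficients of
  \<open>model1 n F\<close> determine \<open>F\<close>.\<close>

lemma model1_inj:
  assumes "F \<in> wspace n [n - 2, 2]" "model1 n F \<in> arnold_ideal n"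
  shows "F = (\<lambda>c. 0)"
proof
  fix c
  show "F c = 0"
  proof (cases "c \<in> wt n [n - 2, 2]")
    case True
    then obtain A where A: "A \<in> generators n" "c = (\<lambda>y. of_bool (y \<in> A))" by (rule indicator_wt)
    have "model1 n F [A] = 0" by (rule arnold_ideal_theta(1)[OF assms(2)])
    then show ?thesis using A by (simp add: model1_def)
  next
    case False
    then show ?thesis by (rule wspace_outside[OF assms(1)])
  qed
qed

lemma model1_surj:
  assumes f: "f \<in> tensor_component 1 n"
  shows "\<exists>F\<in>wspace n [n - 2, 2]. (\<lambda>u. f u - model1 n F u) \<in> arnold_ideal n"
proof -
  define F where "F c = (if c \<in> wt n [n - 2, 2] then f [{y. c y = 1}] else 0)" for c
  have "F \<in> wspace n [n - 2, 2]" by (simp add: F_def wspace_def)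
  moreover have "f u = model1 n F u" for u
  proof (cases "\<exists>A\<in>generators n. u = [A]")
    case True
    then obtain A where "A \<in> generators n" "u = [A]" by blast
    then show ?thesis using wt_indicator by (simp add: model1_def F_def)
  next
    case False
    have "f u = 0"
    proof (rule ccontr)
      assume "f u \<noteq> 0"
      then have "length u = 1" "u \<in> lists (generators n)"
        using f by (auto simp: tensor_component_def tensor_algebra_simps(1))
      then show False using False by (auto simp: length_Suc_conv)
    qed
    then show ?thesis using model1_nonzero[of n F u] False by fastforce
  qed
  ultimately show ?thesis using lin_zero[OF lin_arnold_ideal] by (intro bexI[of _ F]) simp_all
qed

section \<open>Degree two: functions on pointed sets of size three and four\<close>

definition model2 :: "nat \<Rightarrow> ((nat \<Rightarrow> nat) \<Rightarrow> rat) \<Rightarrow> nat set list \<Rightarrow> rat" where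
  "model2 n F = sec n (\<lambda>x K. F (col x K))"

text \<open>The sum of \<open>W\<^sub>2\<close> and \<open>W\<^sub>3\<close> inside one function
  space. The two summands are supported on colorings of different weights, so the sum is direct and
  a single section serves both sizes of \<open>K\<close>.\<close>

definition pspace :: "nat \<Rightarrow> ((nat \<Rightarrow> nat) \<Rightarrow> rat) set" where
  "pspace n = {\<lambda>c. F c + G c |F G. F \<in> hspace n (n - 3) 2 \<and> G \<in> hspace n (n - 4) 3}"

lemma lin_pspace: "lin (pspace n)"
proof (rule linI)
  show "(\<lambda>_. 0) \<in> pspace n"
    unfolding pspace_def using lin_zero[OF lin_hspace] by (intro CollectI exI[of _ "\<lambda>_. 0"]) auto
next
  fix f g a b assume "f \<in> pspace n" "g \<in> pspace n"
  then obtain F G F' G' where *: "F \<in> hspace n (n - 3) 2" "G \<in> hspace n (n - 4) 3"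
    "F' \<in> hspace n (n - 3) 2" "G' \<in> hspace n (n - 4) 3"
    "f = (\<lambda>c. F c + G c)" "g = (\<lambda>c. F' c + G' c)" unfolding pspace_def by blast
  have "(\<lambda>c. a * f c + b * g c) = (\<lambda>c. (a * F c + b * F' c) + (a * G c + b * G' c))"
    by (simp add: *(5,6) algebra_simps)
  then show "(\<lambda>c. a * f c + b * g c) \<in> pspace n"
    unfolding pspace_def mem_Collect_eq
    using lin_comb[OF lin_hspace *(1,3), of a b] lin_comb[OF lin_hspace *(2,4), of a b]
    by (intro exI[of _ "\<lambda>c. a * F c + b * F' c"] exI[of _ "\<lambda>c. a * G c + b * G' c"] conjI)
qed

lemma pspace_sum:
  assumes "F \<in> pspace n" "K \<subseteq> {1..n}"
  shows "(\<Sum>x\<in>K. F (col x K)) = 0"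
  using assms by (auto simp: pspace_def sum.distrib hspace_sum)

lemma pspace_outside:
  assumes "F \<in> pspace n" "c \<notin> wt n [n - 3, 2, 1]" "c \<notin> wt n [n - 4, 3, 1]"
  shows "F c = 0"
proof -
  obtain F' G' where *: "F' \<in> wspace n [n - 3, 2, 1]" "G' \<in> wspace n [n - 4, 3, 1]"
    "F = (\<lambda>c. F' c + G' c)"
    using assms(1) by (auto simp: pspace_def hspace_def)
  show ?thesis
    using wspace_outside[OF *(1) assms(2)] wspace_outside[OF *(2) assms(3)] by (simp add: *(3))
qed

lemma model2_perm:
  assumes \<pi>: "\<pi> permutes {1..n}"
  shows "model2 n (\<lambda>c. F (c \<circ> \<pi>)) = relabel \<pi> (model2 n F)"
proof
  fix u
  let ?\<rho> = "Hilbert_Choice.inv \<pi>"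
  have inj: "inj ?\<rho>" by (rule permutes_inj[OF permutes_inv[OF \<pi>]])
  have gen: "?\<rho> ` A \<in> generators n \<longleftrightarrow> A \<in> generators n" for A
    by (rule generators_image[OF permutes_inv[OF \<pi>]])
  have col: "col x K \<circ> \<pi> = col (?\<rho> x) (?\<rho> ` K)" for x K
  proof
    fix y
    have "y \<in> ?\<rho> ` K \<longleftrightarrow> \<pi> y \<in> K" "y = ?\<rho> x \<longleftrightarrow> \<pi> y = x"
      using permutes_inverses[OF \<pi>] by (metis image_iff)+
    then show "(col x K \<circ> \<pi>) y = col (?\<rho> x) (?\<rho> ` K) y" by (simp add: col_def)
  qed
  have sum: "(\<Sum>a\<in>A. F (col a K \<circ> \<pi>)) = (\<Sum>a\<in>?\<rho> ` A. F (col a (?\<rho> ` K)))" for A K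
    using inj_on_subset[OF inj, of A] by (simp add: col sum.reindex)
  have "card (?\<rho> ` K) = card K" for K
    using inj_on_subset[OF inj, of K] by (simp add: card_image)
  then show "model2 n (\<lambda>c. F (c \<circ> \<pi>)) u = relabel \<pi> (model2 n F) u"
    unfolding model2_def relabel_def
    \<comment> \<open>This case rule distinguishes words of length zero, one and at least
      two.\<close>
    by (cases u rule: remdups_adj.cases)
      (auto simp: sec_def gen sum image_Un[symmetric] split: list.splits)
qed

text \<open>\<open>theta\<close> vanishes on the ideal and recovers from \<open>model2 n F\<close>
  the values of \<open>F\<close> on all pointed sets of size three or four, where \<open>F\<close>
  is supported.\<close>

lemma model2_inj:
  assumes F: "F \<in> pspace n" and I: "model2 n F \<in> arnold_ideal n"
  shows "F = (\<lambda>c. 0)"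
proof -
  have col: "F (col x K) = 0" if "K \<subseteq> {1..n}" "x \<in> K" "card K = 3 \<or> card K = 4" for x K
    using theta_sec[OF that, of "\<lambda>x K. F (col x K)"] pspace_sum[OF F that(1)]
      arnold_ideal_theta(2)[OF I, of x K] by (simp add: model2_def)
  have "F c = 0" if c: "c \<in> wt n [a, k, 1]" and k: "k = 2 \<or> k = 3" for c a k
  proof -
    obtain x K where K: "K \<subseteq> {1..n}" "x \<in> K" "card K = Suc k" "c = col x K"
      using wt_col[OF c] by metis
    then have "card K = 3 \<or> card K = 4" using k by auto
    then show ?thesis unfolding K(4) by (rule col[OF K(1,2)])
  qed
  then show ?thesis using pspace_outside[OF F] by blast
qed

lemma card_union_generators:
  assumes "A \<in> generators n" "B \<in> generators n"
  shows "A = B \<or> card (A \<union> B) = 3 \<or> card (A \<union> B) = 4"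
proof -
  have fin: "finite A" "finite B" "card A = 2" "card B = 2"
    using assms by (auto simp: generators_iff intro: card_ge_0_finite)
  have "card (A \<union> B) + card (A \<inter> B) = 4" using card_Un_Int[OF fin(1,2)] fin by simp
  moreover have "A = B" if "card (A \<inter> B) \<ge> 2"
  proof -
    have "A \<inter> B = A" using card_seteq[of A "A \<inter> B"] that fin by simp
    then show ?thesis using card_seteq[of B A] fin by auto
  qed
  ultimately show ?thesis by fastforce
qed

lemma model2_surj:
  assumes f: "f \<in> tensor_component 2 n"
  shows "\<exists>F\<in>pspace n. (\<lambda>u. f u - model2 n F u) \<in> arnold_ideal n"
proof -
  \<comment> \<open>The function \<open>theta n f\<close> transported to colorings: the marked point
    is the entry of color 2, and \<open>K\<close> consists of the entries of nonzero color.\<close>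
  define F where "F p c = (if c \<in> wt n p then theta n f (THE x. c x = 2) {y. c y \<noteq> 0} else 0)" for p c
  have the: "(THE y. col x K y = 2) = x" for x K
    by (rule the_equality) (auto simp: col_def split: if_splits)
  have supp: "{y. col x K y \<noteq> 0} = K" if "x \<in> K" for x K
    using that by (auto simp: col_def)
  have F: "F [n - Suc k, k, 1] (col x K) = theta n f x K"
    if "K \<subseteq> {1..n}" "x \<in> K" "card K = Suc k" for x K k
    using col_wt[OF that] supp[OF that(2)] by (simp add: F_def the del: One_nat_def)
  have F': "F [a, k, 1] (col x K) = 0"
    if "K \<subseteq> {1..n}" "x \<in> K" "card K \<noteq> Suc k" for x K k a
  proof -
    have "{y \<in> {1..n}. col x K y = 1} = K - {x}" using that(1) by (auto simp: col_def)
    then have "card {y \<in> {1..n}. col x K y = 1} \<noteq> k"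
    proof -
      have fin: "finite K" using that(1) by (rule finite_subset) simp
      then have "card K > 0" using that(2) by (auto simp: card_gt_0_iff)
      then show ?thesis
        unfolding \<open>{y \<in> {1..n}. col x K y = 1} = K - {x}\<close> using that(2,3) fin by simp
    qed
    then have "col x K \<notin> wt n [a, k, 1]" by (force simp: wt_def)
    then show ?thesis by (simp add: F_def)
  qed
  have h: "F [n - Suc k, k, 1] \<in> hspace n (n - Suc k) k" for k
  proof (rule hspaceI)
    show "F [n - Suc k, k, 1] \<in> wspace n [n - Suc k, k, 1]" by (simp add: F_def wspace_def)
    fix K assume K: "K \<subseteq> {1..n}" "card K = Suc k"
    then show "(\<Sum>x\<in>K. F [n - Suc k, k, 1] (col x K)) = 0"
      using F theta_sum[of K n f] finite_subset[OF K(1)] by simp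
  qed
  let ?F = "\<lambda>c. F [n - 3, 2, 1] c + F [n - 4, 3, 1] c"
  have "?F \<in> pspace n" unfolding pspace_def using h[of 2] h[of 3] by auto
  moreover have "model2 n ?F = sec n (theta n f)"
  proof
    fix u
    show "model2 n ?F u = sec n (theta n f) u"
    proof (cases "\<exists>A\<in>generators n. \<exists>B\<in>generators n. u = [A, B]")
      case True
      then obtain A B where AB: "A \<in> generators n" "B \<in> generators n" "u = [A, B]" by blast
      have sub: "A \<union> B \<subseteq> {1..n}" using AB by (simp add: generators_iff)
      show ?thesis
      proof (cases "A = B")
        case True
        then show ?thesis using AB by (simp add: model2_def sec_def)
      next
        case False
        then have card: "card (A \<union> B) = 3 \<or> card (A \<union> B) = 4" using card_union_generators AB by blast
        have "?F (col x (A \<union> B)) = theta n f x (A \<union> B)" if "x \<in> A \<union> B" for x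
          using card F[OF sub that, of 2] F[OF sub that, of 3] F'[OF sub that, of 2] F'[OF sub that, of 3]
          by (auto simp del: One_nat_def)
        then have "(\<Sum>a\<in>A. ?F (col a (A \<union> B))) = (\<Sum>a\<in>A. theta n f a (A \<union> B))"
          "(\<Sum>b\<in>B. ?F (col b (A \<union> B))) = (\<Sum>b\<in>B. theta n f b (A \<union> B))"
          by (intro sum.cong refl; blast)+
        then show ?thesis
          unfolding model2_def AB(3) sec_pair[OF AB(1,2) refl] by (simp only:)
      qed
    next
      case False
      then have "sec n g u = 0" for g by (subst sec_eq) (rule if_not_P)
      then show ?thesis by (simp add: model2_def)
    qed
  qed
  ultimately show ?thesis using component_minus_sec[OF f] by (intro bexI[of _ ?F]) simp_all
qed

section \<open>The decompositions\<close>

definition step :: "nat \<Rightarrow> nat \<Rightarrow> ((nat \<Rightarrow> nat) \<Rightarrow> rat) \<Rightarrow> ((nat \<Rightarrow> nat) \<Rightarrow> rat) \<Rightarrow> ((nat \<Rightarrow> nat) \<Rightarrow> rat)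
    \<Rightarrow> (nat \<Rightarrow> nat) \<Rightarrow> rat" where
  "step n b F h \<kappa> = (\<lambda>c. move n 1 0 F c + point n b h c + \<kappa> c)"

lemma step_linear:
  "step n b (\<lambda>c. F c + F' c) (\<lambda>c. h c + h' c) (\<lambda>c. \<kappa> c + \<kappa>' c) = (\<lambda>c. step n b F h \<kappa> c + step n b F' h' \<kappa>' c)"
  "step n b (\<lambda>c. a * F c) (\<lambda>c. a * h c) (\<lambda>c. a * \<kappa> c) = (\<lambda>c. a * step n b F h \<kappa> c)"
  unfolding step_def move_linear point_linear by (simp_all add: algebra_simps)

lemma step_perm:
  assumes "\<pi> permutes {1..n}"
  shows "step n b (\<lambda>c. F (c \<circ> \<pi>)) (\<lambda>c. h (c \<circ> \<pi>)) (\<lambda>c. \<kappa> (c \<circ> \<pi>)) = (\<lambda>c. step n b F h \<kappa> (c \<circ> \<pi>))"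
  by (simp add: step_def move_perm[OF assms] point_perm[OF assms])

text \<open>The successor equations are hypotheses so that weights such as \<open>n - 1\<close> and
  numerals such as \<open>2\<close> can be used as they stand.\<close>

lemma step_hspace:
  assumes "A = Suc a" "B = Suc b"
    and "F \<in> hspace n A b" "h \<in> kern n [A, B]" "\<kappa> \<in> kern n [a, B, 1]"
  shows "step n B F h \<kappa> \<in> hspace n a B"
  unfolding step_def assms(2)
  by (rule lin_add[OF lin_hspace lin_add[OF lin_hspace move_hspace[OF assms(3)[unfolded assms(1)]]
    point_hspace[OF assms(4)[unfolded assms(1,2)]]] subsetD[OF kern_hspace assms(5)[unfolded assms(2)]]])

lemma step_inj:
  assumes "A = Suc a" "B = Suc b" "b \<le> a"
    and F: "F \<in> hspace n A b" "F' \<in> hspace n A b" and h: "h \<in> kern n [A, B]" "h' \<in> kern n [A, B]"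
    and \<kappa>: "\<kappa> \<in> kern n [a, B, 1]" "\<kappa>' \<in> kern n [a, B, 1]"
    and eq: "step n B F h \<kappa> = step n B F' h' \<kappa>'"
  shows "F = F' \<and> h = h' \<and> \<kappa> = \<kappa>'"
proof -
  have "move n 1 0 (\<lambda>c. F c - F' c) c + point n (Suc b) (\<lambda>c. h c - h' c) c + (\<kappa> c - \<kappa>' c) = 0" for c
    using fun_cong[OF eq, of c] unfolding step_def move_linear point_linear assms(2)
    by (simp add: algebra_simps)
  then have "(\<lambda>c. F c - F' c) = (\<lambda>c. 0)" "(\<lambda>c. h c - h' c) = (\<lambda>c. 0)" "(\<lambda>c. \<kappa> c - \<kappa>' c) = (\<lambda>c. 0)"
    using hook_unique[OF lin_diff[OF lin_hspace F[unfolded assms(1)]]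
      lin_diff[OF lin_kern h[unfolded assms(1,2)]] lin_diff[OF lin_kern \<kappa>[unfolded assms(2)]] assms(3)]
    by blast+
  then show ?thesis by (simp add: fun_eq_iff)
qed

lemma step_surj:
  assumes "A = Suc a" "B = Suc b" "f \<in> hspace n a B"
  obtains F h \<kappa> where "F \<in> hspace n A b" "h \<in> kern n [A, B]" "\<kappa> \<in> kern n [a, B, 1]" "f = step n B F h \<kappa>"
proof -
  have "f \<in> hspace n a (Suc b)" using assms(2,3) by simp
  then obtain F h \<kappa> where "F \<in> hspace n (Suc a) b" "h \<in> kern n [Suc a, Suc b]"
    "\<kappa> \<in> kern n [a, Suc b, 1]" "f = (\<lambda>c. move n 1 0 F c + point n (Suc b) h c + \<kappa> c)"
    by (rule hook_decomposition)
  then show ?thesis using that[of F h \<kappa>] unfolding assms(1,2) step_def by blast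
qed

text \<open>The number of entries of color 1, two or three, separates the supports.\<close>

lemma pspace_unique:
  assumes F: "F \<in> hspace n a 2" "F' \<in> hspace n a 2" and G: "G \<in> hspace n b 3" "G' \<in> hspace n b 3"
    and eq: "(\<lambda>c. F c + G c) = (\<lambda>c. F' c + G' c)"
  shows "F = F' \<and> G = G'"
proof -
  have disj: "c \<notin> wt n [b, 3, 1]" if "c \<in> wt n [a, 2, 1]" for c
  proof
    assume "c \<in> wt n [b, 3, 1]"
    then have "card {y \<in> {1..n}. c y = 1} = [b, 3, 1] ! 1" by (simp add: wt_def del: One_nat_def)
    moreover have "card {y \<in> {1..n}. c y = 1} = [a, 2, 1] ! 1"
      using that by (simp add: wt_def del: One_nat_def)
    ultimately show False by simp
  qed
  have Fw: "F \<in> wspace n [a, 2, 1]" "F' \<in> wspace n [a, 2, 1]" using F by (auto simp: hspace_def)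
  have Gw: "G \<in> wspace n [b, 3, 1]" "G' \<in> wspace n [b, 3, 1]" using G by (auto simp: hspace_def)
  have "F c = F' c" for c
  proof (cases "c \<in> wt n [a, 2, 1]")
    case True
    then have "G c = 0" "G' c = 0" using disj Gw wspace_outside by blast+
    then show ?thesis using fun_cong[OF eq, of c] by simp
  next
    case False
    then show ?thesis using wspace_outside[OF Fw(1)] wspace_outside[OF Fw(2)] by simp
  qed
  then have "F = F'" by blast
  then show ?thesis using eq by (simp add: fun_eq_iff)
qed

lemma antitone_1: "antitone [a]"
  by (simp add: antitone_def)

lemma antitone_2: "b \<le> a \<Longrightarrow> antitone [a, b]"
  by (auto simp: antitone_def nth_Cons' less_Suc_eq)

lemma antitone_3: "b \<le> a \<Longrightarrow> c \<le> b \<Longrightarrow> antitone [a, b, c]"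
  by (auto simp: antitone_def nth_Cons' less_Suc_eq)

definition shapes1 :: "nat \<Rightarrow> nat list list" where
  "shapes1 n = [[n], [n - 1, 1], [n - 2, 2]]"

definition shapes2 :: "nat \<Rightarrow> nat list list" where
  "shapes2 n = [[n - 1, 1], [n - 1, 1], [n - 2, 2], [n - 2, 2], [n - 2, 1, 1], [n - 2, 1, 1],
     [n - 3, 3], [n - 3, 2, 1], [n - 3, 2, 1], [n - 4, 3, 1]]"

definition assemble1 :: "nat \<Rightarrow> ((nat \<Rightarrow> nat) \<Rightarrow> rat) list \<Rightarrow> (nat \<Rightarrow> nat) \<Rightarrow> rat" where
  "assemble1 n fs = (\<lambda>c. move n 1 0 (\<lambda>c. move n 1 0 (fs ! 0) c + (fs ! 1) c) c + (fs ! 2) c)"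

text \<open>The first summand builds \<open>W\<^sub>2\<close> from zero in two stages, the second
  builds \<open>W\<^sub>3\<close> in three. Positions refer to \<open>shapes2\<close>, where equal
  shapes are adjacent: of two copies the first goes to \<open>W\<^sub>2\<close> and the second to
  \<open>W\<^sub>3\<close>, and positions 6 and 9 occur only in \<open>W\<^sub>3\<close>.\<close>

definition assemble2 :: "nat \<Rightarrow> ((nat \<Rightarrow> nat) \<Rightarrow> rat) list \<Rightarrow> (nat \<Rightarrow> nat) \<Rightarrow> rat" where
  "assemble2 n fs = (\<lambda>c.
     step n 2 (step n 1 (\<lambda>c. 0) (fs ! 0) (fs ! 4)) (fs ! 2) (fs ! 7) c +
     step n 3 (step n 2 (step n 1 (\<lambda>c. 0) (fs ! 1) (fs ! 5)) (fs ! 3) (fs ! 8)) (fs ! 6) (fs ! 9) c)"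

lemma shapes1_listset:
  "fs \<in> listset (map (kern n) (shapes1 n)) \<longleftrightarrow> (\<exists>h0 h1 h2. fs = [h0, h1, h2] \<and>
     h0 \<in> kern n [n] \<and> h1 \<in> kern n [n - 1, 1] \<and> h2 \<in> kern n [n - 2, 2])"
  by (auto simp: shapes1_def set_Cons_def)

lemma shapes2_length: "fs \<in> listset (map (kern n) (shapes2 n)) \<Longrightarrow> length fs = 10"
  by (simp only: listset_iff) (simp add: shapes2_def)

lemma shapes2_mem:
  "[h1, h1', h2, h2', \<kappa>1, \<kappa>1', h3, \<kappa>2, \<kappa>2', \<kappa>3] \<in> listset (map (kern n) (shapes2 n)) \<longleftrightarrow>
     h1 \<in> kern n [n - 1, 1] \<and> h1' \<in> kern n [n - 1, 1] \<and> h2 \<in> kern n [n - 2, 2] \<and> h2' \<in> kern n [n - 2, 2] \<and>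
     \<kappa>1 \<in> kern n [n - 2, 1, 1] \<and> \<kappa>1' \<in> kern n [n - 2, 1, 1] \<and> h3 \<in> kern n [n - 3, 3] \<and>
     \<kappa>2 \<in> kern n [n - 3, 2, 1] \<and> \<kappa>2' \<in> kern n [n - 3, 2, 1] \<and> \<kappa>3 \<in> kern n [n - 4, 3, 1]"
  unfolding shapes2_def list.map listset.simps set_Cons_def by simp

lemma list_10:
  assumes "length xs = 10"
  obtains a b c d e f g h i j where "xs = [a, b, c, d, e, f, g, h, i, j]"
proof -
  have "length xs = Suc (Suc (Suc (Suc (Suc (Suc (Suc (Suc (Suc (Suc 0)))))))))" using assms by simp
  then show ?thesis using that by (auto simp only: length_Suc_conv length_0_conv)
qed

text \<open>A single row admits no raising operator. The empty second row makes this space the start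
  of the two-row tower.\<close>

lemma kern_one_row: "kern n [n] = wspace n [n, 0]"
  using wspace_append_zero[of "[n]" n] by (simp add: kern_def)

lemma move_two_row:
  assumes "A = Suc a" "B = Suc b" "g \<in> wspace n [A, b]"
  shows "move n 1 0 g \<in> wspace n [a, B]"
  by (rule move_wspace[OF assms(3)]) (use assms(1,2) in \<open>auto simp: less_Suc_eq\<close>)

lemma two_row_inj:
  assumes "A = Suc a" "B = Suc b" "b \<le> a"
    and g: "g \<in> wspace n [A, b]" "g' \<in> wspace n [A, b]" and h: "h \<in> kern n [a, B]" "h' \<in> kern n [a, B]"
    and eq: "(\<lambda>c. move n 1 0 g c + h c) = (\<lambda>c. move n 1 0 g' c + h' c)"
  shows "g = g' \<and> h = h'"
proof -
  have "move n 1 0 (\<lambda>c. g c - g' c) c + (h c - h' c) = 0" for c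
    using fun_cong[OF eq, of c] unfolding move_linear by (simp add: algebra_simps)
  then have "(\<lambda>c. g c - g' c) = (\<lambda>c. 0)" "(\<lambda>c. h c - h' c) = (\<lambda>c. 0)"
    using two_row_unique[OF lin_diff[OF lin_wspace g[unfolded assms(1)]]
      lin_diff[OF lin_kern h[unfolded assms(2)]] assms(3)] by blast+
  then show ?thesis by (simp add: fun_eq_iff)
qed

lemma two_row_surj:
  assumes "A = Suc a" "B = Suc b" "f \<in> wspace n [a, B]"
  obtains g h where "g \<in> wspace n [A, b]" "h \<in> kern n [a, B]" "f = (\<lambda>c. move n 1 0 g c + h c)"
proof -
  have "f \<in> wspace n [a, Suc b]" using assms(2,3) by simp
  then obtain g h where "g \<in> wspace n [Suc a, b]" "h \<in> kern n [a, Suc b]"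
    "f = (\<lambda>c. move n 1 0 g c + h c)" by (rule two_row_decomposition)
  then show ?thesis using that[of g h] unfolding assms(1,2) by blast
qed

lemma assemble1_bij:
  assumes "n \<ge> 4"
  shows "bij_betw (assemble1 n) (listset (map (kern n) (shapes1 n))) (wspace n [n - 2, 2])"
proof -
  have a: "n = Suc (n - 1)" "n - 1 = Suc (n - 2)" using assms by simp_all
  have b: "1 = Suc 0" "2 = Suc 1" by simp_all
  have le: "0 \<le> n - 1" "1 \<le> n - 2" using assms by simp_all
  have asm: "assemble1 n [h0, h1, h2] = (\<lambda>c. move n 1 0 (\<lambda>c. move n 1 0 h0 c + h1 c) c + h2 c)" for h0 h1 h2
    by (simp add: assemble1_def)
  have w: "(\<lambda>c. move n 1 0 h0 c + h1 c) \<in> wspace n [n - 1, 1]"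
    if "h0 \<in> wspace n [n, 0]" "h1 \<in> kern n [n - 1, 1]" for h0 h1
    by (rule lin_add[OF lin_wspace move_two_row[OF a(1) b(1) that(1)] kern_wspace[OF that(2)]])
  show ?thesis
    unfolding bij_betw_def
  proof
    show "inj_on (assemble1 n) (listset (map (kern n) (shapes1 n)))"
    proof (rule inj_onI)
      fix fs gs assume "fs \<in> listset (map (kern n) (shapes1 n))" "gs \<in> listset (map (kern n) (shapes1 n))"
        and eq: "assemble1 n fs = assemble1 n gs"
      then obtain h0 h1 h2 g0 g1 g2 where fs: "fs = [h0, h1, h2]" "gs = [g0, g1, g2]"
        and h: "h0 \<in> wspace n [n, 0]" "h1 \<in> kern n [n - 1, 1]" "h2 \<in> kern n [n - 2, 2]"
        and g: "g0 \<in> wspace n [n, 0]" "g1 \<in> kern n [n - 1, 1]" "g2 \<in> kern n [n - 2, 2]"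
        unfolding shapes1_listset kern_one_row by blast
      have *: "(\<lambda>c. move n 1 0 h0 c + h1 c) = (\<lambda>c. move n 1 0 g0 c + g1 c) \<and> h2 = g2"
        by (rule two_row_inj[OF a(2) b(2) le(2) w[OF h(1,2)] w[OF g(1,2)] h(3) g(3)])
          (use eq in \<open>simp only: fs asm\<close>)
      have "h0 = g0 \<and> h1 = g1"
        by (rule two_row_inj[OF a(1) b(1) le(1) h(1) g(1) h(2) g(2) conjunct1[OF *]])
      then show "fs = gs" unfolding fs using * by simp
    qed
    show "assemble1 n ` listset (map (kern n) (shapes1 n)) = wspace n [n - 2, 2]"
    proof (intro equalityI subsetI)
      fix f assume "f \<in> assemble1 n ` listset (map (kern n) (shapes1 n))"
      then obtain h0 h1 h2 where f: "f = assemble1 n [h0, h1, h2]"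
        and h: "h0 \<in> wspace n [n, 0]" "h1 \<in> kern n [n - 1, 1]" "h2 \<in> kern n [n - 2, 2]"
        unfolding image_iff Bex_def shapes1_listset kern_one_row by blast
      show "f \<in> wspace n [n - 2, 2]"
        unfolding f asm
        by (rule lin_add[OF lin_wspace move_two_row[OF a(2) b(2) w[OF h(1,2)]] kern_wspace[OF h(3)]])
    next
      fix f assume f: "f \<in> wspace n [n - 2, 2]"
      obtain g h2 where g: "g \<in> wspace n [n - 1, 1]" "h2 \<in> kern n [n - 2, 2]"
        "f = (\<lambda>c. move n 1 0 g c + h2 c)" using two_row_surj[OF a(2) b(2) f] .
      obtain h0 h1 where h: "h0 \<in> wspace n [n, 0]" "h1 \<in> kern n [n - 1, 1]"
        "g = (\<lambda>c. move n 1 0 h0 c + h1 c)" using two_row_surj[OF a(1) b(1) g(1)] .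
      show "f \<in> assemble1 n ` listset (map (kern n) (shapes1 n))"
      proof (rule image_eqI)
        show "f = assemble1 n [h0, h1, h2]" by (simp only: asm g(3) h(3))
        show "[h0, h1, h2] \<in> listset (map (kern n) (shapes1 n))"
          unfolding shapes1_listset kern_one_row using g h by blast
      qed
    qed
  qed
qed

text \<open>For injectivity the two weights are separated first and then the stages are undone from
  the outermost inwards; the bounds \<open>le\<close> make each lowering operator injective.\<close>

lemma assemble2_bij:
  assumes "n \<ge> 7"
  shows "bij_betw (assemble2 n) (listset (map (kern n) (shapes2 n))) (pspace n)"
proof -
  have a: "n - 1 = Suc (n - 2)" "n - 2 = Suc (n - 3)" "n - 3 = Suc (n - 4)" using assms by simp_all
  have b: "1 = Suc 0" "2 = Suc 1" "3 = Suc 2" by simp_all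
  have le: "0 \<le> n - 2" "1 \<le> n - 3" "2 \<le> n - 4" using assms by simp_all
  have z: "(\<lambda>c. 0) \<in> hspace n (n - 1) 0" by (rule lin_zero[OF lin_hspace])
  note m1 = step_hspace[OF a(1) b(1) z] and m2 = step_hspace[OF a(2) b(2)] and m3 = step_hspace[OF a(3) b(3)]
  note i1 = step_inj[OF a(1) b(1) le(1) z z] and i2 = step_inj[OF a(2) b(2) le(2)]
    and i3 = step_inj[OF a(3) b(3) le(3)]
  \<comment> \<open>The innermost stage has no lowered part, since \<open>hspace n (n - 1) 0\<close>
    is zero.\<close>
  have s1: "\<exists>h\<in>kern n [n - 1, 1]. \<exists>\<kappa>\<in>kern n [n - 2, 1, 1]. f = step n 1 (\<lambda>c. 0) h \<kappa>"
    if "f \<in> hspace n (n - 2) 1" for f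
    using step_surj[OF a(1) b(1) that] unfolding hspace_zero by blast
  have asm: "assemble2 n [h1, h1', h2, h2', \<kappa>1, \<kappa>1', h3, \<kappa>2, \<kappa>2', \<kappa>3]
    = (\<lambda>c. step n 2 (step n 1 (\<lambda>c. 0) h1 \<kappa>1) h2 \<kappa>2 c
      + step n 3 (step n 2 (step n 1 (\<lambda>c. 0) h1' \<kappa>1') h2' \<kappa>2') h3 \<kappa>3 c)"
    for h1 h1' h2 h2' \<kappa>1 \<kappa>1' h3 \<kappa>2 \<kappa>2' \<kappa>3
    by (simp add: assemble2_def)
  show ?thesis
    unfolding bij_betw_def
  proof
    show "inj_on (assemble2 n) (listset (map (kern n) (shapes2 n)))"
    proof (rule inj_onI)
      fix fs gs assume mem: "fs \<in> listset (map (kern n) (shapes2 n))" "gs \<in> listset (map (kern n) (shapes2 n))"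
        and eq: "assemble2 n fs = assemble2 n gs"
      obtain h1 h1' h2 h2' \<kappa>1 \<kappa>1' h3 \<kappa>2 \<kappa>2' \<kappa>3 where
        fs: "fs = [h1, h1', h2, h2', \<kappa>1, \<kappa>1', h3, \<kappa>2, \<kappa>2', \<kappa>3]"
        using list_10[OF shapes2_length[OF mem(1)]] by metis
      obtain g1 g1' g2 g2' \<mu>1 \<mu>1' g3 \<mu>2 \<mu>2' \<mu>3 where
        gs: "gs = [g1, g1', g2, g2', \<mu>1, \<mu>1', g3, \<mu>2, \<mu>2', \<mu>3]"
        using list_10[OF shapes2_length[OF mem(2)]] by metis
      have h: "h1 \<in> kern n [n - 1, 1]" "h1' \<in> kern n [n - 1, 1]" "h2 \<in> kern n [n - 2, 2]"
          "h2' \<in> kern n [n - 2, 2]" "\<kappa>1 \<in> kern n [n - 2, 1, 1]" "\<kappa>1' \<in> kern n [n - 2, 1, 1]"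
          "h3 \<in> kern n [n - 3, 3]" "\<kappa>2 \<in> kern n [n - 3, 2, 1]" "\<kappa>2' \<in> kern n [n - 3, 2, 1]" "\<kappa>3 \<in> kern n [n - 4, 3, 1]"
        using mem(1) unfolding fs shapes2_mem by blast+
      have g: "g1 \<in> kern n [n - 1, 1]" "g1' \<in> kern n [n - 1, 1]" "g2 \<in> kern n [n - 2, 2]"
          "g2' \<in> kern n [n - 2, 2]" "\<mu>1 \<in> kern n [n - 2, 1, 1]" "\<mu>1' \<in> kern n [n - 2, 1, 1]"
          "g3 \<in> kern n [n - 3, 3]" "\<mu>2 \<in> kern n [n - 3, 2, 1]" "\<mu>2' \<in> kern n [n - 3, 2, 1]" "\<mu>3 \<in> kern n [n - 4, 3, 1]"
        using mem(2) unfolding gs shapes2_mem by blast+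
      note hl1 = m1[OF h(1,5)] m1[OF g(1,5)] and hl1' = m1[OF h(2,6)] m1[OF g(2,6)]
      note hl2' = m2[OF hl1'(1) h(4,9)] m2[OF hl1'(2) g(4,9)]
      have *: "step n 2 (step n 1 (\<lambda>c. 0) h1 \<kappa>1) h2 \<kappa>2 = step n 2 (step n 1 (\<lambda>c. 0) g1 \<mu>1) g2 \<mu>2 \<and>
        step n 3 (step n 2 (step n 1 (\<lambda>c. 0) h1' \<kappa>1') h2' \<kappa>2') h3 \<kappa>3
          = step n 3 (step n 2 (step n 1 (\<lambda>c. 0) g1' \<mu>1') g2' \<mu>2') g3 \<mu>3"
        by (rule pspace_unique[OF m2[OF hl1(1) h(3,8)] m2[OF hl1(2) g(3,8)]
          m3[OF hl2'(1) h(7,10)] m3[OF hl2'(2) g(7,10)]]) (use eq in \<open>simp only: fs gs asm\<close>)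
      have e2: "step n 1 (\<lambda>c. 0) h1 \<kappa>1 = step n 1 (\<lambda>c. 0) g1 \<mu>1 \<and> h2 = g2 \<and> \<kappa>2 = \<mu>2"
        by (rule i2[OF hl1 h(3) g(3) h(8) g(8) conjunct1[OF *]])
      have e1: "h1 = g1 \<and> \<kappa>1 = \<mu>1"
        using i1[OF h(1) g(1) h(5) g(5)] e2 by blast
      have e3: "step n 2 (step n 1 (\<lambda>c. 0) h1' \<kappa>1') h2' \<kappa>2' = step n 2 (step n 1 (\<lambda>c. 0) g1' \<mu>1') g2' \<mu>2'
          \<and> h3 = g3 \<and> \<kappa>3 = \<mu>3"
        by (rule i3[OF hl2' h(7) g(7) h(10) g(10) conjunct2[OF *]])
      have e2': "step n 1 (\<lambda>c. 0) h1' \<kappa>1' = step n 1 (\<lambda>c. 0) g1' \<mu>1' \<and> h2' = g2' \<and> \<kappa>2' = \<mu>2'"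
        by (rule i2[OF hl1' h(4) g(4) h(9) g(9) conjunct1[OF e3]])
      have e1': "h1' = g1' \<and> \<kappa>1' = \<mu>1'"
        using i1[OF h(2) g(2) h(6) g(6)] e2' by blast
      show "fs = gs" unfolding fs gs using e1 e1' e2 e2' e3 by simp
    qed
    show "assemble2 n ` listset (map (kern n) (shapes2 n)) = pspace n"
    proof (intro equalityI subsetI)
      fix f assume "f \<in> assemble2 n ` listset (map (kern n) (shapes2 n))"
      then obtain fs where mem: "fs \<in> listset (map (kern n) (shapes2 n))" and f: "f = assemble2 n fs" by blast
      obtain h1 h1' h2 h2' \<kappa>1 \<kappa>1' h3 \<kappa>2 \<kappa>2' \<kappa>3 where
        fs: "fs = [h1, h1', h2, h2', \<kappa>1, \<kappa>1', h3, \<kappa>2, \<kappa>2', \<kappa>3]"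
        using list_10[OF shapes2_length[OF mem]] by metis
      have h: "h1 \<in> kern n [n - 1, 1]" "h1' \<in> kern n [n - 1, 1]" "h2 \<in> kern n [n - 2, 2]"
          "h2' \<in> kern n [n - 2, 2]" "\<kappa>1 \<in> kern n [n - 2, 1, 1]" "\<kappa>1' \<in> kern n [n - 2, 1, 1]"
          "h3 \<in> kern n [n - 3, 3]" "\<kappa>2 \<in> kern n [n - 3, 2, 1]" "\<kappa>2' \<in> kern n [n - 3, 2, 1]" "\<kappa>3 \<in> kern n [n - 4, 3, 1]"
        using mem unfolding fs shapes2_mem by blast+
      show "f \<in> pspace n"
        unfolding f fs asm pspace_def
        using m2[OF m1[OF h(1,5)] h(3,8)] m3[OF m2[OF m1[OF h(2,6)] h(4,9)] h(7,10)] by blast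
    next
      fix f assume "f \<in> pspace n"
      then obtain F G where FG: "F \<in> hspace n (n - 3) 2" "G \<in> hspace n (n - 4) 3" "f = (\<lambda>c. F c + G c)"
        unfolding pspace_def by blast
      obtain F1 h2 \<kappa>2 where F: "F1 \<in> hspace n (n - 2) 1" "h2 \<in> kern n [n - 2, 2]" "\<kappa>2 \<in> kern n [n - 3, 2, 1]"
        "F = step n 2 F1 h2 \<kappa>2" using step_surj[OF a(2) b(2) FG(1)] .
      obtain G2 h3 \<kappa>3 where G: "G2 \<in> hspace n (n - 3) 2" "h3 \<in> kern n [n - 3, 3]" "\<kappa>3 \<in> kern n [n - 4, 3, 1]"
        "G = step n 3 G2 h3 \<kappa>3" using step_surj[OF a(3) b(3) FG(2)] .
      obtain G1 h2' \<kappa>2' where G': "G1 \<in> hspace n (n - 2) 1" "h2' \<in> kern n [n - 2, 2]" "\<kappa>2' \<in> kern n [n - 3, 2, 1]"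
        "G2 = step n 2 G1 h2' \<kappa>2'" using step_surj[OF a(2) b(2) G(1)] .
      obtain h1 \<kappa>1 where F1: "h1 \<in> kern n [n - 1, 1]" "\<kappa>1 \<in> kern n [n - 2, 1, 1]" "F1 = step n 1 (\<lambda>c. 0) h1 \<kappa>1"
        using s1[OF F(1)] by blast
      obtain h1' \<kappa>1' where G1: "h1' \<in> kern n [n - 1, 1]" "\<kappa>1' \<in> kern n [n - 2, 1, 1]" "G1 = step n 1 (\<lambda>c. 0) h1' \<kappa>1'"
        using s1[OF G'(1)] by blast
      show "f \<in> assemble2 n ` listset (map (kern n) (shapes2 n))"
      proof (rule image_eqI)
        show "f = assemble2 n [h1, h1', h2, h2', \<kappa>1, \<kappa>1', h3, \<kappa>2, \<kappa>2', \<kappa>3]"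
          by (simp add: asm FG(3) F(4) G(4) G'(4) F1(3) G1(3))
        show "[h1, h1', h2, h2', \<kappa>1, \<kappa>1', h3, \<kappa>2, \<kappa>2', \<kappa>3] \<in> listset (map (kern n) (shapes2 n))"
          unfolding shapes2_mem using F G G' F1 G1 by blast
      qed
    qed
  qed
qed

lemma assemble1_linear:
  assumes "length fs = 3" "length gs = 3"
  shows "assemble1 n (map2 (\<lambda>f g c. f c + g c) fs gs) = (\<lambda>c. assemble1 n fs c + assemble1 n gs c)"
    and "assemble1 n (map (\<lambda>f c. a * f c) fs) = (\<lambda>c. a * assemble1 n fs c)"
    and "\<pi> permutes {1..n} \<Longrightarrow> assemble1 n (map (\<lambda>f c. f (c \<circ> \<pi>)) fs) = (\<lambda>c. assemble1 n fs (c \<circ> \<pi>))"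
  using assms by (simp_all add: assemble1_def move_linear move_perm algebra_simps)

lemma assemble2_linear:
  assumes "length fs = 10" "length gs = 10"
  shows "assemble2 n (map2 (\<lambda>f g c. f c + g c) fs gs) = (\<lambda>c. assemble2 n fs c + assemble2 n gs c)"
    and "assemble2 n (map (\<lambda>f c. a * f c) fs) = (\<lambda>c. a * assemble2 n fs c)"
    and "\<pi> permutes {1..n} \<Longrightarrow> assemble2 n (map (\<lambda>f c. f (c \<circ> \<pi>)) fs) = (\<lambda>c. assemble2 n fs (c \<circ> \<pi>))"
proof -
  have s: "step n 1 (\<lambda>c. 0) (\<lambda>c. h c + h' c) (\<lambda>c. \<kappa> c + \<kappa>' c)
      = (\<lambda>c. step n 1 (\<lambda>c. 0) h \<kappa> c + step n 1 (\<lambda>c. 0) h' \<kappa>' c)"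
    "step n 1 (\<lambda>c. 0) (\<lambda>c. a * h c) (\<lambda>c. a * \<kappa> c) = (\<lambda>c. a * step n 1 (\<lambda>c. 0) h \<kappa> c)" for h h' \<kappa> \<kappa>'
    using step_linear(1)[of n 1 "\<lambda>c. 0" "\<lambda>c. 0" h h' \<kappa> \<kappa>'] step_linear(2)[of n 1 a "\<lambda>c. 0" h \<kappa>] by simp_all
  have p: "step n 1 (\<lambda>c. 0) (\<lambda>c. h (c \<circ> \<pi>)) (\<lambda>c. \<kappa> (c \<circ> \<pi>)) = (\<lambda>c. step n 1 (\<lambda>c. 0) h \<kappa> (c \<circ> \<pi>))"
    if "\<pi> permutes {1..n}" for h \<kappa>
    using step_perm[OF that, of 1 "\<lambda>c. 0" h \<kappa>] by simp
  show "assemble2 n (map2 (\<lambda>f g c. f c + g c) fs gs) = (\<lambda>c. assemble2 n fs c + assemble2 n gs c)"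
    "assemble2 n (map (\<lambda>f c. a * f c) fs) = (\<lambda>c. a * assemble2 n fs c)"
    using assms by (simp_all add: assemble2_def step_linear s[simplified] algebra_simps)
  show "assemble2 n (map (\<lambda>f c. f (c \<circ> \<pi>)) fs) = (\<lambda>c. assemble2 n fs (c \<circ> \<pi>))" if "\<pi> permutes {1..n}"
    using assms by (simp add: assemble2_def step_perm[OF that] p[OF that, simplified])
qed

theorem theoremB:
  shows "(\<forall>n\<ge>4. sn_iso n (arnold_component 1 n) (direct_sum [V n [0], V n [1], V n [2]])) \<and>
    (\<forall>n\<ge>7. sn_iso n (arnold_component 2 n) (direct_sum
       (replicate 2 (V n [1]) @ replicate 2 (V n [2]) @ replicate 2 (V n [1, 1]) @
        [V n [3]] @ replicate 2 (V n [2, 1]) @ [V n [3, 1]])))"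
proof (intro conjI allI impI)
  fix n :: nat assume n: "n \<ge> 4"
  have len: "length fs = 3" if "fs \<in> listset (map (kern n) (shapes1 n))" for fs
    using that by (auto simp: shapes1_listset)
  have "sn_iso n (arnold_component 1 n) (direct_sum (map specht (shapes1 n)))"
  proof (rule arnold_component_iso[OF _ lin_wspace model1_component _ _ _ model1_inj model1_surj assemble1_bij[OF n]])
    fix p assume "p \<in> set (shapes1 n)"
    \<comment> \<open>The bound 4 enters as \<open>2 \<le> n - 2\<close>.\<close>
    then show "p \<noteq> [] \<and> antitone p \<and> sum_list p = n"
      using n by (auto simp: shapes1_def antitone_1 antitone_2)
  next
    show "model1 n (\<lambda>c. F c + G c) = (\<lambda>u. model1 n F u + model1 n G u)" for F G
      by (auto simp: model1_eq fun_eq_iff)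
    show "model1 n (\<lambda>c. a * F c) = (\<lambda>u. a * model1 n F u)" for a F
      by (auto simp: model1_eq fun_eq_iff)
    show "model1 n (\<lambda>c. F (c \<circ> \<pi>)) = relabel \<pi> (model1 n F)" if "\<pi> permutes {1..n}" for \<pi> F
      by (rule model1_perm[OF that])
  next
    fix fs gs assume *: "fs \<in> listset (map (kern n) (shapes1 n))" "gs \<in> listset (map (kern n) (shapes1 n))"
    show "assemble1 n (map2 (\<lambda>f g c. f c + g c) fs gs) = (\<lambda>c. assemble1 n fs c + assemble1 n gs c)"
      by (rule assemble1_linear(1)[OF len[OF *(1)] len[OF *(2)]])
  next
    fix fs a assume *: "fs \<in> listset (map (kern n) (shapes1 n))"
    show "assemble1 n (map (\<lambda>f c. a * f c) fs) = (\<lambda>c. a * assemble1 n fs c)"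
      by (rule assemble1_linear(2)[OF len[OF *] len[OF *]])
  next
    fix \<pi> fs assume *: "\<pi> permutes {1..n}" "fs \<in> listset (map (kern n) (shapes1 n))"
    show "assemble1 n (map (\<lambda>f c. f (c \<circ> \<pi>)) fs) = (\<lambda>c. assemble1 n fs (c \<circ> \<pi>))"
      by (rule assemble1_linear(3)[OF len[OF *(2)] len[OF *(2)] *(1)])
  qed
  moreover have "map specht (shapes1 n) = [V n [0], V n [1], V n [2]]"
    by (simp add: shapes1_def V_def)
  ultimately show "sn_iso n (arnold_component 1 n) (direct_sum [V n [0], V n [1], V n [2]])" by simp
next
  fix n :: nat assume n: "n \<ge> 7"
  have len: "length fs = 10" if "fs \<in> listset (map (kern n) (shapes2 n))" for fs
    by (rule shapes2_length[OF that])
  have "sn_iso n (arnold_component 2 n) (direct_sum (map specht (shapes2 n)))"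
  proof (rule arnold_component_iso[OF _ lin_pspace _ _ _ _ model2_inj model2_surj assemble2_bij[OF n]])
    fix p assume "p \<in> set (shapes2 n)"
    \<comment> \<open>The bound 7 enters as \<open>3 \<le> n - 4\<close>.\<close>
    then show "p \<noteq> [] \<and> antitone p \<and> sum_list p = n"
      using n by (auto simp: shapes2_def antitone_2 antitone_3)
  next
    show "model2 n F \<in> tensor_component 2 n" for F
      unfolding model2_def by (rule sec_component)
    show "model2 n (\<lambda>c. F c + G c) = (\<lambda>u. model2 n F u + model2 n G u)" for F G
      unfolding model2_def by (rule sec_linear)
    show "model2 n (\<lambda>c. a * F c) = (\<lambda>u. a * model2 n F u)" for a F
      unfolding model2_def by (rule sec_linear)
    show "model2 n (\<lambda>c. F (c \<circ> \<pi>)) = relabel \<pi> (model2 n F)" if "\<pi> permutes {1..n}" for \<pi> F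
      by (rule model2_perm[OF that])
  next
    fix fs gs assume *: "fs \<in> listset (map (kern n) (shapes2 n))" "gs \<in> listset (map (kern n) (shapes2 n))"
    show "assemble2 n (map2 (\<lambda>f g c. f c + g c) fs gs) = (\<lambda>c. assemble2 n fs c + assemble2 n gs c)"
      by (rule assemble2_linear(1)[OF len[OF *(1)] len[OF *(2)]])
  next
    fix fs a assume *: "fs \<in> listset (map (kern n) (shapes2 n))"
    show "assemble2 n (map (\<lambda>f c. a * f c) fs) = (\<lambda>c. a * assemble2 n fs c)"
      by (rule assemble2_linear(2)[OF len[OF *] len[OF *]])
  next
    fix \<pi> fs assume *: "\<pi> permutes {1..n}" "fs \<in> listset (map (kern n) (shapes2 n))"
    show "assemble2 n (map (\<lambda>f c. f (c \<circ> \<pi>)) fs) = (\<lambda>c. assemble2 n fs (c \<circ> \<pi>))"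
      by (rule assemble2_linear(3)[OF len[OF *(2)] len[OF *(2)] *(1)])
  qed
  moreover have "map specht (shapes2 n) = replicate 2 (V n [1]) @ replicate 2 (V n [2]) @
      replicate 2 (V n [1, 1]) @ [V n [3]] @ replicate 2 (V n [2, 1]) @ [V n [3, 1]]"
    by (simp add: shapes2_def V_def numeral_2_eq_2 numeral_3_eq_3 eval_nat_numeral)
  ultimately show "sn_iso n (arnold_component 2 n) (direct_sum
       (replicate 2 (V n [1]) @ replicate 2 (V n [2]) @ replicate 2 (V n [1, 1]) @
        [V n [3]] @ replicate 2 (V n [2, 1]) @ [V n [3, 1]]))" by simp
qed

end
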